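(* Let $\Omega\subset\mathbb{R}^n$ be a bounded connected open set with smooth boundary. Let $\varepsilon_i\in(0,1)$ with $\varepsilon_i\to0$, and let $\{u_{\varepsilon_i}\}_{i=1}^\infty\subset W^{1,2}(\Omega;[-1,1])$ be classical solutions of $J_{\varepsilon_i}$ in $\Omega$ such that (1) $J_{\varepsilon_i}(u_{\varepsilon_i})\le E_0<\infty$ for all $i$; (2) there exists $c>0$ such that, for all $i$, $J_{\varepsilon_i}(u_{\varepsilon_i})\le J_{\varepsilon_i}(\tilde u)$ for all $\tilde u\in W^{1,2}(\Omega;[-1,1])$ with $\int_\Omega|u_{\varepsilon_i}-\tilde u|<c$. Let $V_i$ be the varifold associated with $u_{\varepsilon_i}$, and let $u_0\in BV(\Omega;\{\pm1\})$ and $V$ be limits along a subsequence (not relabeled), i.e. $u_{\varepsilon_i}\to u_0$ a.e. in $\Omega$ and $V_i\to V$ as varifolds. Then for any $\tilde u\in BV(\Omega;\{\pm1\})$ with $\int_\Omega|u_0-\tilde u|<c$ we have $J_0(u_0)\le J_0(\tilde u)$, and $$\operatorname{spt}\|V\|=\operatorname{spt}|\partial\{u_0=1\}|.$$ Additionally, if $\|D^2u_{\varepsilon_i}\|_{L^\infty}\le C\varepsilon_i^{-2}$ for all $i$ with $C$ independent of $i$, then $4^{-1}\|V\|=|\partial\{u_0=1\}|$.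
   Context: Energies: $J_\varepsilon(u)=\int_\Omega\left(\varepsilon|\nabla u|^2+\frac{\chi_{(-1,1)}(u)}{\varepsilon}\right)dx$ for $\varepsilon>0$, with $\chi_{(-1,1)}$ the indicator function of $(-1,1)$; $J_0(u)=2\int_\Omega|\nabla u|$ (total variation) if $u\in BV(\Omega;\{\pm1\})$ and $J_0(u)=+\infty$ otherwise, where $BV(\Omega;\{\pm1\})$ is the set of BV functions with values a.e. in $\{\pm1\}$. Classical solution: a (continuous) function $u:\Omega\to[-1,1]$ is a classical solution of $J_\varepsilon$ in $\Omega$ if $\Delta u=0$ in $\Omega\cap\{|u|<1\}$, $|\nabla u|=1/\varepsilon$ on $\Omega\cap\partial\{|u|<1\}$ (gradient taken from inside $\{|u|<1\}$), and $\partial\{|u|<1\}$ is locally a $C^1$ surface. $D^2u$ denotes the pointwise Hessian off the free boundary $\partial\{|u|<1\}$, so the $L^\infty$ bound is a bound on the Hessian in $\{|u|<1\}$. Varifolds: an $(n-1)$-dimensional varifold in $\Omega$ is a Radon measure on $\Omega\times G(n,n-1)$, with $G(n,n-1)$ the Grassmannian of unoriented $(n-1)$-dimensional subspaces of $\mathbb{R}^n$, identified with orthogonal projections; convergence is convergence of Radon measures, and the weight is $\|V\|(A)=V(A\times G(n,n-1))$. The varifold associated with $u_{\varepsilon_i}$ is $$V_i(\phi)=\int_{\{|\nabla u_{\varepsilon_i}|\ne0\}}\phi\left(x,I-\frac{\nabla u_{\varepsilon_i}}{|\nabla u_{\varepsilon_i}|}\otimes\frac{\nabla u_{\varepsilon_i}}{|\nabla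 u_{\varepsilon_i}|}\right)\left(\varepsilon_i|\nabla u_{\varepsilon_i}|^2+\frac{\chi_{(-1,1)}(u_{\varepsilon_i})}{\varepsilon_i}\right)dx,\quad \phi\in C_c(\Omega\times G(n,n-1)).$$ $|\partial\{u_0=1\}|$ is the perimeter measure of $\{u_0=1\}$ in $\Omega$, i.e. $\mathcal{H}^{n-1}$ restricted to the reduced boundary $\partial^*\{u_0=1\}$. *)

theory Defs
  imports "HOL-Analysis.Analysis"
begin

section \<open>Differential calculus and regularity classes\<close>

text \<open>\<open>Ck_on k f S\<close> is meant for open \<open>S\<close>, so that \<open>differentiable_on\<close> and the unrestricted
  Frechet derivative agree.\<close>

fun Ck_on :: "nat \<Rightarrow> ('a::euclidean_space \<Rightarrow> 'b::real_normed_vector) \<Rightarrow> 'a set \<Rightarrow> bool" where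
  "Ck_on 0 f S \<longleftrightarrow> continuous_on S f"
| "Ck_on (Suc k) f S \<longleftrightarrow>
     f differentiable_on S \<and> (\<forall>v. Ck_on k (\<lambda>x. frechet_derivative f (at x) v) S)"

definition smooth_on :: "('a::euclidean_space \<Rightarrow> 'b::real_normed_vector) \<Rightarrow> 'a set \<Rightarrow> bool" where
  "smooth_on f S \<longleftrightarrow> (\<forall>k. Ck_on k f S)"

definition partial :: "'n \<Rightarrow> (real ^ 'n \<Rightarrow> real) \<Rightarrow> real ^ 'n::finite \<Rightarrow> real" where
  "partial i f x = frechet_derivative f (at x) (axis i 1)"

definition grad :: "(real ^ 'n \<Rightarrow> real) \<Rightarrow> real ^ 'n::finite \<Rightarrow> real ^ 'n" where
  "grad f x = (\<chi> i. partial i f x)"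

definition laplacian :: "(real ^ 'n \<Rightarrow> real) \<Rightarrow> real ^ 'n::finite \<Rightarrow> real" where
  "laplacian f x = (\<Sum>i\<in>UNIV. partial i (partial i f) x)"

definition hessian :: "(real ^ 'n \<Rightarrow> real) \<Rightarrow> real ^ 'n::finite \<Rightarrow> real ^ 'n ^ 'n" where
  "hessian f x = (\<chi> i j. partial i (partial j f) x)"

definition divergence :: "(real ^ 'n \<Rightarrow> real ^ 'n) \<Rightarrow> real ^ 'n::finite \<Rightarrow> real" where
  "divergence F x = (\<Sum>i\<in>UNIV. partial i (\<lambda>y. F y $ i) x)"

definition compactly_supported_in ::
    "('a::topological_space \<Rightarrow> 'b::zero) \<Rightarrow> 'a set \<Rightarrow> bool" where
  "compactly_supported_in f U \<longleftrightarrow>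
     compact (closure {x. f x \<noteq> 0}) \<and> closure {x. f x \<noteq> 0} \<subseteq> U"

text \<open>Near each boundary point the set is the side \<open>g < 0\<close> of a regular level set of a smooth
  function, so it lies locally on one side of its boundary.\<close>

definition smooth_boundary :: "(real ^ 'n::finite) set \<Rightarrow> bool" where
  "smooth_boundary \<Omega> \<longleftrightarrow>
     (\<forall>x\<in>frontier \<Omega>. \<exists>N g. open N \<and> x \<in> N \<and> smooth_on g N \<and> (\<forall>y\<in>N. grad g y \<noteq> 0) \<and>
        \<Omega> \<inter> N = {y \<in> N. g y < 0})"

text \<open>Embedded \<open>C\<^sup>1\<close> hypersurface, without reference to its sides.\<close>

definition locally_C1_surface :: "(real ^ 'n::finite) set \<Rightarrow> bool" where
  "locally_C1_surface S \<longleftrightarrow>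
     (\<forall>x\<in>S. \<exists>N g. open N \<and> x \<in> N \<and> Ck_on 1 g N \<and> (\<forall>y\<in>N. grad g y \<noteq> 0) \<and>
        S \<inter> N = {y \<in> N. g y = 0})"


section \<open>Sobolev and BV functions\<close>

text \<open>Functions on \<open>\<Omega>\<close> are total functions whose values outside \<open>\<Omega>\<close> are irrelevant.\<close>

definition locally_integrable_on ::
    "(real ^ 'n::finite \<Rightarrow> 'b::euclidean_space) \<Rightarrow> (real ^ 'n) set \<Rightarrow> bool" where
  "locally_integrable_on f \<Omega> \<longleftrightarrow> (\<forall>K. compact K \<and> K \<subseteq> \<Omega> \<longrightarrow> set_integrable lebesgue K f)"

definition is_weak_grad ::
    "(real ^ 'n::finite) set \<Rightarrow> (real ^ 'n \<Rightarrow> real) \<Rightarrow> (real ^ 'n \<Rightarrow> real ^ 'n) \<Rightarrow> bool" where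
  "is_weak_grad \<Omega> u g \<longleftrightarrow> locally_integrable_on g \<Omega> \<and>
     (\<forall>\<phi> i. smooth_on \<phi> UNIV \<and> compactly_supported_in \<phi> \<Omega> \<longrightarrow>
        set_lebesgue_integral lebesgue \<Omega> (\<lambda>x. u x * partial i \<phi> x) =
        - set_lebesgue_integral lebesgue \<Omega> (\<lambda>x. g x $ i * \<phi> x))"

text \<open>A weak gradient is unique up to null sets; one representative is chosen.\<close>

definition weak_grad ::
    "(real ^ 'n::finite) set \<Rightarrow> (real ^ 'n \<Rightarrow> real) \<Rightarrow> real ^ 'n \<Rightarrow> real ^ 'n" where
  "weak_grad \<Omega> u = (SOME g. is_weak_grad \<Omega> u g)"

definition W12 :: "(real ^ 'n::finite) set \<Rightarrow> (real ^ 'n \<Rightarrow> real) set" where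
  "W12 \<Omega> = {u. locally_integrable_on u \<Omega> \<and> set_integrable lebesgue \<Omega> (\<lambda>x. (u x)\<^sup>2) \<and>
     (\<exists>g. is_weak_grad \<Omega> u g \<and> set_integrable lebesgue \<Omega> (\<lambda>x. (norm (g x))\<^sup>2))}"

definition W12_unit :: "(real ^ 'n::finite) set \<Rightarrow> (real ^ 'n \<Rightarrow> real) set" where
  "W12_unit \<Omega> = {u \<in> W12 \<Omega>. AE x in lebesgue. x \<in> \<Omega> \<longrightarrow> u x \<in> {-1..1}}"

text \<open>Total variation of \<open>f\<close> in the open set \<open>U\<close>. The field \<open>0\<close> is admissible, so truncating
  negative values by \<open>ennreal\<close> does not change the supremum.\<close>

definition variation :: "(real ^ 'n::finite) set \<Rightarrow> (real ^ 'n \<Rightarrow> real) \<Rightarrow> ennreal" where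
  "variation U f =
     (SUP \<phi> \<in> {\<phi> :: real ^ 'n \<Rightarrow> real ^ 'n.
                 Ck_on 1 \<phi> UNIV \<and> compactly_supported_in \<phi> U \<and> (\<forall>x. norm (\<phi> x) \<le> 1)}.
        ennreal (set_lebesgue_integral lebesgue U (\<lambda>x. f x * divergence \<phi> x)))"

definition BV :: "(real ^ 'n::finite) set \<Rightarrow> (real ^ 'n \<Rightarrow> real) set" where
  "BV \<Omega> = {u. set_integrable lebesgue \<Omega> u \<and> variation \<Omega> u < \<infinity>}"

definition BV_pm1 :: "(real ^ 'n::finite) set \<Rightarrow> (real ^ 'n \<Rightarrow> real) set" where
  "BV_pm1 \<Omega> = {u \<in> BV \<Omega>. AE x in lebesgue. x \<in> \<Omega> \<longrightarrow> u x \<in> {-1, 1}}"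

text \<open>The perimeter measure of \<open>E\<close> in the open set \<open>\<Omega>\<close>: the total variation measure of the
  distributional derivative of the indicator of \<open>E\<close>, given on open sets by \<open>variation\<close> and
  extended to Borel sets by outer regularity (a Borel measure by De Giorgi--Letta).\<close>

definition perimeter_measure ::
    "(real ^ 'n::finite) set \<Rightarrow> (real ^ 'n) set \<Rightarrow> (real ^ 'n) measure" where
  "perimeter_measure \<Omega> E =
     measure_of \<Omega> (sets (restrict_space borel \<Omega>))
       (\<lambda>A. INF U \<in> {U. open U \<and> A \<subseteq> U \<and> U \<subseteq> \<Omega>}. variation U (indicator E))"


section \<open>The energies and classical solutions\<close>

definition energy_density ::
    "(real ^ 'n::finite) set \<Rightarrow> real \<Rightarrow> (real ^ 'n \<Rightarrow> real) \<Rightarrow> real ^ 'n \<Rightarrow> real" where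
  "energy_density \<Omega> \<epsilon> u x =
     \<epsilon> * (norm (weak_grad \<Omega> u x))\<^sup>2 + indicator {-1<..<1} (u x) / \<epsilon>"

definition J :: "(real ^ 'n::finite) set \<Rightarrow> real \<Rightarrow> (real ^ 'n \<Rightarrow> real) \<Rightarrow> ennreal" where
  "J \<Omega> \<epsilon> u = (\<integral>\<^sup>+x\<in>\<Omega>. ennreal (energy_density \<Omega> \<epsilon> u x) \<partial>lebesgue)"

definition J0 :: "(real ^ 'n::finite) set \<Rightarrow> (real ^ 'n \<Rightarrow> real) \<Rightarrow> ennreal" where
  "J0 \<Omega> u = (if u \<in> BV_pm1 \<Omega> then 2 * variation \<Omega> u else \<infinity>)"

definition transition_set :: "(real ^ 'n::finite) set \<Rightarrow> (real ^ 'n \<Rightarrow> real) \<Rightarrow> (real ^ 'n) set" where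
  "transition_set \<Omega> u = {x \<in> \<Omega>. \<bar>u x\<bar> < 1}"

text \<open>The gradient on the free boundary is the limit from inside \<open>{\<bar>u\<bar> < 1}\<close>. Only its norm is
  required to converge, since \<open>{\<bar>u\<bar> < 1}\<close> may lie on both sides of the free boundary, with
  opposite gradients.\<close>

definition classical_solution ::
    "(real ^ 'n::finite) set \<Rightarrow> real \<Rightarrow> (real ^ 'n \<Rightarrow> real) \<Rightarrow> bool" where
  "classical_solution \<Omega> \<epsilon> u \<longleftrightarrow>
     continuous_on \<Omega> u \<and> (\<forall>x\<in>\<Omega>. u x \<in> {-1..1}) \<and>
     Ck_on 2 u (transition_set \<Omega> u) \<and> (\<forall>x\<in>transition_set \<Omega> u. laplacian u x = 0) \<and>
     (\<forall>x\<in>\<Omega> \<inter> frontier (transition_set \<Omega> u).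
        ((\<lambda>y. norm (grad u y)) \<longlongrightarrow> 1 / \<epsilon>) (at x within transition_set \<Omega> u)) \<and>
     locally_C1_surface (\<Omega> \<inter> frontier (transition_set \<Omega> u))"


section \<open>Varifolds\<close>

text \<open>\<open>G(n,n-1)\<close>, a hyperplane being identified with the orthogonal projection onto it.\<close>

definition grassmannian :: "(real ^ 'n ^ 'n::finite) set" where
  "grassmannian = {P. transpose P = P \<and> P ** P = P \<and> rank P = CARD('n) - 1}"

text \<open>On the locally compact, second countable sets considered here, a Borel measure that is finite
  on compact sets is regular, hence Radon.\<close>

definition radon_measure_on :: "'a::topological_space set \<Rightarrow> 'a measure \<Rightarrow> bool" where
  "radon_measure_on X M \<longleftrightarrow>
     sets M = sets (restrict_space borel X) \<and> (\<forall>K. compact K \<and> K \<subseteq> X \<longrightarrow> emeasure M K < \<infinity>)"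

type_synonym 'n varifold = "((real ^ 'n) \<times> (real ^ 'n ^ 'n)) measure"

definition is_varifold :: "(real ^ 'n::finite) set \<Rightarrow> 'n varifold \<Rightarrow> bool" where
  "is_varifold \<Omega> V \<longleftrightarrow> radon_measure_on (\<Omega> \<times> grassmannian) V"

definition weight :: "(real ^ 'n::finite) set \<Rightarrow> 'n varifold \<Rightarrow> (real ^ 'n) measure" where
  "weight \<Omega> V = distr V (restrict_space borel \<Omega>) fst"

definition Cc_on :: "'a::topological_space set \<Rightarrow> ('a \<Rightarrow> real) set" where
  "Cc_on X = {\<phi>. continuous_on X \<phi> \<and> (\<exists>K. compact K \<and> K \<subseteq> X \<and> (\<forall>z\<in>X - K. \<phi> z = 0))}"

definition varifold_tendsto ::
    "(real ^ 'n::finite) set \<Rightarrow> (nat \<Rightarrow> 'n varifold) \<Rightarrow> 'n varifold \<Rightarrow> bool" where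
  "varifold_tendsto \<Omega> W V \<longleftrightarrow>
     (\<forall>\<phi>\<in>Cc_on (\<Omega> \<times> grassmannian).
        (\<lambda>i. integral\<^sup>L (W i) \<phi>) \<longlonglongrightarrow> integral\<^sup>L V \<phi>)"

definition normal_projection :: "real ^ 'n::finite \<Rightarrow> real ^ 'n ^ 'n" where
  "normal_projection p = mat 1 - (\<chi> i j. (p $ i / norm p) * (p $ j / norm p))"

definition assoc_varifold ::
    "(real ^ 'n::finite) set \<Rightarrow> real \<Rightarrow> (real ^ 'n \<Rightarrow> real) \<Rightarrow> 'n varifold" where
  "assoc_varifold \<Omega> \<epsilon> u =
     distr (density (restrict_space lebesgue {x \<in> \<Omega>. weak_grad \<Omega> u x \<noteq> 0})
              (\<lambda>x. ennreal (energy_density \<Omega> \<epsilon> u x)))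
           (restrict_space borel (\<Omega> \<times> grassmannian))
           (\<lambda>x. (x, normal_projection (weak_grad \<Omega> u x)))"

text \<open>The support relative to \<open>space M\<close>, which is \<open>\<Omega>\<close> for \<open>weight\<close> and \<open>perimeter_measure\<close>.\<close>

definition spt :: "'a::topological_space measure \<Rightarrow> 'a set" where
  "spt M = {x \<in> space M. \<forall>U. open U \<and> x \<in> U \<longrightarrow> emeasure M (U \<inter> space M) \<noteq> 0}"


subsection \<open>The associated varifold as a functional\<close>

lemma normal_projection_mult:
  fixes p :: "real ^ 'n::finite"
  shows "normal_projection p *v x = x - ((p \<bullet> x) / (norm p)\<^sup>2) *\<^sub>R p"
proof -
  have "(\<Sum>j\<in>UNIV. p $ j * (p $ i * x $ j) / (norm p * norm p)) = p $ i * (\<Sum>j\<in>UNIV. p $ j * x $ j) / (norm p * norm p)" for i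
    by (simp add: sum_distrib_left sum_divide_distrib mult.left_commute)
  then show ?thesis
    unfolding normal_projection_def matrix_vector_mult_diff_rdistrib matrix_vector_mul_lid
    by (simp add: vec_eq_iff matrix_vector_mult_def inner_vec_def power2_eq_square mult_ac)
qed

lemma normal_projection_in_grassmannian:
  fixes p :: "real ^ 'n::finite"
  assumes "p \<noteq> 0"
  shows "normal_projection p \<in> grassmannian"
proof -
  let ?P = "normal_projection p"
  have np: "p \<bullet> p / (norm p)\<^sup>2 = 1" using assms by (simp add: power2_norm_eq_inner)
  have orth: "p \<bullet> (?P *v x) = 0" for x
    using assms by (simp add: normal_projection_mult inner_diff_right power2_norm_eq_inner)
  have fx: "?P *v x = x" if "p \<bullet> x = 0" for x using that by (simp add: normal_projection_mult)
  have "transpose ?P = ?P"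
    by (simp add: normal_projection_def transpose_def vec_eq_iff mat_def mult_ac)
  moreover have "?P ** ?P = ?P"
    unfolding matrix_eq matrix_vector_mul_assoc[symmetric] using fx orth by blast
  moreover have "range ((*v) ?P) = {x. p \<bullet> x = 0}" 
    using orth fx by (force simp: image_iff intro: sym[OF fx])
  then have "rank ?P = CARD('n) - 1"
    using dim_hyperplane[OF assms] by (simp add: rank_dim_range)
  ultimately show ?thesis by (simp add: grassmannian_def)
qed

lemma open_locally_integrable_measurable:
  fixes f :: "real ^ 'n::finite \<Rightarrow> 'b::euclidean_space"
  assumes "open \<Omega>" "locally_integrable_on f \<Omega>"
  shows "f \<in> borel_measurable (restrict_space lebesgue \<Omega>)"
proof -
  obtain C where C: "\<And>n::nat. compact (C n)" "\<And>n. C n \<subseteq> \<Omega>" "\<And>n. C n \<subseteq> interior (C (Suc n))" "\<Union>(range C) = \<Omega>"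
    using open_Union_compact_subsets[OF assms(1)] by metis
  have meas: "(\<lambda>x. indicator (C n) x *\<^sub>R f x) \<in> borel_measurable lebesgue" for n
    using assms(2) C unfolding locally_integrable_on_def set_integrable_def
    by (meson borel_measurable_integrable)
  have mono: "C m \<subseteq> C n" if "m \<le> n" for m n
    using that C(3) interior_subset by (metis (no_types, opaque_lifting) lift_Suc_mono_le subset_trans)
  have "(\<lambda>x. indicator \<Omega> x *\<^sub>R f x) \<in> borel_measurable lebesgue"
  proof (rule borel_measurable_LIMSEQ_metric[OF meas])
    fix x
    show "(\<lambda>n. indicator (C n) x *\<^sub>R f x) \<longlonglongrightarrow> indicator \<Omega> x *\<^sub>R f x"
    proof (cases "x \<in> \<Omega>")
      case True
      then obtain m where "x \<in> C m" using C(4) by blast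
      then have "\<forall>\<^sub>F n in sequentially. indicator (C n) x *\<^sub>R f x = indicator \<Omega> x *\<^sub>R f x"
        using mono True by (intro eventually_sequentiallyI[of m]) (auto simp: indicator_def)
      then show ?thesis by (rule tendsto_eventually)
    next
      case False
      then have "indicator (C n) x *\<^sub>R f x = 0" for n using C by (auto simp: indicator_def)
      then have "(\<lambda>n. indicator (C n) x *\<^sub>R f x) = (\<lambda>n. 0)" by blast
      with False show ?thesis by simp
    qed
  qed
  then show ?thesis
    using assms(1) by (subst borel_measurable_restrict_space_iff) auto
qed

lemma is_weak_grad_weak_grad: "u \<in> W12 \<Omega> \<Longrightarrow> is_weak_grad \<Omega> u (weak_grad \<Omega> u)"
  unfolding W12_def weak_grad_def by (metis (mono_tags, lifting) mem_Collect_eq someI)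

text \<open>The defining formula of the associated varifold, as a functional on test functions.\<close>

lemma integral_assoc_varifold:
  fixes u :: "real ^ 'n::finite \<Rightarrow> real"
  assumes "open \<Omega>" "u \<in> W12 \<Omega>" "0 < \<epsilon>" "\<phi> \<in> Cc_on (\<Omega> \<times> grassmannian)"
  defines "g \<equiv> weak_grad \<Omega> u"
  shows "integral\<^sup>L (assoc_varifold \<Omega> \<epsilon> u) \<phi> =
    set_lebesgue_integral lebesgue {x \<in> \<Omega>. g x \<noteq> 0}
      (\<lambda>x. \<phi> (x, normal_projection (g x)) * (\<epsilon> * (norm (g x))\<^sup>2 + indicator {-1<..<1} (u x) / \<epsilon>))"
proof -
  let ?S = "{x \<in> \<Omega>. g x \<noteq> 0}"
  let ?M = "restrict_space lebesgue ?S"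
  have gm: "g \<in> borel_measurable (restrict_space lebesgue \<Omega>)"
    unfolding g_def using assms is_weak_grad_weak_grad open_locally_integrable_measurable
    unfolding is_weak_grad_def by blast
  have um: "u \<in> borel_measurable (restrict_space lebesgue \<Omega>)"
    using assms open_locally_integrable_measurable unfolding W12_def by blast
  have "{x \<in> space (restrict_space lebesgue \<Omega>). g x \<noteq> 0} \<in> sets (restrict_space lebesgue \<Omega>)"
    using gm by measurable
  then have S: "?S \<in> sets lebesgue"
    using assms(1) by (auto simp: space_restrict_space sets_restrict_space_iff)
  have gS[measurable]: "g \<in> borel_measurable ?M"
    using measurable_restrict_mono[OF gm, of ?S] by auto
  have uS[measurable]: "u \<in> borel_measurable ?M"
    using measurable_restrict_mono[OF um, of ?S] by auto
  have eS[measurable]: "energy_density \<Omega> \<epsilon> u \<in> borel_measurable ?M"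
    unfolding energy_density_def g_def[symmetric] by measurable
  have id: "(\<lambda>x. x) \<in> ?M \<rightarrow>\<^sub>M borel"
    by (intro measurable_restrict_space1) (auto intro: measurable_completion)
  have npb: "normal_projection \<in> borel \<rightarrow>\<^sub>M (borel :: (real ^ 'n ^ 'n) measure)"
  proof (subst borel_measurable_euclidean_space, rule ballI)
    fix b :: "real ^ 'n ^ 'n" assume "b \<in> Basis"
    then obtain i j where b: "b = axis i (axis j 1)" by (auto simp: Basis_vec_def)
    have nth: "(\<lambda>p :: real ^ 'n. p $ k) \<in> borel_measurable borel" for k
      by (intro borel_measurable_continuous_onI continuous_intros)
    show "(\<lambda>p. normal_projection p \<bullet> b) \<in> borel_measurable borel"
      unfolding b inner_axis normal_projection_def using nth[of i] nth[of j]
      by (simp add: mat_def) 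
  qed
  have pr: "(\<lambda>x. (x, normal_projection (g x))) \<in> ?M \<rightarrow>\<^sub>M restrict_space borel (\<Omega> \<times> grassmannian)"
    unfolding borel_prod[symmetric]
    using id measurable_compose[OF gS npb] normal_projection_in_grassmannian
    by (intro measurable_restrict_space2 measurable_Pair) (auto simp: space_restrict_space)
  have pm: "\<phi> \<in> borel_measurable (restrict_space borel (\<Omega> \<times> grassmannian))"
    using assms(4) by (auto simp: Cc_on_def intro: borel_measurable_continuous_on_restrict)
  have "integral\<^sup>L (assoc_varifold \<Omega> \<epsilon> u) \<phi> =
    integral\<^sup>L (density ?M (\<lambda>x. ennreal (energy_density \<Omega> \<epsilon> u x))) (\<lambda>x. \<phi> (x, normal_projection (g x)))"
    unfolding assoc_varifold_def g_def[symmetric]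
    using pr pm by (intro integral_distr) auto
  also have "\<dots> = integral\<^sup>L ?M (\<lambda>x. energy_density \<Omega> \<epsilon> u x *\<^sub>R \<phi> (x, normal_projection (g x)))"
  proof (rule integral_density[OF measurable_compose[OF pr pm] eS])
    show "AE x in ?M. 0 \<le> energy_density \<Omega> \<epsilon> u x"
      using assms(3) by (auto simp: energy_density_def)
  qed
  also have "\<dots> = set_lebesgue_integral lebesgue ?S (\<lambda>x. energy_density \<Omega> \<epsilon> u x *\<^sub>R \<phi> (x, normal_projection (g x)))"
    unfolding set_lebesgue_integral_def using S by (intro integral_restrict_space) auto
  finally show ?thesis by (simp add: energy_density_def g_def mult.commute)
qed

end

theory Submission
  imports Defs "HOL-Computational_Algebra.Polynomial"
begin

text \<open>The weight of the limit varifold equals \<open>4 |\<partial>{u\<^sub>0 = 1}|\<close>, by an argument of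
  \<open>\<Gamma>\<close>-convergence type.

  Lower bound: the weak gradient of \<open>u\<^sub>i\<close> vanishes a.e. where \<open>\<bar>u\<^sub>i\<bar> = 1\<close> (the free boundary is a
  null set, and off its closure \<open>u\<^sub>i\<close> is locally constant there), so
  \<open>2 \<bar>\<nabla>u\<^sub>i\<bar> \<le> \<epsilon>\<^sub>i \<bar>\<nabla>u\<^sub>i\<bar>\<^sup>2 + \<chi>(u\<^sub>i) / \<epsilon>\<^sub>i\<close>, and testing with \<open>C\<^sup>1\<close> fields gives
  \<open>2 \<integral> u\<^sub>0 div \<phi> \<le> \<integral> \<bar>\<phi>\<bar> d\<parallel>V\<parallel>\<close>.

  Upper bound: if \<open>w\<close> is smooth and \<open>a \<ge> \<bar>\<nabla>w\<bar>\<close> is a positive \<open>C\<^sup>1\<close> function, the truncation \<open>v\<^sub>t\<close> of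
  \<open>(w - t) / (\<epsilon> a)\<close> to \<open>[-1, 1]\<close> satisfies \<open>\<bar>\<nabla>v\<^sub>t\<bar> \<le> 1 / \<epsilon> + O(1)\<close> on the strip \<open>\<bar>w - t\<bar> < \<epsilon> a\<close> and is
  constant off it, so its energy is at most \<open>(2 / \<epsilon> + O(1))\<close> times the measure of the strip. By Fubini
  the average over \<open>t \<in> (-1, 1)\<close> of that measure is at most \<open>\<epsilon> \<integral> a\<close>. This replaces the coarea
  formula, Sard's theorem and signed distance functions. Applied to smooth \<open>w\<close> converging strictly in
  \<open>BV\<close> to a competitor \<open>v\<close> it yields recovery sequences, and minimality gives \<open>\<parallel>V\<parallel>(\<Omega>) \<le> J\<^sub>0(v)\<close>.

  With \<open>v = u\<^sub>0\<close> both bounds agree on \<open>\<Omega>\<close>, hence on every open subset.\<close>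

section \<open>Functions of class \<open>C\<^sup>k\<close>\<close>

text \<open>The lower bound is local, the upper bound only global: minimality compares total
  energies and says nothing about a subset. Equality of the total masses, joined to the inequality
  on every open set, is what localizes the upper bound. For this a competitor must be approximated
  by smooth functions whose gradient mass in \<Omega> barely exceeds its variation there, with
  nothing added along the boundary; the smoothness of the boundary serves this purpose. The strips
  have half-width \<epsilon> a because 1/\<epsilon> is the slope p at which \<epsilon> p^2 +
  1/\<epsilon> = 2 p, the equality case of the lower bound. The function \<open>a\<close> stays away
  from zero, so critical points of \<open>w\<close> do no harm, and exceeds |grad w| by at most a
  small \<eta>. A density 2/\<epsilon> on a set of measure \<epsilon> times the integral of
  \<open>a\<close> costs twice that integral. The constant 4 is 2 * 2: one factor from the
  inequality between energy density and gradient, the other from the jump between -1 and 1, which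
  makes the variation of \<open>u0\<close> twice the perimeter.\<close>

lemma Ck_on_SucI:
  assumes "\<And>x. (f has_derivative f' x) (at x)" "\<And>v. Ck_on k (\<lambda>x. f' x v) UNIV"
  shows "Ck_on (Suc k) f UNIV"
proof -
  have "frechet_derivative f (at x) = f' x" for x
    using assms(1) frechet_derivative_at by metis
  with assms show ?thesis
    by (auto simp: differentiable_on_def differentiable_def)
qed

lemma Ck_on_SucD:
  assumes "Ck_on (Suc k) f UNIV"
  shows "(f has_derivative frechet_derivative f (at x)) (at x)"
    "Ck_on k (\<lambda>x. frechet_derivative f (at x) v) UNIV"
  using assms by (auto simp: differentiable_on_def frechet_derivative_works)

lemma Ck_on_imp_continuous: "Ck_on k f UNIV \<Longrightarrow> continuous_on UNIV f"
  by (cases k) (auto simp: differentiable_imp_continuous_on)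

lemma Ck_on_Suc_imp: "Ck_on (Suc k) f UNIV \<Longrightarrow> Ck_on k f UNIV"
proof (induction k arbitrary: f)
  case 0
  then show ?case by (simp add: differentiable_imp_continuous_on)
next
  case (Suc k)
  from Suc.prems have "f differentiable_on UNIV" "\<And>v. Ck_on (Suc k) (\<lambda>x. frechet_derivative f (at x) v) UNIV"
    by simp_all
  with Suc.IH show ?case by (subst Ck_on.simps) blast
qed

lemma Ck_on_mono: "Ck_on l f UNIV \<Longrightarrow> k \<le> l \<Longrightarrow> Ck_on k f UNIV"
  by (induction l) (auto simp del: Ck_on.simps(2) simp: le_Suc_eq dest: Ck_on_Suc_imp)

lemma Ck_on_const [simp]: "Ck_on k (\<lambda>x. c) UNIV"
  by (induction k arbitrary: c) (auto intro!: Ck_on_SucI derivative_intros simp del: Ck_on.simps(2))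

lemma Ck_on_linear:
  assumes "bounded_linear f" shows "Ck_on k f UNIV"
proof (cases k)
  case 0 then show ?thesis using assms by (simp add: linear_continuous_on)
next
  case (Suc m)
  then show ?thesis using assms
    by (auto intro!: Ck_on_SucI[where f' = "\<lambda>x. f"] bounded_linear_imp_has_derivative simp del: Ck_on.simps)
qed

text \<open>The closure rules share one scheme: induction on \<open>k\<close>, with the usual
  differentiation formula handed to \<open>Ck_on_SucI\<close>, where uniqueness of derivatives lets
  it replace the value of \<open>frechet_derivative\<close>.\<close>

lemma Ck_on_add:
  assumes "Ck_on k f UNIV" "Ck_on k g UNIV" shows "Ck_on k (\<lambda>x. f x + g x) UNIV"
  using assms
proof (induction k arbitrary: f g)
  case 0 then show ?case by (auto intro: continuous_intros)
next
  case (Suc k)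
  show ?case
    by (rule Ck_on_SucI[where f' = "\<lambda>x v. frechet_derivative f (at x) v + frechet_derivative g (at x) v"])
      (auto intro!: derivative_intros Suc.IH Ck_on_SucD[OF Suc.prems(1)] Ck_on_SucD[OF Suc.prems(2)] simp del: Ck_on.simps)
qed

lemma Ck_on_bounded_linear:
  assumes "bounded_linear L" "Ck_on k f UNIV" shows "Ck_on k (\<lambda>x. L (f x)) UNIV"
  using assms(2)
proof (induction k arbitrary: f)
  case 0 then show ?case using assms(1)
    by (auto intro: linear_continuous_on continuous_on_compose2)
next
  case (Suc k)
  show ?case
    by (rule Ck_on_SucI[where f' = "\<lambda>x v. L (frechet_derivative f (at x) v)"])
      (auto intro!: bounded_linear.has_derivative[OF assms(1)] Suc.IH Ck_on_SucD[OF Suc.prems(1)] simp del: Ck_on.simps)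
qed

lemma Ck_on_sum:
  assumes "\<And>i. i \<in> I \<Longrightarrow> Ck_on k (f i) UNIV" shows "Ck_on k (\<lambda>x. \<Sum>i\<in>I. f i x) UNIV"
  using assms by (induction I rule: infinite_finite_induct) (auto intro: Ck_on_add)

lemma Ck_on_scaleR:
  fixes f :: "'a::euclidean_space \<Rightarrow> real"
  assumes "Ck_on k f UNIV" "Ck_on k g UNIV" shows "Ck_on k (\<lambda>x. f x *\<^sub>R g x) UNIV"
  using assms
proof (induction k arbitrary: f g)
  case 0 then show ?case by (auto intro: continuous_intros)
next
  case (Suc k)
  note d = Ck_on_SucD[OF Suc.prems(1)] Ck_on_SucD[OF Suc.prems(2)] Ck_on_Suc_imp[OF Suc.prems(1)] Ck_on_Suc_imp[OF Suc.prems(2)]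
  show ?case
    by (rule Ck_on_SucI[where f' = "\<lambda>x v. f x *\<^sub>R frechet_derivative g (at x) v + frechet_derivative f (at x) v *\<^sub>R g x"])
      (auto intro!: has_derivative_scaleR Ck_on_add Suc.IH d simp del: Ck_on.simps)
qed

lemma Ck_on_mult:
  fixes f g :: "'a::euclidean_space \<Rightarrow> real"
  shows "Ck_on k f UNIV \<Longrightarrow> Ck_on k g UNIV \<Longrightarrow> Ck_on k (\<lambda>x. f x * g x) UNIV"
  using Ck_on_scaleR[of k f g] by simp

lemma Ck_on_uminus: "Ck_on k f UNIV \<Longrightarrow> Ck_on k (\<lambda>x. - f x) UNIV"
  using Ck_on_bounded_linear[of uminus] by (simp add: bounded_linear_minus bounded_linear_ident)

lemma Ck_on_diff: "Ck_on k f UNIV \<Longrightarrow> Ck_on k g UNIV \<Longrightarrow> Ck_on k (\<lambda>x. f x - g x) UNIV"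
  using Ck_on_add[of k f "\<lambda>x. - g x"] Ck_on_uminus[of k g] by simp

lemma Ck_on_inverse:
  fixes f :: "'a::euclidean_space \<Rightarrow> real"
  assumes "Ck_on k f UNIV" "\<And>x. f x \<noteq> 0" shows "Ck_on k (\<lambda>x. inverse (f x)) UNIV"
  using assms(1)
proof (induction k)
  case 0 then show ?case using assms(2) by (auto intro: continuous_intros)
next
  case (Suc k)
  note d = Ck_on_SucD[OF Suc.prems(1)] Ck_on_Suc_imp[OF Suc.prems(1)]
  show ?case
    by (rule Ck_on_SucI[where f' = "\<lambda>x v. - (inverse (f x) * frechet_derivative f (at x) v * inverse (f x))"])
      (auto intro!: Deriv.has_derivative_inverse Ck_on_uminus Ck_on_mult Suc.IH d assms(2) simp del: Ck_on.simps)
qed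

lemma Ck_on_divide:
  fixes f g :: "'a::euclidean_space \<Rightarrow> real"
  shows "Ck_on k f UNIV \<Longrightarrow> Ck_on k g UNIV \<Longrightarrow> (\<And>x. g x \<noteq> 0) \<Longrightarrow> Ck_on k (\<lambda>x. f x / g x) UNIV"
  unfolding divide_inverse by (intro Ck_on_mult Ck_on_inverse)

text \<open>\<open>g\<close> is constrained only at the values of \<open>f\<close>, so that
  \<open>sqrt\<close> is admissible on a positive function, as is \<open>soft_clamp\<close>, whose
  derivative has corners.\<close>

lemma Ck_on_1_compose:
  fixes f :: "'a::euclidean_space \<Rightarrow> real"
  assumes "Ck_on 1 f UNIV" "\<And>x. (g has_real_derivative g' (f x)) (at (f x))"
    "continuous_on UNIV (\<lambda>x. g' (f x))"
  shows "Ck_on 1 (\<lambda>x. g (f x)) UNIV"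
    "((\<lambda>x. g (f x)) has_derivative (\<lambda>v. g' (f x) * frechet_derivative f (at x) v)) (at x)"
proof -
  note d = Ck_on_SucD[OF assms(1)[unfolded One_nat_def]]
  show *: "((\<lambda>x. g (f x)) has_derivative (\<lambda>v. g' (f x) * frechet_derivative f (at x) v)) (at x)" for x
    using has_derivative_compose[OF d(1) assms(2)[unfolded has_field_derivative_def]] by simp
  show "Ck_on 1 (\<lambda>x. g (f x)) UNIV" unfolding One_nat_def
    using * d(2) assms(3) by (auto intro!: Ck_on_SucI[OF *] continuous_intros simp del: Ck_on.simps(2))
qed

lemma Ck_on_inner:
  fixes f g :: "'a::euclidean_space \<Rightarrow> real ^ 'n"
  assumes "Ck_on k f UNIV" "Ck_on k g UNIV" shows "Ck_on k (\<lambda>x. f x \<bullet> g x) UNIV"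
  unfolding inner_vec_def using assms
  by (auto intro!: Ck_on_sum Ck_on_mult Ck_on_bounded_linear[OF bounded_linear_vec_nth])

lemma Ck_on_vec:
  fixes f :: "'n::finite \<Rightarrow> 'a::euclidean_space \<Rightarrow> real"
  assumes "\<And>i. Ck_on k (f i) UNIV" shows "Ck_on k (\<lambda>x. \<chi> i. f i x) UNIV"
proof -
  have "(\<lambda>x. \<chi> i. f i x) = (\<lambda>x. \<Sum>i\<in>UNIV. f i x *\<^sub>R axis i 1)"
    by (auto simp: vec_eq_iff axis_def if_distrib cong: if_cong)
  then show ?thesis using assms by (auto intro!: Ck_on_sum Ck_on_scaleR)
qed

lemma smooth_on_imp_Ck: "smooth_on f UNIV \<Longrightarrow> Ck_on k f UNIV"
  by (simp add: smooth_on_def)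

section \<open>Partial derivatives, gradients and divergences\<close>

lemma partial_eqI: "(f has_derivative f') (at x) \<Longrightarrow> partial i f x = f' (axis i 1)"
  unfolding partial_def using frechet_derivative_at by metis

lemma frechet_eq_grad:
  assumes "f differentiable (at x)"
  shows "frechet_derivative f (at x) v = grad f x \<bullet> v"
proof -
  interpret L: linear "frechet_derivative f (at x)" using assms by (rule linear_frechet_derivative)
  have "frechet_derivative f (at x) v = frechet_derivative f (at x) (\<Sum>i\<in>UNIV. v $ i *\<^sub>R axis i 1)"
    by (metis basis_expansion scalar_mult_eq_scaleR)
  also have "\<dots> = (\<Sum>i\<in>UNIV. v $ i * frechet_derivative f (at x) (axis i 1))"
    by (simp add: L.sum L.scale)
  finally show ?thesis by (simp add: grad_def inner_vec_def partial_def mult.commute)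
qed

lemma Ck_on_partial: "Ck_on (Suc k) f UNIV \<Longrightarrow> Ck_on k (partial i f) UNIV"
  unfolding partial_def by (rule Ck_on_SucD)

lemma Ck_on_grad: "Ck_on (Suc k) f UNIV \<Longrightarrow> Ck_on k (grad f) UNIV"
  unfolding grad_def[abs_def] by (intro Ck_on_vec Ck_on_partial)

lemma has_derivative_grad:
  "Ck_on (Suc k) f UNIV \<Longrightarrow> (f has_derivative (\<lambda>v. grad f x \<bullet> v)) (at x)"
  using Ck_on_SucD(1)[of k f x] frechet_eq_grad[of f x]
  by (metis (no_types, lifting) differentiable_def ext)

lemma grad_eqI: "(f has_derivative (\<lambda>v. g \<bullet> v)) (at x) \<Longrightarrow> grad f x = g"
  by (simp add: grad_def vec_eq_iff inner_axis partial_eqI)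

lemma partial_eq_grad: "partial i f x = grad f x $ i"
  by (simp add: grad_def)

lemma has_derivative_component:
  fixes \<phi> :: "real ^ 'n::finite \<Rightarrow> real ^ 'n"
  assumes "Ck_on (Suc k) \<phi> UNIV"
  shows "((\<lambda>y. \<phi> y $ i) has_derivative (\<lambda>v. frechet_derivative \<phi> (at x) v $ i)) (at x)"
  by (rule bounded_linear.has_derivative[OF bounded_linear_vec_nth Ck_on_SucD(1)[OF assms]])

lemma divergence_scaleR:
  fixes f :: "real ^ 'n::finite \<Rightarrow> real" and \<phi> :: "real ^ 'n \<Rightarrow> real ^ 'n"
  assumes "Ck_on 1 f UNIV" "Ck_on 1 \<phi> UNIV"
  shows "divergence (\<lambda>x. f x *\<^sub>R \<phi> x) x = f x * divergence \<phi> x + grad f x \<bullet> \<phi> x"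
proof -
  note a = assms[unfolded One_nat_def]
  have "partial i (\<lambda>y. (f y *\<^sub>R \<phi> y) $ i) x = f x * partial i (\<lambda>y. \<phi> y $ i) x + grad f x $ i * \<phi> x $ i" for i
    using partial_eqI[OF has_derivative_mult[OF has_derivative_grad[OF a(1)] has_derivative_component[OF a(2)]], of i i x]
      partial_eqI[OF has_derivative_component[OF a(2)], of i i x]
    by (simp add: inner_axis)
  then show ?thesis
    by (simp add: divergence_def sum.distrib sum_distrib_left inner_vec_def)
qed

lemma divergence_sum:
  fixes \<phi> :: "'i \<Rightarrow> real ^ 'n::finite \<Rightarrow> real ^ 'n"
  assumes "\<And>j. j \<in> I \<Longrightarrow> Ck_on 1 (\<phi> j) UNIV"
  shows "divergence (\<lambda>x. \<Sum>j\<in>I. \<phi> j x) x = (\<Sum>j\<in>I. divergence (\<phi> j) x)"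
proof -
  note a = assms[unfolded One_nat_def]
  have "partial i (\<lambda>y. (\<Sum>j\<in>I. \<phi> j y) $ i) x = (\<Sum>j\<in>I. partial i (\<lambda>y. \<phi> j y $ i) x)" for i
  proof -
    have "((\<lambda>y. \<Sum>j\<in>I. \<phi> j y $ i) has_derivative (\<lambda>v. \<Sum>j\<in>I. frechet_derivative (\<phi> j) (at x) v $ i)) (at x)"
      by (intro has_derivative_sum has_derivative_component[OF a])
    from partial_eqI[OF this] show ?thesis
      using partial_eqI[OF has_derivative_component[OF a]] by simp
  qed
  then show ?thesis
    by (simp add: divergence_def sum.swap[of _ UNIV])
qed

lemma Ck_on_divergence:
  fixes \<phi> :: "real ^ 'n::finite \<Rightarrow> real ^ 'n"
  assumes "Ck_on (Suc k) \<phi> UNIV" shows "Ck_on k (divergence \<phi>) UNIV"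
  unfolding divergence_def[abs_def] using assms
  by (intro Ck_on_sum Ck_on_partial Ck_on_bounded_linear[OF bounded_linear_vec_nth])

section \<open>Smooth bumps and mollifiers\<close>

text \<open>The polynomial factor makes the family closed under differentiation, so smoothness of
  all orders follows by induction with \<open>p\<close> arbitrary. For \<open>p = 1\<close> this is
  the classical function exp(-1/t), flat at 0.\<close>

definition exp_recip :: "real poly \<Rightarrow> real \<Rightarrow> real" where
  "exp_recip p t = (if 0 < t then poly p (1 / t) * exp (- (1 / t)) else 0)"

lemma poly_exp_tendsto_0: "((\<lambda>x. poly p x * exp (- x)) \<longlongrightarrow> (0::real)) at_top"
proof -
  have "((\<lambda>x. \<Sum>i\<le>degree p. coeff p i * (x ^ i / exp x)) \<longlongrightarrow> (0::real)) at_top"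
    by (intro tendsto_null_sum tendsto_mult_right_zero tendsto_power_div_exp_0)
  moreover have "poly p x * exp (- x) = (\<Sum>i\<le>degree p. coeff p i * (x ^ i / exp x))" for x
    by (simp add: poly_altdef exp_minus divide_inverse sum_distrib_right mult.assoc)
  ultimately show ?thesis by simp
qed

lemma exp_recip_tendsto_0: "(exp_recip p \<longlongrightarrow> 0) (at 0)"
proof -
  have "((\<lambda>t. poly p (inverse t) * exp (- inverse t)) \<longlongrightarrow> 0) (at_right 0)"
    using filterlim_compose[OF poly_exp_tendsto_0 filterlim_inverse_at_top_right] .
  then have "(exp_recip p \<longlongrightarrow> 0) (at_right 0)"
    by (rule Lim_transform_eventually) (auto simp: exp_recip_def eventually_at_filter inverse_eq_divide)
  moreover have "(exp_recip p \<longlongrightarrow> 0) (at_left 0)"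
    by (rule tendsto_eventually) (auto simp: exp_recip_def eventually_at_filter)
  ultimately show ?thesis by (simp add: filterlim_split_at)
qed

text \<open>Since 1/t has derivative -(1/t)^2, differentiation replaces p by X^2 (p - p'), with X^2
  written here as a coefficient list.\<close>

lemma exp_recip_deriv:
  "(exp_recip p has_real_derivative exp_recip ([:0, 0, 1:] * (p - pderiv p)) t) (at t)"
proof -
  consider "t > 0" | "t < 0" | "t = 0" by linarith
  then show ?thesis
  proof cases
    case 1
    have d: "((\<lambda>t. 1 / t) has_real_derivative - (1 / t * (1 / t))) (at t)"
      using 1 DERIV_inverse[of t] by (simp add: inverse_eq_divide power2_eq_square)
    have "((\<lambda>t. poly p (1 / t) * exp (- (1 / t))) has_real_derivative
        poly (pderiv p) (1 / t) * - (1 / t * (1 / t)) * exp (- (1 / t)) +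
        exp (- (1 / t)) * - (- (1 / t * (1 / t))) * poly p (1 / t)) (at t)"
      by (intro DERIV_mult DERIV_chain2[OF poly_DERIV d] DERIV_chain2[OF DERIV_exp DERIV_minus[OF d]])
    moreover have "poly (pderiv p) (1 / t) * - (1 / t * (1 / t)) * exp (- (1 / t)) +
        exp (- (1 / t)) * - (- (1 / t * (1 / t))) * poly p (1 / t) = exp_recip ([:0, 0, 1:] * (p - pderiv p)) t"
      unfolding exp_recip_def if_P[OF 1] poly_mult poly_diff by (simp add: algebra_simps)
    ultimately have "((\<lambda>t. poly p (1 / t) * exp (- (1 / t))) has_real_derivative
        exp_recip ([:0, 0, 1:] * (p - pderiv p)) t) (at t)" by simp
    then show ?thesis
      by (rule DERIV_cong_ev[OF refl _ refl, THEN iffD1, rotated])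
        (use 1 in \<open>auto simp: exp_recip_def eventually_nhds intro!: exI[of _ "{0<..}"]\<close>)
  next
    case 2
    have "((\<lambda>t. 0) has_real_derivative exp_recip ([:0, 0, 1:] * (p - pderiv p)) t) (at t)"
      using 2 by (auto simp: exp_recip_def)
    then show ?thesis
      by (rule DERIV_cong_ev[OF refl _ refl, THEN iffD1, rotated])
        (use 2 in \<open>auto simp: exp_recip_def eventually_nhds intro!: exI[of _ "{..<0}"]\<close>)
  next
    case 3
    \<comment> \<open>Dividing by \<open>h\<close> multiplies the polynomial by X, so the difference
      quotient at 0 belongs to the family again and tends to 0.\<close>
    have "(\<lambda>h. (exp_recip p (0 + h) - exp_recip p 0) / h) = exp_recip ([:0, 1:] * p)"
      by (auto simp: exp_recip_def fun_eq_iff)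
    moreover have "exp_recip q 0 = 0" for q by (simp add: exp_recip_def)
    ultimately show ?thesis using 3 exp_recip_tendsto_0[of "[:0,1:] * p"]
      unfolding DERIV_def by metis
  qed
qed

lemma Ck_on_exp_recip:
  assumes "\<And>k. Ck_on k f UNIV" shows "Ck_on k (\<lambda>x. exp_recip p (f x)) UNIV"
proof (induction k arbitrary: p)
  case 0
  have "continuous_on UNIV (exp_recip p)"
    using exp_recip_deriv[THEN DERIV_isCont] by (simp add: continuous_on_eq_continuous_at)
  then show ?case using assms[of 0] by (auto intro: continuous_on_compose2)
next
  case (Suc k)
  let ?q = "[:0, 0, 1:] * (p - pderiv p)"
  have 1: "((\<lambda>x. exp_recip p (f x)) has_derivative (\<lambda>v. frechet_derivative f (at x) v * exp_recip ?q (f x))) (at x)" for x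
    using has_derivative_compose[OF Ck_on_SucD(1)[OF assms[of 1, unfolded One_nat_def]]
       exp_recip_deriv[unfolded has_field_derivative_def]]
    by (simp add: mult.commute)
  show ?case
    by (rule Ck_on_SucI[OF 1]) (intro Ck_on_mult Ck_on_SucD(2)[OF assms] Suc.IH)
qed

text \<open>The squared distance is polynomial in \<open>x\<close>, hence smooth also at the centre
  \<open>p\<close>, where the norm is not.\<close>

definition bump :: "'a::euclidean_space \<Rightarrow> real \<Rightarrow> 'a \<Rightarrow> real" where
  "bump p r x = exp_recip 1 (r\<^sup>2 - (x - p) \<bullet> (x - p))"

lemma Ck_on_bump [simp]: "Ck_on k (bump p r) UNIV"
proof -
  have "Ck_on k (\<lambda>x. (x - p) \<bullet> (x - p)) UNIV" for k
    by (subst euclidean_inner) (intro Ck_on_sum Ck_on_mult Ck_on_bounded_linear[OF bounded_linear_inner_left] Ck_on_diff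
        Ck_on_linear bounded_linear_ident Ck_on_const)
  then show ?thesis unfolding bump_def[abs_def] by (intro Ck_on_exp_recip Ck_on_diff Ck_on_const)
qed

lemma bump_nonneg: "0 \<le> bump p r x"
  by (simp add: bump_def exp_recip_def)

lemma bump_pos_iff: "0 < r \<Longrightarrow> 0 < bump p r x \<longleftrightarrow> x \<in> ball p r"
proof -
  assume "0 < r"
  then have "(x - p) \<bullet> (x - p) < r\<^sup>2 \<longleftrightarrow> norm (x - p) < r"
    unfolding power2_norm_eq_inner[symmetric] using \<open>0 < r\<close> power2_less_imp_less[of "norm (x - p)" r]
      power_strict_mono[of "norm (x - p)" r 2] by auto
  then show ?thesis by (simp add: bump_def exp_recip_def dist_norm norm_minus_commute)
qed

lemma bump_eq_0_iff: "0 < r \<Longrightarrow> bump p r x = 0 \<longleftrightarrow> x \<notin> ball p r"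
  using bump_pos_iff[of r p x] bump_nonneg[of p r x] by force

section \<open>Boundedly supported functions\<close>

lemma integrable_bounded_support:
  fixes f :: "'a::euclidean_space \<Rightarrow> 'b::{banach, second_countable_topology}"
  assumes "continuous_on UNIV f" "bounded {x. f x \<noteq> 0}"
  shows "integrable lborel f"
proof -
  have "integrable lborel (\<lambda>x. indicator (closure {x. f x \<noteq> 0}) x *\<^sub>R f x)"
    using assms by (intro borel_integrable_compact) (auto simp: compact_eq_bounded_closed intro: continuous_on_subset)
  moreover have "indicator (closure {x. f x \<noteq> 0}) x *\<^sub>R f x = f x" for x
    using closure_subset[of "{x. f x \<noteq> 0}"] by (auto simp: indicator_def)
  ultimately show ?thesis by simp
qed

lemma uniformly_continuous_bounded_support:
  fixes f :: "'a::euclidean_space \<Rightarrow> 'b::real_normed_vector"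
  assumes "continuous_on UNIV f" "bounded {x. f x \<noteq> 0}" "0 < e"
  shows "\<exists>d>0. \<forall>x y. norm (x - y) < d \<longrightarrow> norm (f x - f y) < e"
proof -
  obtain R where R: "\<And>x. f x \<noteq> 0 \<Longrightarrow> norm x \<le> R" using assms(2) by (auto simp: bounded_iff)
  \<comment> \<open>The margin 1 covers pairs with only one point in the support: being less than 1
    apart, both lie in the enlarged ball. If neither point is in the support, both values
    vanish.\<close>
  have "uniformly_continuous_on (cball 0 (R + 1)) f"
    using assms(1) by (intro compact_uniformly_continuous) (auto intro: continuous_on_subset)
  then obtain d where d: "0 < d" "\<And>x y. x \<in> cball 0 (R+1) \<Longrightarrow> y \<in> cball 0 (R+1) \<Longrightarrow> dist x y < d \<Longrightarrow> dist (f x) (f y) < e"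
    unfolding uniformly_continuous_on_def using assms(3) by metis
  have "norm (f x - f y) < e" if "norm (x - y) < min d 1" for x y
  proof (cases "f x = 0 \<and> f y = 0")
    case True then show ?thesis using assms(3) by simp
  next
    case False
    then have "norm x \<le> R + 1 \<and> norm y \<le> R + 1"
      using R[of x] R[of y] that norm_triangle_sub[of x y] norm_triangle_sub[of y x]
      by (auto simp: norm_minus_commute)
    then show ?thesis using d(2)[of x y] that by (auto simp: dist_norm)
  qed
  then show ?thesis using d(1) by (intro exI[of _ "min d 1"]) simp
qed

lemma bounded_range_bounded_support:
  fixes f :: "'a::euclidean_space \<Rightarrow> 'b::real_normed_vector"
  assumes "continuous_on UNIV f" "bounded {x. f x \<noteq> 0}"
  obtains B where "0 < B" "\<And>x. norm (f x) \<le> B"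
proof -
  have "compact (f ` closure {x. f x \<noteq> 0})"
    using assms by (intro compact_continuous_image) (auto simp: compact_eq_bounded_closed intro: continuous_on_subset)
  then obtain B where B: "0 < B" "\<And>y. y \<in> f ` closure {x. f x \<noteq> 0} \<Longrightarrow> norm y \<le> B"
    using compact_imp_bounded bounded_pos by metis
  have "norm (f x) \<le> B" for x
    using B closure_subset[of "{x. f x \<noteq> 0}"] by (cases "f x = 0") auto
  then show ?thesis using that B(1) by blast
qed

lemma frechet_derivative_support:
  "{x. frechet_derivative f (at x) v \<noteq> 0} \<subseteq> closure {x. f x \<noteq> 0}"
proof (clarify, rule ccontr)
  fix x assume a: "x \<notin> closure {x. f x \<noteq> 0}" "frechet_derivative f (at x) v \<noteq> 0"
  have "(f has_derivative (\<lambda>v. 0)) (at x)"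
    by (rule has_derivative_transform_within_open[where s = "- closure {x. f x \<noteq> 0}" and f = "\<lambda>x. 0"])
      (use a closure_subset[of "{x. f x \<noteq> 0}"] in \<open>auto\<close>)
  then show False using a(2) frechet_derivative_at by metis
qed

lemma bounded_frechet_derivative_support:
  "bounded {x. f x \<noteq> 0} \<Longrightarrow> bounded {x. frechet_derivative f (at x) v \<noteq> 0}"
  using frechet_derivative_support bounded_closure bounded_subset by metis

text \<open>The derivative is uniformly continuous in each basis direction, hence in operator norm,
  and the mean value inequality on a ball turns this into a remainder estimate independent of the
  base point. Such a remainder may be integrated.\<close>

lemma uniformly_differentiable:
  fixes p :: "'a::euclidean_space \<Rightarrow> 'b::real_normed_vector"
  assumes "Ck_on 1 p UNIV" "bounded {x. p x \<noteq> 0}" "0 < e"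
  shows "\<exists>d>0. \<forall>z h. norm h < d \<longrightarrow>
    norm (p (z + h) - p z - frechet_derivative p (at z) h) \<le> e * norm h"
proof -
  let ?D = "\<lambda>x. frechet_derivative p (at x)"
  note pd = Ck_on_SucD[OF assms(1)[unfolded One_nat_def]]
  have "\<exists>d>0. \<forall>x y. norm (x - y) < d \<longrightarrow> norm (?D x b - ?D y b) < e / DIM('a)" for b
  proof -
    have "continuous_on UNIV (\<lambda>x. ?D x b)" using pd(2) by simp
    moreover have "0 < e / DIM('a)" using assms(3) by simp
    ultimately show ?thesis
      using bounded_frechet_derivative_support[OF assms(2)] by (auto intro!: uniformly_continuous_bounded_support)
  qed
  then have "\<exists>d. \<forall>b. 0 < d b \<and> (\<forall>x y. norm (x - y) < d b \<longrightarrow> norm (?D x b - ?D y b) < e / DIM('a))"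
    by (intro choice allI)
  then obtain d where d: "\<And>b. 0 < d b" "\<And>b x y. norm (x - y) < d b \<Longrightarrow> norm (?D x b - ?D y b) < e / DIM('a)"
    by blast
  define d0 where "d0 = Min (d ` Basis)"
  have d0: "0 < d0" "\<And>b. b \<in> Basis \<Longrightarrow> d0 \<le> d b"
    using d(1) by (auto simp: d0_def)
  have on: "norm (?D x h - ?D y h) \<le> e * norm h" if "norm (x - y) < d0" for x y h
  proof -
    interpret X: linear "?D x" using pd(1) has_derivative_linear by blast
    interpret Y: linear "?D y" using pd(1) has_derivative_linear by blast
    have "?D x h - ?D y h = ?D x (\<Sum>b\<in>Basis. (h \<bullet> b) *\<^sub>R b) - ?D y (\<Sum>b\<in>Basis. (h \<bullet> b) *\<^sub>R b)"
      by (simp only: euclidean_representation)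
    also have "\<dots> = (\<Sum>b\<in>Basis. (h \<bullet> b) *\<^sub>R (?D x b - ?D y b))"
      by (simp only: X.sum X.scale Y.sum Y.scale scaleR_diff_right sum_subtractf)
    also have "norm \<dots> \<le> (\<Sum>b\<in>(Basis::'a set). norm h * (e / DIM('a)))"
    proof (rule sum_norm_le)
      fix b :: 'a assume b: "b \<in> Basis"
      have "norm (?D x b - ?D y b) \<le> e / DIM('a)"
        using d(2)[of x y b] d0(2)[OF b] that by simp
      then show "norm ((h \<bullet> b) *\<^sub>R (?D x b - ?D y b)) \<le> norm h * (e / DIM('a))"
        unfolding norm_scaleR using Basis_le_norm[OF b, of h]
        by (intro mult_mono) auto
    qed
    finally show ?thesis by (simp add: mult.commute)
  qed
  have "norm (p (z + h) - p z - ?D z h) \<le> e * norm h" if h: "norm h < d0" for z h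
  proof -
    have "norm (p (z + h) - p z - ?D z (z + h - z)) \<le> norm (z + h - z) * e"
    proof (rule differentiable_bound_linearization[where S = "ball z d0"])
      show "z + t *\<^sub>R (z + h - z) \<in> ball z d0" if "t \<in> {0..1}" for t
        using that h mult_left_le_one_le[of "norm h" t] by (auto simp: dist_norm)
      show "(p has_derivative ?D x) (at x within ball z d0)" for x
        using pd(1) has_derivative_at_withinI by blast
      show "onorm (?D x - ?D z) \<le> e" if "x \<in> ball z d0" for x
        using on[of x z] that by (intro onorm_le) (auto simp: dist_norm norm_minus_commute)
    qed (use d0 in auto)
    then show ?thesis by (simp add: mult.commute)
  qed
  then show ?thesis using d0(1) by blast
qed

section \<open>Invariance of Lebesgue measure and integrals of derivatives\<close>

lemma lborel_distr_reflect: "distr lborel borel (\<lambda>x. t - x) = (lborel :: 'a::euclidean_space measure)"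
  using lborel_affine[of "-1" t] by (auto simp: density_1)

lemma lborel_integral_reflect:
  fixes f :: "'a::euclidean_space \<Rightarrow> 'b::{banach, second_countable_topology}"
  assumes [measurable]: "f \<in> borel_measurable borel"
  shows "(\<integral>x. f (t - x) \<partial>lborel) = (\<integral>x. f x \<partial>lborel)"
  by (subst (2) lborel_distr_reflect[of t, symmetric]) (simp add: integral_distr)

lemma lborel_integrable_reflect:
  fixes f :: "'a::euclidean_space \<Rightarrow> 'b::{banach, second_countable_topology}"
  assumes "integrable lborel f"
  shows "integrable lborel (\<lambda>x. f (t - x))"
proof -
  have "integrable (distr lborel borel (\<lambda>x. t - x)) f" using assms by (simp add: lborel_distr_reflect)
  then show ?thesis by (subst (asm) integrable_distr_eq) (use assms in auto)
qed

lemma lborel_integral_translate: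
  fixes f :: "'a::euclidean_space \<Rightarrow> 'b::{banach, second_countable_topology}"
  assumes [measurable]: "f \<in> borel_measurable borel"
  shows "(\<integral>x. f (x + t) \<partial>lborel) = (\<integral>x. f x \<partial>lborel)"
  by (subst (2) lborel_distr_plus[of t, symmetric]) (simp add: integral_distr add.commute)

lemma integral_bounded_support_le:
  fixes f :: "'a::euclidean_space \<Rightarrow> 'b::{banach, second_countable_topology}"
  assumes "\<And>x. norm (f x) \<le> e * indicator (cball 0 R) x" "0 \<le> e"
  shows "norm (\<integral>x. f x \<partial>lborel) \<le> e * measure lborel (cball (0::'a) R)"
proof -
  have i: "integrable lborel (\<lambda>x::'a. e * indicator (cball 0 R) x)"
    using emeasure_lborel_cball_finite[of 0 R] by (intro integrable_mult_right integrable_real_indicator) auto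
  have "norm (\<integral>x. f x \<partial>lborel) \<le> (\<integral>x. norm (f x) \<partial>lborel)" by (rule integral_norm_bound)
  also have "\<dots> \<le> (\<integral>x. e * indicator (cball 0 R) (x :: 'a) \<partial>lborel)"
    by (rule Bochner_Integration.integral_mono'[OF i]) (simp_all add: assms)
  finally show ?thesis by simp
qed

text \<open>By translation invariance the increment f(x + s v) - f(x) has integral zero. It differs
  from s times the derivative by a remainder that is uniformly small relative to s and supported in
  a fixed ball, so the integral of the derivative is arbitrarily small.\<close>

lemma integral_frechet_derivative_0:
  fixes f :: "'a::euclidean_space \<Rightarrow> 'b::{banach, second_countable_topology}"
  assumes "Ck_on 1 f UNIV" "bounded {x. f x \<noteq> 0}"
  shows "(\<integral>x. frechet_derivative f (at x) v \<partial>lborel) = 0"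
proof -
  let ?D = "\<lambda>x. frechet_derivative f (at x)"
  note fd = Ck_on_SucD[OF assms(1)[unfolded One_nat_def]]
  have c: "continuous_on UNIV f" "continuous_on UNIV (\<lambda>x. ?D x v)"
    using fd(2) Ck_on_imp_continuous[OF assms(1)] by auto
  obtain R where R: "\<And>x. f x \<noteq> 0 \<Longrightarrow> norm x \<le> R" using assms(2) by (auto simp: bounded_iff)
  have sD: "?D x v \<noteq> 0 \<Longrightarrow> norm x \<le> R" for x
  proof -
    have "closure {x. f x \<noteq> 0} \<subseteq> cball 0 R" using R by (intro closure_minimal) auto
    then show "?D x v \<noteq> 0 \<Longrightarrow> norm x \<le> R" using frechet_derivative_support[of f v] by auto
  qed
  define M where "M = measure lborel (cball (0::'a) (R + norm v))"
  have "norm (\<integral>x. ?D x v \<partial>lborel) \<le> 0 + e" if "0 < e" for e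
  proof -
    define e' where "e' = e / (norm v * M + 1)"
    have M: "0 \<le> M" by (simp add: M_def)
    have e': "0 < e'" using that M by (simp add: e'_def add_nonneg_pos)
    obtain d where d: "0 < d" "\<And>z h. norm h < d \<Longrightarrow> norm (f (z + h) - f z - ?D z h) \<le> e' * norm h"
      using uniformly_differentiable[OF assms e'] by blast
    define s where "s = min 1 (d / (norm v + 1)) / 2"
    have s: "0 < s" "s \<le> 1"
      using d(1) min.cobounded1[of 1 "d / (norm v + 1)"] norm_ge_zero[of v] unfolding s_def
      by (simp_all del: min.cobounded1 norm_ge_zero)
    have sv: "norm (s *\<^sub>R v) < d"
    proof -
      have "norm (s *\<^sub>R v) = s * norm v" using s by simp
      also have "\<dots> \<le> d / (norm v + 1) / 2 * norm v"
        unfolding s_def by (intro mult_right_mono divide_right_mono) simp_all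
      also have "\<dots> = d * (norm v / (2 * (norm v + 1)))" by simp
      also have "\<dots> < d * 1" using d(1) norm_ge_zero[of v]
        by (intro mult_strict_left_mono) (auto simp: divide_less_eq add_nonneg_pos)
      finally show ?thesis by simp
    qed
    have lin: "?D x (s *\<^sub>R v) = s *\<^sub>R ?D x v" for x
      by (rule linear_cmul[OF has_derivative_linear[OF fd(1)]])
    have int: "integrable lborel f" "integrable lborel (\<lambda>x. ?D x v)"
      by (rule integrable_bounded_support[OF c(1) assms(2)],
          rule integrable_bounded_support[OF c(2) bounded_frechet_derivative_support[OF assms(2)]])
    have intt: "integrable lborel (\<lambda>x. f (x + s *\<^sub>R v))"
    proof (rule integrable_bounded_support)
      show "bounded {x. f (x + s *\<^sub>R v) \<noteq> 0}"
      proof (rule boundedI[of _ "R + norm (s *\<^sub>R v)"])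
        fix x assume "x \<in> {x. f (x + s *\<^sub>R v) \<noteq> 0}"
        then have "norm (x + s *\<^sub>R v) \<le> R" using R by simp
        then show "norm x \<le> R + norm (s *\<^sub>R v)" using norm_triangle_ineq4[of "x + s *\<^sub>R v" "s *\<^sub>R v"] by simp
      qed
    qed (intro continuous_on_compose2[OF c(1)] continuous_intros; simp)
    have "s *\<^sub>R (\<integral>x. ?D x v \<partial>lborel) = - (\<integral>x. f (x + s *\<^sub>R v) - f x - s *\<^sub>R ?D x v \<partial>lborel)"
      using int intt lborel_integral_translate[of f "s *\<^sub>R v"] by simp
    then have "s * norm (\<integral>x. ?D x v \<partial>lborel) = norm (\<integral>x. f (x + s *\<^sub>R v) - f x - s *\<^sub>R ?D x v \<partial>lborel)"
      using s norm_scaleR[of s "\<integral>x. ?D x v \<partial>lborel"] by (simp only: norm_minus_cancel abs_of_pos)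
    also have "\<dots> \<le> (e' * s * norm v) * M" unfolding M_def
    proof (rule integral_bounded_support_le)
      fix x
      have "f (x + s *\<^sub>R v) - f x - s *\<^sub>R ?D x v = 0" if "\<not> norm x \<le> R + norm v"
      proof -
        have "norm (s *\<^sub>R v) \<le> norm v" using s by (simp add: mult_left_le_one_le)
        moreover have "norm x \<le> norm (x + s *\<^sub>R v) + norm (s *\<^sub>R v)"
          using norm_triangle_ineq4[of "x + s *\<^sub>R v" "s *\<^sub>R v"] by simp
        ultimately have "\<not> norm (x + s *\<^sub>R v) \<le> R" "\<not> norm x \<le> R"
          using that norm_ge_zero[of v] by linarith+
        then have "f (x + s *\<^sub>R v) = 0" "f x = 0" "?D x v = 0" using R sD by blast+
        then show ?thesis by simp
      qed
      moreover have "norm (f (x + s *\<^sub>R v) - f x - s *\<^sub>R ?D x v) \<le> e' * s * norm v"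
        using d(2)[OF sv, of x] s by (simp add: lin mult.assoc)
      ultimately show "norm (f (x + s *\<^sub>R v) - f x - s *\<^sub>R ?D x v) \<le> e' * s * norm v * indicator (cball 0 (R + norm v)) x"
        by (cases "norm x \<le> R + norm v") auto
    qed (use e' s in auto)
    also have "\<dots> = s * (e' * (norm v * M))" by simp
    finally have "norm (\<integral>x. ?D x v \<partial>lborel) \<le> e' * (norm v * M)" using s by simp
    also have "\<dots> \<le> e' * (norm v * M + 1)" using e' by simp
    also have "\<dots> = e"
    proof -
      have "0 \<le> norm v * M" using M by simp
      then have "norm v * M + 1 \<noteq> 0" by linarith
      then show ?thesis by (simp add: e'_def)
    qed
    finally show ?thesis by simp
  qed
  then have "norm (\<integral>x. ?D x v \<partial>lborel) \<le> 0" by (rule field_le_epsilon)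
  then show ?thesis by simp
qed

section \<open>Convolution\<close>

text \<open>The first factor is scalar, and for differentiation only its integrability matters;
  regularity is carried by the second, which may be a vector field. Both mollified functions
  \<open>conv v k\<close> and mollified fields \<open>conv k \<phi>\<close> are covered in this
  way.\<close>

definition conv :: "('a::euclidean_space \<Rightarrow> real) \<Rightarrow> ('a \<Rightarrow> 'b) \<Rightarrow> 'a \<Rightarrow> 'b::euclidean_space" where
  "conv q p x = (\<integral>y. q y *\<^sub>R p (x - y) \<partial>lborel)"

lemma conv_integrable:
  fixes p :: "'a::euclidean_space \<Rightarrow> 'b::euclidean_space"
  assumes "integrable lborel q" "continuous_on UNIV p" "bounded {x. p x \<noteq> 0}"
  shows "integrable lborel (\<lambda>y. q y *\<^sub>R p (x - y))"
proof -
  obtain B where B: "0 < B" "\<And>x. norm (p x) \<le> B"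
    using bounded_range_bounded_support[OF assms(2,3)] by blast
  have [measurable]: "p \<in> borel_measurable borel" by (rule borel_measurable_continuous_onI[OF assms(2)])
  show ?thesis
  proof (rule Bochner_Integration.integrable_bound)
    show "integrable lborel (\<lambda>y. B * q y)" using assms(1) by simp
    show "AE y in lborel. norm (q y *\<^sub>R p (x - y)) \<le> norm (B * q y)"
    proof (intro AE_I2)
      fix y
      have "\<bar>q y\<bar> * norm (p (x - y)) \<le> \<bar>q y\<bar> * B" by (intro mult_left_mono B) auto
      then show "norm (q y *\<^sub>R p (x - y)) \<le> norm (B * q y)" using B(1) by (simp add: abs_mult mult.commute)
    qed
  qed (use borel_measurable_integrable[OF assms(1)] in measurable)
qed

lemma conv_commute:
  fixes p q :: "'a::euclidean_space \<Rightarrow> real"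
  assumes [measurable]: "q \<in> borel_measurable borel" "p \<in> borel_measurable borel"
  shows "conv q p = conv p q"
proof
  fix x
  have "conv q p x = (\<integral>y. q (x - y) *\<^sub>R p (x - (x - y)) \<partial>lborel)"
    unfolding conv_def using lborel_integral_reflect[of "\<lambda>y. q y *\<^sub>R p (x - y)" x] by simp
  then show "conv q p x = conv p q x" by (simp add: conv_def mult.commute)
qed

lemma conv_add:
  fixes p :: "'a::euclidean_space \<Rightarrow> 'b::euclidean_space"
  assumes "integrable lborel q" "continuous_on UNIV p" "bounded {x. p x \<noteq> 0}"
    "continuous_on UNIV p'" "bounded {x. p' x \<noteq> 0}"
  shows "conv q (\<lambda>x. p x + p' x) x = conv q p x + conv q p' x"
  unfolding conv_def scaleR_add_right
  by (intro Bochner_Integration.integral_add conv_integrable assms)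

lemma conv_bounded_linear:
  fixes p :: "'a::euclidean_space \<Rightarrow> 'b::euclidean_space" and L :: "'b \<Rightarrow> 'c::euclidean_space"
  assumes "integrable lborel q" "continuous_on UNIV p" "bounded {x. p x \<noteq> 0}" "bounded_linear L"
  shows "L (conv q p x) = conv q (\<lambda>x. L (p x)) x"
  unfolding conv_def
  by (subst integral_bounded_linear[OF assms(4) conv_integrable[OF assms(1-3)], symmetric])
    (simp add: linear_cmul[OF bounded_linear.linear[OF assms(4)]])

lemma norm_integral_scaleR_le:
  fixes q :: "'a::euclidean_space \<Rightarrow> real" and f :: "'a \<Rightarrow> 'b::euclidean_space"
  assumes "integrable lborel q" "integrable lborel (\<lambda>y. q y *\<^sub>R f y)"
    "\<And>y. q y \<noteq> 0 \<Longrightarrow> norm (f y) \<le> e" "0 \<le> e"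
  shows "norm (\<integral>y. q y *\<^sub>R f y \<partial>lborel) \<le> e * (\<integral>y. \<bar>q y\<bar> \<partial>lborel)"
proof -
  have "norm (\<integral>y. q y *\<^sub>R f y \<partial>lborel) \<le> (\<integral>y. norm (q y *\<^sub>R f y) \<partial>lborel)" by (rule integral_norm_bound)
  also have "\<dots> \<le> (\<integral>y. e * \<bar>q y\<bar> \<partial>lborel)"
  proof (rule integral_mono)
    show "norm (q y *\<^sub>R f y) \<le> e * \<bar>q y\<bar>" for y
      using mult_left_mono[OF assms(3)[of y], of "\<bar>q y\<bar>"] by (cases "q y = 0") (auto simp: mult.commute)
  qed (use assms(1) integrable_norm[OF assms(2)] in auto)
  finally show ?thesis by simp
qed

lemma conv_continuous:
  fixes p :: "'a::euclidean_space \<Rightarrow> 'b::euclidean_space"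
  assumes q: "integrable lborel q" and p: "continuous_on UNIV p" "bounded {x. p x \<noteq> 0}"
  shows "continuous_on UNIV (conv q p)"
  unfolding continuous_on_iff
proof (intro ballI allI impI)
  fix x :: 'a and e :: real assume e: "0 < e"
  define A where "A = (\<integral>y. \<bar>q y\<bar> \<partial>lborel)"
  have A: "0 \<le> A" by (simp add: A_def)
  \<comment> \<open>The 1 is added because \<open>A\<close> may vanish.\<close>
  then have e': "0 < e / (A + 1)" using e by simp
  obtain d where d: "0 < d" "\<And>x y. norm (x - y) < d \<Longrightarrow> norm (p x - p y) < e / (A + 1)"
    using uniformly_continuous_bounded_support[OF p e'] by blast
  have "dist (conv q p x') (conv q p x) < e" if "dist x' x < d" for x'
  proof -
    have "conv q p x' - conv q p x = (\<integral>y. q y *\<^sub>R (p (x' - y) - p (x - y)) \<partial>lborel)"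
      unfolding conv_def scaleR_diff_right
      by (rule Bochner_Integration.integral_diff[symmetric]) (intro conv_integrable q p)+
    also have "norm \<dots> \<le> e / (A + 1) * A" unfolding A_def
    proof (rule norm_integral_scaleR_le[OF q])
      show "integrable lborel (\<lambda>y. q y *\<^sub>R (p (x' - y) - p (x - y)))"
        unfolding scaleR_diff_right by (intro Bochner_Integration.integrable_diff conv_integrable q p)
      show "norm (p (x' - y) - p (x - y)) \<le> e / ((\<integral>y. \<bar>q y\<bar> \<partial>lborel) + 1)" for y
        using d(2)[of "x' - y" "x - y"] that by (simp add: dist_norm A_def)
    qed (use e' in \<open>simp add: A_def\<close>)
    also have "\<dots> < e" using e A by (simp add: field_simps)
    finally show ?thesis by (simp add: dist_norm)
  qed
  then show "\<exists>d>0. \<forall>x'\<in>UNIV. dist x' x < d \<longrightarrow> dist (conv q p x') (conv q p x) < e"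
    using d(1) by blast
qed

text \<open>Differentiation under the integral sign: the remainder of \<open>p\<close> is small
  uniformly in the base point by \<open>uniformly_differentiable\<close>, so integrating it against
  \<open>q\<close> costs only a factor, the L1 norm of \<open>q\<close>.\<close>

lemma conv_has_derivative:
  fixes p :: "'a::euclidean_space \<Rightarrow> 'b::euclidean_space"
  assumes q: "integrable lborel q" and p: "Ck_on 1 p UNIV" "bounded {x. p x \<noteq> 0}"
  shows "(conv q p has_derivative (\<lambda>h. conv q (\<lambda>z. frechet_derivative p (at z) h) x)) (at x)"
proof -
  let ?D = "\<lambda>z. frechet_derivative p (at z)"
  note pd = Ck_on_SucD[OF p(1)[unfolded One_nat_def]]
  have cD: "continuous_on UNIV (\<lambda>z. ?D z h)" for h using pd(2) by simp
  note bD = bounded_frechet_derivative_support[OF p(2)]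
  note cp = Ck_on_imp_continuous[OF p(1)]
  have lin: "linear (?D z)" for z by (rule has_derivative_linear[OF pd(1)])
  have "linear (\<lambda>h. conv q (\<lambda>z. ?D z h) x)"
  proof (rule linearI)
    show "conv q (\<lambda>z. ?D z (h + h')) x = conv q (\<lambda>z. ?D z h) x + conv q (\<lambda>z. ?D z h') x" for h h'
      unfolding linear_add[OF lin] by (intro conv_add q cD bD)
    show "conv q (\<lambda>z. ?D z (c *\<^sub>R h)) x = c *\<^sub>R conv q (\<lambda>z. ?D z h) x" for c h
      unfolding linear_cmul[OF lin] by (rule conv_bounded_linear[symmetric, OF q cD bD bounded_linear_scaleR_right])
  qed
  then have bl: "bounded_linear (\<lambda>h. conv q (\<lambda>z. ?D z h) x)" by (rule linear_linear[THEN iffD2])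
  define A where "A = (\<integral>y. \<bar>q y\<bar> \<partial>lborel)"
  have A: "0 \<le> A" by (simp add: A_def)
  show ?thesis unfolding has_derivative_at_alt
  proof (intro conjI bl allI impI)
    fix e :: real assume e: "0 < e"
    have e': "0 < e / (A + 1)" using e A by simp
    obtain d where d: "0 < d" "\<And>z h. norm h < d \<Longrightarrow> norm (p (z + h) - p z - ?D z h) \<le> e / (A + 1) * norm h"
      using uniformly_differentiable[OF p e'] by blast
    have "norm (conv q p y - conv q p x - conv q (\<lambda>z. ?D z (y - x)) x) \<le> e * norm (y - x)"
      if "norm (y - x) < d" for y
    proof -
      let ?f = "\<lambda>t. p (y - t) - p (x - t) - ?D (x - t) (y - x)"
      note int = conv_integrable[OF q cp p(2)] conv_integrable[OF q cD bD]
      have "conv q p y - conv q p x - conv q (\<lambda>z. ?D z (y - x)) x = (\<integral>t. q t *\<^sub>R ?f t \<partial>lborel)"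
        unfolding conv_def scaleR_diff_right
        by (subst Bochner_Integration.integral_diff, intro Bochner_Integration.integrable_diff int, intro int,
            subst Bochner_Integration.integral_diff) (intro int refl)+
      also have "norm \<dots> \<le> e / (A + 1) * norm (y - x) * A" unfolding A_def
      proof (rule norm_integral_scaleR_le[OF q])
        show "integrable lborel (\<lambda>t. q t *\<^sub>R ?f t)"
          unfolding scaleR_diff_right by (intro Bochner_Integration.integrable_diff int)
        show "norm (?f t) \<le> e / ((\<integral>y. \<bar>q y\<bar> \<partial>lborel) + 1) * norm (y - x)" for t
          using d(2)[OF that, of "x - t"] by (simp add: A_def)
        show "0 \<le> e / ((\<integral>y. \<bar>q y\<bar> \<partial>lborel) + 1) * norm (y - x)"
          using e' by (intro mult_nonneg_nonneg) (simp_all add: A_def)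
      qed
      also have "\<dots> = e * (A / (A + 1)) * norm (y - x)" by simp
      also have "\<dots> \<le> e * 1 * norm (y - x)"
        using e A by (intro mult_right_mono mult_left_mono) auto
      finally show ?thesis by simp
    qed
    then show "\<exists>d>0. \<forall>y. norm (y - x) < d \<longrightarrow>
        norm (conv q p y - conv q p x - conv q (\<lambda>z. ?D z (y - x)) x) \<le> e * norm (y - x)"
      using d(1) by blast
  qed
qed

lemma Ck_on_conv:
  fixes p :: "'a::euclidean_space \<Rightarrow> 'b::euclidean_space"
  assumes "integrable lborel q" "Ck_on k p UNIV" "bounded {x. p x \<noteq> 0}"
  shows "Ck_on k (conv q p) UNIV"
  using assms(2,3)
proof (induction k arbitrary: p)
  case 0
  then show ?case using conv_continuous[OF assms(1)] by simp
next
  case (Suc k)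
  have 1: "Ck_on 1 p UNIV" by (rule Ck_on_mono[OF Suc.prems(1)]) simp
  show ?case
    by (rule Ck_on_SucI[OF conv_has_derivative[OF assms(1) 1 Suc.prems(2)]])
      (intro Suc.IH Ck_on_SucD(2)[OF Suc.prems(1)] bounded_frechet_derivative_support Suc.prems(2))
qed

lemma frechet_derivative_conv:
  fixes p :: "'a::euclidean_space \<Rightarrow> 'b::euclidean_space"
  assumes "integrable lborel q" "Ck_on 1 p UNIV" "bounded {x. p x \<noteq> 0}"
  shows "frechet_derivative (conv q p) (at x) v = conv q (\<lambda>z. frechet_derivative p (at z) v) x"
  using frechet_derivative_at[OF conv_has_derivative[OF assms]] by (metis (no_types))

text \<open>Every derivative falls on the field, one coordinate at a time. The duality argument for
  the variation relies on this to move a mollification from a function to a test field.\<close>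

lemma divergence_conv:
  fixes p :: "real ^ 'n::finite \<Rightarrow> real ^ 'n"
  assumes q: "integrable lborel q" and p: "Ck_on 1 p UNIV" "bounded {x. p x \<noteq> 0}"
  shows "divergence (conv q p) x = conv q (divergence p) x"
proof -
  note pd = Ck_on_SucD[OF p(1)[unfolded One_nat_def]]
  let ?d = "\<lambda>i z. frechet_derivative p (at z) (axis i 1) $ i"
  have 1: "partial i (\<lambda>y. g y $ i) x = frechet_derivative g (at x) (axis i 1) $ i"
    if "Ck_on (Suc 0) g UNIV" for g :: "real ^ 'n \<Rightarrow> real ^ 'n" and i x
    using partial_eqI[OF has_derivative_component[OF that]] by blast
  have c: "continuous_on UNIV (\<lambda>z. frechet_derivative p (at z) v)" for v
    using pd(2) by simp
  have "bounded {z. ?d i z \<noteq> 0}" for i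
    by (rule bounded_subset[OF bounded_frechet_derivative_support[OF p(2)], of _ "axis i 1"]) auto
  then have ci: "integrable lborel (\<lambda>y. q y *\<^sub>R ?d i (x - y))" for i
    by (intro conv_integrable[OF q] continuous_intros c)
  have "divergence (conv q p) x = (\<Sum>i\<in>UNIV. frechet_derivative (conv q p) (at x) (axis i 1) $ i)"
    unfolding divergence_def using 1[OF Ck_on_conv[OF q p(1)[unfolded One_nat_def] p(2)]] by simp
  also have "\<dots> = (\<Sum>i\<in>UNIV. conv q (?d i) x)"
    unfolding frechet_derivative_conv[OF q p]
    by (intro sum.cong refl conv_bounded_linear[OF q c bounded_frechet_derivative_support[OF p(2)] bounded_linear_vec_nth])
  also have "\<dots> = conv q (\<lambda>z. \<Sum>i\<in>UNIV. ?d i z) x"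
    unfolding conv_def scaleR_sum_right using ci by (intro Bochner_Integration.integral_sum[symmetric]) auto
  also have "(\<lambda>z. \<Sum>i\<in>UNIV. ?d i z) = divergence p"
    unfolding divergence_def using 1[OF p(1)[unfolded One_nat_def]] by auto
  finally show ?thesis .
qed

text \<open>The centre \<open>p\<close> is free because the approximation up to the boundary uses
  kernels supported away from the origin. No symmetry is imposed, and reflections are tracked
  explicitly.\<close>

definition mollifier :: "('a::euclidean_space \<Rightarrow> real) \<Rightarrow> 'a \<Rightarrow> real \<Rightarrow> bool" where
  "mollifier k p r \<longleftrightarrow> (\<forall>l. Ck_on l k UNIV) \<and> (\<forall>x. 0 \<le> k x) \<and> (\<forall>x. k x \<noteq> 0 \<longrightarrow> x \<in> ball p r) \<and>
     (\<integral>x. k x \<partial>lborel) = 1"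

lemma mollifierD:
  assumes "mollifier k p r"
  shows "Ck_on l k UNIV" "0 \<le> k x" "k x \<noteq> 0 \<Longrightarrow> x \<in> ball p r" "(\<integral>x. k x \<partial>lborel) = 1"
    "bounded {x. k x \<noteq> 0}" "integrable lborel k" "continuous_on UNIV k" "k \<in> borel_measurable borel"
proof -
  show 1: "Ck_on l k UNIV" "0 \<le> k x" "k x \<noteq> 0 \<Longrightarrow> x \<in> ball p r" "(\<integral>x. k x \<partial>lborel) = 1" for l x
    using assms by (auto simp: mollifier_def)
  show 2: "bounded {x. k x \<noteq> 0}" by (rule bounded_subset[OF bounded_ball[of p r]]) (use 1(3) in blast)
  show 3: "continuous_on UNIV k" by (rule Ck_on_imp_continuous[OF 1(1)])
  show "integrable lborel k" by (rule integrable_bounded_support[OF 3 2])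
  show "k \<in> borel_measurable borel" by (rule borel_measurable_continuous_onI[OF 3])
qed

lemma mollifier_exists: "0 < r \<Longrightarrow> \<exists>k. mollifier k (p::'a::euclidean_space) r"
proof -
  assume r: "0 < r"
  let ?b = "bump p r"
  define I where "I = (\<integral>x. ?b x \<partial>lborel)"
  have c: "continuous_on UNIV ?b" by (rule Ck_on_imp_continuous[OF Ck_on_bump])
  have "{x. ?b x \<noteq> 0} \<subseteq> ball p r" using bump_eq_0_iff[OF r] by blast
  then have int: "integrable lborel ?b"
    by (intro integrable_bounded_support[OF c]) (rule bounded_subset[OF bounded_ball])
  \<comment> \<open>A vanishing integral would make the bump zero almost everywhere, and a nonempty
    open ball would be null.\<close>
  have "I \<noteq> 0"
  proof
    assume "I = 0"
    then have "AE x in lborel. ?b x = 0"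
      using integral_nonneg_eq_0_iff_AE[OF int] bump_nonneg by (auto simp: I_def)
    then have "AE x in lborel. x \<notin> ball p r" using bump_eq_0_iff[OF r] by auto
    then have "emeasure lborel (ball p r) = 0" by (subst (asm) AE_iff_measurable[of "ball p r"]) auto
    moreover have "open (ball p r)" "ball p r \<noteq> {}" using r by auto
    ultimately show False
      using open_not_negligible[of "ball p r"] negligible_iff_emeasure0[of "ball p r"] by auto
  qed
  moreover have "0 \<le> I" by (simp add: I_def bump_nonneg)
  ultimately have I: "0 < I" by simp
  have "mollifier (\<lambda>x. ?b x / I) p r"
    using I bump_nonneg[of p r] bump_eq_0_iff[OF r, of p]
    by (auto simp: mollifier_def I_def[symmetric] intro!: Ck_on_divide divide_nonneg_pos)
  then show ?thesis by blast
qed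

lemma Ck_on_affine:
  assumes "Ck_on k f UNIV" shows "Ck_on k (\<lambda>x. f (c *\<^sub>R x + t)) UNIV"
  using assms
proof (induction k arbitrary: f)
  case 0
  have "continuous_on UNIV (\<lambda>x. c *\<^sub>R x + t)" by (intro continuous_intros)
  with 0 show ?case using continuous_on_compose2[of UNIV f UNIV "\<lambda>x. c *\<^sub>R x + t"] by simp
next
  case (Suc k)
  have "((\<lambda>x. f (c *\<^sub>R x + t)) has_derivative (\<lambda>v. frechet_derivative f (at (c *\<^sub>R x + t)) (c *\<^sub>R v))) (at x)" for x
    by (rule has_derivative_compose[OF _ Ck_on_SucD(1)[OF Suc.prems]]) (auto intro!: derivative_eq_intros)
  then show ?case
    by (rule Ck_on_SucI) (intro Suc.IH Ck_on_SucD(2)[OF Suc.prems])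
qed

text \<open>Reflection moves the centre to \<open>- p\<close>: a kernel shifted against the inward
  cone becomes one shifted along it.\<close>

lemma mollifier_reflect: "mollifier k p r \<Longrightarrow> mollifier (\<lambda>x. k (- x)) (- p) r"
proof -
  assume m: "mollifier k p r"
  have "Ck_on l (\<lambda>x. k (- x)) UNIV" for l
    using Ck_on_affine[OF mollifierD(1)[OF m, of l], of "-1" 0] by simp
  moreover have "x \<in> ball (- p) r" if "k (- x) \<noteq> 0" for x
  proof -
    have "dist p (- x) = dist (- p) x" by (metis dist_minus minus_minus)
    then show ?thesis using mollifierD(3)[OF m that] by simp
  qed
  moreover have "(\<integral>x. k (- x) \<partial>lborel) = 1"
    using lborel_integral_reflect[OF mollifierD(8)[OF m], of 0] mollifierD(4)[OF m] by simp
  ultimately show ?thesis using mollifierD(2)[OF m] by (simp add: mollifier_def)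
qed

text \<open>The kernel is a probability density, so the convolution is a mean of the values f(x - y)
  with y in the ball. Besides uniform approximation this yields sup bounds (with
  \<open>c = 0\<close>) and localizes supports (with \<open>c = 0\<close> and
  \<open>e = 0\<close>).\<close>

lemma conv_mollifier_near:
  fixes f :: "'a::euclidean_space \<Rightarrow> 'b::euclidean_space"
  assumes m: "mollifier k p r" and f: "continuous_on UNIV f" "bounded {x. f x \<noteq> 0}"
    and e: "\<And>y. y \<in> ball p r \<Longrightarrow> norm (f (x - y) - c) \<le> e"
  shows "norm (conv k f x - c) \<le> e"
proof -
  \<comment> \<open>The bound \<open>e\<close> is assumed only over the ball, which must therefore
    be shown nonempty; a kernel of integral 1 is not identically zero.\<close>
  have "0 \<le> e"
  proof -
    have "\<exists>y. k y \<noteq> 0"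
    proof (rule ccontr)
      assume "\<not> ?thesis"
      then have "k = (\<lambda>_. 0)" by auto
      then show False using mollifierD(4)[OF m] by simp
    qed
    then show ?thesis using e mollifierD(3)[OF m] order_trans[OF norm_ge_zero] by blast
  qed
  note int = conv_integrable[OF mollifierD(6)[OF m] f] integrable_scaleR_left[OF mollifierD(6)[OF m], of c]
  have "conv k f x - c = (\<integral>y. k y *\<^sub>R f (x - y) \<partial>lborel) - (\<integral>y. k y *\<^sub>R c \<partial>lborel)"
    using mollifierD(4,6)[OF m] by (simp add: conv_def)
  also have "\<dots> = (\<integral>y. k y *\<^sub>R (f (x - y) - c) \<partial>lborel)"
    unfolding scaleR_diff_right using int by (intro Bochner_Integration.integral_diff[symmetric]) auto
  also have "norm \<dots> \<le> e * (\<integral>y. \<bar>k y\<bar> \<partial>lborel)"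
  proof (rule norm_integral_scaleR_le)
    show "integrable lborel (\<lambda>y. k y *\<^sub>R (f (x - y) - c))"
      unfolding scaleR_diff_right using int by (intro Bochner_Integration.integrable_diff) auto
  qed (use e mollifierD[OF m] \<open>0 \<le> e\<close> in auto)
  also have "\<dots> = e" using mollifierD(2,4)[OF m] by simp
  finally show ?thesis .
qed

text \<open>Fubini: the adjoint of convolution with \<open>k\<close> is convolution with the
  reflected kernel. This is how the mollification of a function is moved onto a test field.\<close>

lemma integral_conv_mult:
  fixes q k f :: "'a::euclidean_space \<Rightarrow> real"
  assumes q: "integrable lborel q" and k: "continuous_on UNIV k" "bounded {x. k x \<noteq> 0}"
    and f: "integrable lborel f"
  shows "(\<integral>x. conv q k x * f x \<partial>lborel) = (\<integral>y. q y * conv (\<lambda>z. k (- z)) f y \<partial>lborel)"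
    "integrable lborel (\<lambda>x. conv q k x * f x)"
proof -
  obtain B where B: "0 < B" "\<And>x. norm (k x) \<le> B"
    using bounded_range_bounded_support[OF k] by blast
  have [measurable]: "k \<in> borel_measurable borel" by (rule borel_measurable_continuous_onI[OF k(1)])
  note [measurable] = borel_measurable_integrable[OF q, simplified] borel_measurable_integrable[OF f, simplified]
  have base: "integrable (lborel \<Otimes>\<^sub>M lborel) (\<lambda>(x, y). f x * q y)"
    by (rule lborel_pair.Fubini_integrable) (use q f in \<open>auto simp: norm_mult abs_mult\<close>)
  have int: "integrable (lborel \<Otimes>\<^sub>M lborel) (\<lambda>(x, y). q y * k (x - y) * f x)"
  proof (rule Bochner_Integration.integrable_bound)
    show "integrable (lborel \<Otimes>\<^sub>M lborel) (\<lambda>z. B * (case z of (x, y) \<Rightarrow> f x * q y))"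
      using base by simp
    show "AE z in lborel \<Otimes>\<^sub>M lborel. norm (case z of (x, y) \<Rightarrow> q y * k (x - y) * f x) \<le> norm (B * (case z of (x, y) \<Rightarrow> f x * q y))"
    proof (intro AE_I2, clarsimp simp: abs_mult)
      fix x y
      have "\<bar>k (x - y)\<bar> * (\<bar>q y\<bar> * \<bar>f x\<bar>) \<le> B * (\<bar>q y\<bar> * \<bar>f x\<bar>)"
        using B(2)[of "x - y"] by (intro mult_right_mono) auto
      then show "\<bar>q y\<bar> * \<bar>k (x - y)\<bar> * \<bar>f x\<bar> \<le> \<bar>B\<bar> * (\<bar>f x\<bar> * \<bar>q y\<bar>)"
        using B(1) by (simp add: mult_ac)
    qed
  qed measurable
  have c: "(\<integral>y. q y * k (x - y) * f x \<partial>lborel) = conv q k x * f x" for x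
    by (simp add: conv_def)
  have "(\<integral>x. k (x - y) * f x \<partial>lborel) = conv (\<lambda>z. k (- z)) f y" for y
  proof -
    have "conv (\<lambda>z. k (- z)) f y = conv f (\<lambda>z. k (- z)) y" by (subst conv_commute) auto
    then show ?thesis by (simp add: conv_def mult.commute)
  qed
  then have c': "(\<integral>x. q y * k (x - y) * f x \<partial>lborel) = q y * conv (\<lambda>z. k (- z)) f y" for y
    by (simp add: mult.assoc)
  show "(\<integral>x. conv q k x * f x \<partial>lborel) = (\<integral>y. q y * conv (\<lambda>z. k (- z)) f y \<partial>lborel)"
    using lborel_pair.Fubini_integral[OF int] unfolding c c' by (rule sym)
  show "integrable lborel (\<lambda>x. conv q k x * f x)"
    using lborel_pair.integrable_fst[OF int] unfolding c .
qed

lemma set_integral_lborel: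
  fixes F :: "'a::euclidean_space \<Rightarrow> real"
  assumes "F \<in> borel_measurable borel" "{x. F x \<noteq> 0} \<subseteq> U"
  shows "set_lebesgue_integral lebesgue U F = (\<integral>x. F x \<partial>lborel)"
proof -
  have "indicator U x *\<^sub>R F x = F x" for x using assms(2) by (auto simp: indicator_def)
  then show ?thesis using integral_completion[of F lborel] assms(1) by (simp only: set_lebesgue_integral_def) simp
qed

text \<open>Two dominated limits. The function is cut off in space and clamped in value, and the
  bounded result is replaced by continuous functions converging almost everywhere. The latter pass
  through the same cutoff and clamp, which supplies the integrable majorant.\<close>

lemma integrable_dense_continuous:
  fixes f :: "'a::euclidean_space \<Rightarrow> real"
  assumes f: "integrable lborel f" and e: "0 < e"
  shows "\<exists>g. continuous_on UNIV g \<and> bounded {x. g x \<noteq> 0} \<and> (\<integral>x. \<bar>f x - g x\<bar> \<partial>lborel) < e"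
proof -
  define cut where "cut = (\<lambda>(n::nat) (x::'a). max 0 (min 1 (real n + 1 - norm x)))"
  define cl where "cl = (\<lambda>(n::nat) (y::real). max (- real n) (min (real n) y))"
  have cut01: "0 \<le> cut n x" "cut n x \<le> 1" for n x by (auto simp: cut_def)
  have cut0: "cut n x = 0" if "norm x \<ge> real n + 1" for n x using that by (auto simp: cut_def)
  have ccut: "continuous_on UNIV (cut n)" for n unfolding cut_def by (intro continuous_intros)
  have ccl: "continuous_on UNIV (cl n)" for n unfolding cl_def by (intro continuous_intros)
  have clle: "\<bar>cl n y\<bar> \<le> \<bar>y\<bar>" "\<bar>cl n y\<bar> \<le> real n" for n y by (auto simp: cl_def)
  have [measurable]: "cut n \<in> borel_measurable borel" "cl n \<in> borel_measurable borel" for n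
    by (rule borel_measurable_continuous_onI[OF ccut], rule borel_measurable_continuous_onI[OF ccl])
  note [measurable] = borel_measurable_integrable[OF f, simplified]
  define F where "F = (\<lambda>n x. cut n x * cl n (f x))"
  have "(\<lambda>n. \<integral>x. \<bar>f x - F n x\<bar> \<partial>lborel) \<longlonglongrightarrow> (\<integral>x. (0::real) \<partial>(lborel :: 'a measure))"
  proof (rule integral_dominated_convergence[where w = "\<lambda>x. 2 * \<bar>f x\<bar>"])
    show "AE x in lborel. (\<lambda>n. \<bar>f x - F n x\<bar>) \<longlonglongrightarrow> 0"
    proof (intro AE_I2 tendsto_eventually eventually_sequentiallyI)
      fix x n assume n: "nat \<lceil>norm x\<rceil> + nat \<lceil>\<bar>f x\<bar>\<rceil> \<le> n"
      then have "norm x \<le> real n" "\<bar>f x\<bar> \<le> real n" by linarith+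
      then show "\<bar>f x - F n x\<bar> = 0" by (simp add: F_def cut_def cl_def)
    qed
    show "AE x in lborel. norm \<bar>f x - F n x\<bar> \<le> 2 * \<bar>f x\<bar>" for n
    proof (intro AE_I2)
      fix x
      have "\<bar>F n x\<bar> \<le> 1 * \<bar>f x\<bar>" unfolding F_def abs_mult using cut01[of n x] clle(1)[of n "f x"]
        by (intro mult_mono) auto
      then show "norm \<bar>f x - F n x\<bar> \<le> 2 * \<bar>f x\<bar>" by simp
    qed
  qed (use f in \<open>auto simp: F_def\<close>)
  then have "\<forall>\<^sub>F n in sequentially. (\<integral>x. \<bar>f x - F n x\<bar> \<partial>lborel) < e / 2"
    using e by (intro order_tendstoD) auto
  then obtain n where n: "(\<integral>x. \<bar>f x - F n x\<bar> \<partial>lborel) < e / 2"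
    by (auto simp: eventually_sequentially)
  \<comment> \<open>This form of measurability provides the continuous approximants, converging off
    a negligible set.\<close>
  have "f measurable_on UNIV"
    by (subst measurable_on_iff_borel_measurable) (auto intro!: measurable_completion simp: lebesgue_on_UNIV_eq)
  then obtain N g where N: "negligible N" and g: "\<And>m. continuous_on UNIV (g m)"
    "\<And>x. x \<notin> N \<Longrightarrow> (\<lambda>m. g m x) \<longlonglongrightarrow> f x"
    unfolding measurable_on_def by auto
  have AEN: "AE x in lborel. x \<notin> N"
    using AE_not_in[of N lebesgue] N by (simp add: negligible_iff_null_sets AE_completion_iff)
  have [measurable]: "g m \<in> borel_measurable borel" for m by (rule borel_measurable_continuous_onI[OF g(1)])
  define G where "G = (\<lambda>m x. cut n x * cl n (g m x))"
  have wint: "integrable lborel (\<lambda>x::'a. 2 * real n * indicator (cball 0 (real n + 1)) x)"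
    using emeasure_lborel_cball_finite[of 0 "real n + 1"]
    by (intro integrable_mult_right integrable_real_indicator) auto
  have GF: "\<bar>cut n x * cl n y\<bar> \<le> real n * indicator (cball 0 (real n + 1)) x" for x y
  proof (cases "norm x \<le> real n + 1")
    case True
    have "\<bar>cut n x\<bar> * \<bar>cl n y\<bar> \<le> 1 * real n" using cut01[of n x] clle(2)[of n y] by (intro mult_mono) auto
    then show ?thesis using True by (simp add: abs_mult)
  qed (simp add: cut0)
  have Fint: "integrable lborel (F n)"
  proof (rule Bochner_Integration.integrable_bound[OF wint])
    show "AE x in lborel. norm (F n x) \<le> norm (2 * real n * indicator (cball 0 (real n + 1)) x)"
    proof (intro AE_I2)
      fix x show "norm (F n x) \<le> norm (2 * real n * indicator (cball 0 (real n + 1)) x)"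
        using GF[of x "f x"] by (auto simp: F_def indicator_def)
    qed
  qed (simp add: F_def)
  have Gint: "integrable lborel (G m)" for m
  proof (rule Bochner_Integration.integrable_bound[OF wint])
    show "AE x in lborel. norm (G m x) \<le> norm (2 * real n * indicator (cball 0 (real n + 1)) x)"
    proof (intro AE_I2)
      fix x show "norm (G m x) \<le> norm (2 * real n * indicator (cball 0 (real n + 1)) x)"
        using GF[of x "g m x"] by (auto simp: G_def indicator_def)
    qed
  qed (simp add: G_def)
  have "(\<lambda>m. \<integral>x. \<bar>F n x - G m x\<bar> \<partial>lborel) \<longlonglongrightarrow> (\<integral>x. (0::real) \<partial>(lborel :: 'a measure))"
  proof (rule integral_dominated_convergence[OF _ _ wint])
    show "AE x in lborel. (\<lambda>m. \<bar>F n x - G m x\<bar>) \<longlonglongrightarrow> 0"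
      using AEN
    proof eventually_elim
      case (elim x)
      have "(\<lambda>m. cl n (g m x)) \<longlonglongrightarrow> cl n (f x)"
        unfolding cl_def by (intro tendsto_intros g(2) elim)
      then have "(\<lambda>m. \<bar>F n x - G m x\<bar>) \<longlonglongrightarrow> \<bar>F n x - cut n x * cl n (f x)\<bar>"
        unfolding G_def by (intro tendsto_intros)
      then show ?case by (simp add: F_def)
    qed
    show "AE x in lborel. norm \<bar>F n x - G m x\<bar> \<le> 2 * real n * indicator (cball 0 (real n + 1)) x" for m
    proof (intro AE_I2)
      fix x
      show "norm \<bar>F n x - G m x\<bar> \<le> 2 * real n * indicator (cball 0 (real n + 1)) x"
        using GF[of x "f x"] GF[of x "g m x"] unfolding F_def G_def real_norm_def mult.assoc by linarith
    qed
  qed (auto simp: F_def G_def)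
  then have "\<forall>\<^sub>F m in sequentially. (\<integral>x. \<bar>F n x - G m x\<bar> \<partial>lborel) < e / 2"
    using e by (intro order_tendstoD) auto
  then obtain m where m: "(\<integral>x. \<bar>F n x - G m x\<bar> \<partial>lborel) < e / 2"
    by (auto simp: eventually_sequentially)
  have "(\<integral>x. \<bar>f x - G m x\<bar> \<partial>lborel) \<le> (\<integral>x. \<bar>f x - F n x\<bar> + \<bar>F n x - G m x\<bar> \<partial>lborel)"
    using f Fint Gint by (intro integral_mono) auto
  also have "\<dots> < e" using n m f Fint Gint by simp
  finally have "(\<integral>x. \<bar>f x - G m x\<bar> \<partial>lborel) < e" .
  moreover have "continuous_on UNIV (G m)"
    unfolding G_def using continuous_on_compose2[OF ccl g(1)] by (intro continuous_intros ccut) auto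
  moreover have "bounded {x. G m x \<noteq> 0}"
  proof (rule bounded_subset[OF bounded_cball[of 0 "real n + 1"]], rule subsetI)
    fix x assume "x \<in> {x. G m x \<noteq> 0}"
    then have "cut n x \<noteq> 0" by (simp add: G_def)
    then show "x \<in> cball 0 (real n + 1)" using cut0[of n x] by fastforce
  qed
  ultimately show ?thesis by blast
qed

text \<open>Young's inequality in L1: by Fubini each value of \<open>h\<close> is spread over a
  translate of \<open>k\<close>, which has integral 1.\<close>

lemma conv_mollifier_L1_le:
  fixes h :: "'a::euclidean_space \<Rightarrow> real"
  assumes h: "integrable lborel h" and m: "mollifier k p r"
  shows "integrable lborel (conv h k)" "(\<integral>x. \<bar>conv h k x\<bar> \<partial>lborel) \<le> (\<integral>x. \<bar>h x\<bar> \<partial>lborel)"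
proof -
  note [measurable] = borel_measurable_integrable[OF h, simplified] mollifierD(8)[OF m]
  have k0: "0 \<le> k x" for x by (rule mollifierD(2)[OF m])
  have tr: "(\<integral>x. k (x - y) \<partial>lborel) = 1" for y
    using lborel_integral_translate[of k "- y"] mollifierD(4)[OF m] by simp
  have tri: "integrable lborel (\<lambda>x. k (x - y))" for y
    using lborel_integrable_reflect[OF lborel_integrable_reflect[OF mollifierD(6)[OF m], of 0], of y] by simp
  have int: "integrable (lborel \<Otimes>\<^sub>M lborel) (\<lambda>(y, x). h y * k (x - y))"
    by (rule lborel_pair.Fubini_integrable) (use h in \<open>auto simp: abs_mult k0 tr intro!: tri integrable_mult_right\<close>)
  have int': "integrable (lborel \<Otimes>\<^sub>M lborel) (\<lambda>(y, x). \<bar>h y\<bar> * k (x - y))"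
    by (rule lborel_pair.Fubini_integrable) (use h in \<open>auto simp: abs_mult k0 tr intro!: tri integrable_mult_right\<close>)
  show 1: "integrable lborel (conv h k)"
    using lborel_pair.integrable_snd[OF int] by (simp add: conv_def[abs_def])
  have "(\<integral>x. \<bar>conv h k x\<bar> \<partial>lborel) \<le> (\<integral>x. (\<integral>y. \<bar>h y\<bar> * k (x - y) \<partial>lborel) \<partial>lborel)"
  proof (rule integral_mono)
    show "\<bar>conv h k x\<bar> \<le> (\<integral>y. \<bar>h y\<bar> * k (x - y) \<partial>lborel)" for x
      unfolding conv_def using integral_norm_bound[of lborel "\<lambda>y. h y *\<^sub>R k (x - y)"] by (simp add: abs_mult k0)
  qed (use 1 lborel_pair.integrable_snd[OF int'] in auto)
  also have "\<dots> = (\<integral>y. (\<integral>x. \<bar>h y\<bar> * k (x - y) \<partial>lborel) \<partial>lborel)"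
    by (rule lborel_pair.Fubini_integral[OF int'])
  also have "\<dots> = (\<integral>x. \<bar>h x\<bar> \<partial>lborel)" by (simp add: tr)
  finally show "(\<integral>x. \<bar>conv h k x\<bar> \<partial>lborel) \<le> (\<integral>x. \<bar>h x\<bar> \<partial>lborel)" .
qed

lemma conv_tendsto_L1:
  fixes f :: "'a::euclidean_space \<Rightarrow> real"
  assumes f: "integrable lborel f" and e: "0 < e"
  shows "\<exists>d>0. \<forall>k p r. mollifier k p r \<and> ball p r \<subseteq> ball 0 d \<longrightarrow> (\<integral>x. \<bar>conv f k x - f x\<bar> \<partial>lborel) < e"
proof -
  obtain g where g: "continuous_on UNIV g" "bounded {x. g x \<noteq> 0}" and fg: "(\<integral>x. \<bar>f x - g x\<bar> \<partial>lborel) < e / 3"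
    using integrable_dense_continuous[OF f, of "e / 3"] e by auto
  have gint: "integrable lborel g" by (rule integrable_bounded_support[OF g])
  obtain R where R: "\<And>x. g x \<noteq> 0 \<Longrightarrow> norm x \<le> R" using g(2) by (auto simp: bounded_iff)
  define M where "M = measure lborel (cball (0::'a) (R + 1))"
  have M: "0 \<le> M" by (simp add: M_def)
  define e' where "e' = e / (3 * (M + 1))"
  have e': "0 < e'" using e M by (simp add: e'_def)
  have e'M: "e' * M < e / 3" using e M by (simp add: e'_def field_simps)
  obtain d where d: "0 < d" "\<And>x y. norm (x - y) < d \<Longrightarrow> norm (g x - g y) < e'"
    using uniformly_continuous_bounded_support[OF g e'] by blast
  have "(\<integral>x. \<bar>conv f k x - f x\<bar> \<partial>lborel) < e" if m: "mollifier k p r" and pr: "ball p r \<subseteq> ball 0 (min d 1)" for k p r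
  proof -
    note kc = mollifierD(7,5)[OF m]
    have ig: "integrable lborel (conv g k)" by (rule conv_mollifier_L1_le(1)[OF gint m])
    have ih: "integrable lborel (\<lambda>x. f x - g x)" using f gint by simp
    note i1 = conv_mollifier_L1_le[OF ih m]
    have lin: "conv (\<lambda>x. f x - g x) k x = conv f k x - conv g k x" for x
      unfolding conv_def scaleR_diff_left
      by (intro Bochner_Integration.integral_diff conv_integrable f gint kc)
    have gk: "conv g k = conv k g"
      using borel_measurable_integrable[OF gint] mollifierD(8)[OF m] by (intro conv_commute) auto
    have near: "norm (conv g k x - g x) \<le> e' * indicator (cball 0 (R + 1)) x" for x
    proof (cases "norm x \<le> R + 1")
      case True
      have "norm (conv k g x - g x) \<le> e'"
      proof (rule conv_mollifier_near[OF m g])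
        fix y assume "y \<in> ball p r"
        then show "norm (g (x - y) - g x) \<le> e'" using pr d(2)[of "x - y" x] by force
      qed
      then show ?thesis using True gk by simp
    next
      case False
      have "norm (conv k g x - 0) \<le> 0"
      proof (rule conv_mollifier_near[OF m g])
        fix y assume "y \<in> ball p r"
        then have "norm y < 1" using pr by force
        then have "\<not> norm (x - y) \<le> R" using False norm_triangle_sub[of x y] by linarith
        then show "norm (g (x - y) - 0) \<le> 0" using R[of "x - y"] by auto
      qed
      moreover have "g x = 0" using False R[of x] by force
      ultimately show ?thesis using False gk by simp
    qed
    have i2: "(\<integral>x. \<bar>conv g k x - g x\<bar> \<partial>lborel) \<le> e' * M"
      using integral_bounded_support_le[of "\<lambda>x. \<bar>conv g k x - g x\<bar>" e' "R + 1"] near e' by (simp add: M_def)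
    have "(\<integral>x. \<bar>conv f k x - f x\<bar> \<partial>lborel) \<le>
      (\<integral>x. \<bar>conv (\<lambda>x. f x - g x) k x\<bar> + \<bar>conv g k x - g x\<bar> + \<bar>f x - g x\<bar> \<partial>lborel)"
    proof (rule integral_mono)
      show "\<bar>conv f k x - f x\<bar> \<le> \<bar>conv (\<lambda>x. f x - g x) k x\<bar> + \<bar>conv g k x - g x\<bar> + \<bar>f x - g x\<bar>" for x
        by (simp add: lin)
    qed (use i1(1) ih ig gint f conv_mollifier_L1_le(1)[OF f m] in auto)
    also have "\<dots> = (\<integral>x. \<bar>conv (\<lambda>x. f x - g x) k x\<bar> \<partial>lborel) + (\<integral>x. \<bar>conv g k x - g x\<bar> \<partial>lborel) + (\<integral>x. \<bar>f x - g x\<bar> \<partial>lborel)"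
      using i1(1) ih ig gint by simp
    also have "\<dots> < e" using i1(2) i2 fg e'M by linarith
    finally show ?thesis .
  qed
  then show ?thesis using d(1) by (intro exI[of _ "min d 1"]) auto
qed

section \<open>Weak gradients\<close>

text \<open>Hypotheses are stated for the completed measure, whereas convolution and Fubini are used
  over \<open>lborel\<close>; a Borel version extended by zero mediates.\<close>

lemma borel_representative:
  fixes f :: "'a::euclidean_space \<Rightarrow> real"
  assumes "set_integrable lebesgue K f" "K \<in> sets borel"
  shows "\<exists>f'. integrable lborel f' \<and> (\<forall>x. x \<notin> K \<longrightarrow> f' x = 0) \<and> (AE x in lebesgue. x \<in> K \<longrightarrow> f' x = f x)"
proof -
  have i: "integrable lebesgue (\<lambda>x. indicator K x * f x)" using assms(1) by (simp add: set_integrable_def)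
  obtain h where h: "h \<in> borel_measurable lborel" "AE x in lborel. indicator K x * f x = h x"
    using completion_ex_borel_measurable_real[OF borel_measurable_integrable[OF i]] by blast
  have [measurable]: "h \<in> borel_measurable borel" "K \<in> sets borel" using h(1) assms(2) by auto
  let ?f = "\<lambda>x. indicator K x * h x"
  have ae: "AE x in lebesgue. indicator K x * f x = ?f x"
    by (rule AE_mp[OF AE_completion[OF h(2)]]) (auto simp: indicator_def)
  have "?f \<in> borel_measurable lebesgue" by (intro measurable_completion) measurable
  then have "integrable lebesgue ?f"
    using ae i by (subst integrable_cong_AE[of _ _ "\<lambda>x. indicator K x * f x"]) auto
  then have "integrable lborel ?f" by (subst (asm) integrable_completion) auto
  moreover have "AE x in lebesgue. x \<in> K \<longrightarrow> ?f x = f x"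
    using ae by eventually_elim auto
  ultimately show ?thesis by (intro exI[of _ ?f]) auto
qed

lemma compactly_supported_inD:
  assumes "compactly_supported_in f U"
  shows "bounded {x. f x \<noteq> 0}" "{x. f x \<noteq> 0} \<subseteq> U" "compact (closure {x. f x \<noteq> 0})" "closure {x. f x \<noteq> 0} \<subseteq> U"
  using assms closure_subset[of "{x. f x \<noteq> 0}"] compact_imp_bounded bounded_subset
  unfolding compactly_supported_in_def by blast+

lemma compactly_supported_inI:
  fixes f :: "'a::euclidean_space \<Rightarrow> 'b::zero"
  assumes "{x. f x \<noteq> 0} \<subseteq> K" "compact K" "K \<subseteq> U" shows "compactly_supported_in f U"
proof -
  have "closure {x. f x \<noteq> 0} \<subseteq> K" by (rule closure_minimal[OF assms(1) compact_imp_closed[OF assms(2)]])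
  then show ?thesis using assms compact_closure bounded_subset[OF compact_imp_bounded[OF assms(2)]]
    unfolding compactly_supported_in_def by blast
qed

text \<open>The sum of \<open>K\<close> and a closed ball is again compact, so one compact set
  absorbs all small shifts of \<open>K\<close>.\<close>

lemma compact_nbhd:
  fixes K :: "'a::euclidean_space set"
  assumes "compact K" "open U" "K \<subseteq> U"
  shows "\<exists>d>0. \<exists>C. compact C \<and> C \<subseteq> U \<and> (\<forall>x\<in>K. \<forall>y. norm y \<le> d \<longrightarrow> x + y \<in> C)"
proof -
  obtain d where d: "0 < d" "(\<Union>x\<in>K. cball x d) \<subseteq> U"
    using compact_subset_open_imp_ball_epsilon_subset assms
    by (metis compact_subset_open_imp_cball_epsilon_subset)
  let ?C = "{x + y |x y. x \<in> K \<and> y \<in> cball 0 d}"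
  have "compact ?C" using assms(1) by (intro compact_sums) auto
  moreover have "?C \<subseteq> U" using d(2) by (fastforce simp: dist_norm)
  ultimately show ?thesis using d(1) by (intro exI[of _ d] conjI exI[of _ ?C]) auto
qed

lemma test_integral_bound:
  fixes f h :: "'a::euclidean_space \<Rightarrow> real"
  assumes f: "set_integrable lebesgue C f" and h: "continuous_on UNIV h" "\<And>x. \<bar>h x\<bar> \<le> B" "{x. h x \<noteq> 0} \<subseteq> C"
    and C: "C \<subseteq> U"
  shows "set_integrable lebesgue U (\<lambda>x. f x * h x)"
    "\<bar>set_lebesgue_integral lebesgue U (\<lambda>x. f x * h x)\<bar> \<le> B * set_lebesgue_integral lebesgue C (\<lambda>x. \<bar>f x\<bar>)"
proof -
  have [measurable]: "h \<in> borel_measurable lebesgue"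
    using borel_measurable_continuous_onI[OF h(1)] by (intro measurable_completion) auto
  have i: "integrable lebesgue (\<lambda>x. indicator C x * f x)" using f by (simp add: set_integrable_def)
  have eq: "indicator U x *\<^sub>R (f x * h x) = (indicator C x * f x) * h x" for x
    using h(3) C by (auto simp: indicator_def)
  have bd: "\<bar>(indicator C x * f x) * h x\<bar> \<le> B * (indicator C x * \<bar>f x\<bar>)" for x
    using mult_left_mono[OF h(2)[of x], of "\<bar>f x\<bar>"] by (simp add: abs_mult indicator_def mult.commute)
  have B: "0 \<le> B" using h(2)[of undefined] by linarith
  have ia: "integrable lebesgue (\<lambda>x. B * (indicator C x * \<bar>f x\<bar>))"
    using integrable_abs[OF i] by (simp add: abs_mult)
  have "integrable lebesgue (\<lambda>x. (indicator C x * f x) * h x)"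
    by (rule Bochner_Integration.integrable_bound[OF ia])
      (use bd B borel_measurable_integrable[OF i] in \<open>auto simp: abs_mult\<close>)
  then show s: "set_integrable lebesgue U (\<lambda>x. f x * h x)" by (simp only: set_integrable_def eq)
  have "\<bar>set_lebesgue_integral lebesgue U (\<lambda>x. f x * h x)\<bar> \<le> (\<integral>x. \<bar>(indicator C x * f x) * h x\<bar> \<partial>lebesgue)"
    unfolding set_lebesgue_integral_def eq by (rule integral_abs_bound)
  also have "\<dots> \<le> (\<integral>x. B * (indicator C x * \<bar>f x\<bar>) \<partial>lebesgue)"
    by (rule Bochner_Integration.integral_mono'[OF ia bd]) (use B in auto)
  finally show "\<bar>set_lebesgue_integral lebesgue U (\<lambda>x. f x * h x)\<bar> \<le> B * set_lebesgue_integral lebesgue C (\<lambda>x. \<bar>f x\<bar>)"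
    by (simp add: set_lebesgue_integral_def)
qed

lemma partial_support: "{x. partial i f x \<noteq> 0} \<subseteq> closure {x. f x \<noteq> 0}"
  unfolding partial_def by (rule frechet_derivative_support)

lemma locally_integrable_component:
  assumes "locally_integrable_on g \<Omega>"
  shows "locally_integrable_on (\<lambda>x. g x $ i) \<Omega>"
  unfolding locally_integrable_on_def set_integrable_def
proof (intro allI impI)
  fix K assume "compact K \<and> K \<subseteq> \<Omega>"
  then have "integrable lebesgue (\<lambda>x. indicator K x *\<^sub>R g x)"
    using assms by (auto simp: locally_integrable_on_def set_integrable_def)
  from integrable_bounded_linear[OF bounded_linear_vec_nth this, of i]
  show "integrable lebesgue (\<lambda>x. indicator K x *\<^sub>R g x $ i)" by simp
qed

text \<open>Weak gradients are tested with smooth functions by definition, but the variation with C1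
  fields. Mollifying \<phi> brings both \<phi> and its partial derivative uniformly close while all
  supports remain in one compact subset of \<Omega>, on which \<open>u\<close> and \<open>g\<close>
  are integrable.\<close>

lemma weak_grad_C1_test:
  fixes u \<phi> :: "real ^ 'n::finite \<Rightarrow> real"
  assumes w: "is_weak_grad \<Omega> u g" and u: "locally_integrable_on u \<Omega>" and "open \<Omega>"
    and p: "Ck_on 1 \<phi> UNIV" and s: "compactly_supported_in \<phi> \<Omega>"
  shows "set_lebesgue_integral lebesgue \<Omega> (\<lambda>x. u x * partial i \<phi> x) =
        - set_lebesgue_integral lebesgue \<Omega> (\<lambda>x. g x $ i * \<phi> x)"
proof -
  note sD = compactly_supported_inD[OF s]
  obtain d0 C where d0: "0 < d0" and C: "compact C" "C \<subseteq> \<Omega>"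
    and dC: "\<And>x y. x \<in> closure {x. \<phi> x \<noteq> 0} \<Longrightarrow> norm y \<le> d0 \<Longrightarrow> x + y \<in> C"
    using compact_nbhd[OF sD(3) \<open>open \<Omega>\<close> sD(4)] by blast
  let ?D = "partial i \<phi>"
  have cp: "continuous_on UNIV \<phi>" "continuous_on UNIV ?D"
    using Ck_on_imp_continuous[OF p] Ck_on_partial[of 0 \<phi> i] p by auto
  have bp: "bounded {x. ?D x \<noteq> 0}"
    by (rule bounded_subset[OF compact_imp_bounded[OF sD(3)] partial_support])
  have uC: "set_integrable lebesgue C u" and gC: "set_integrable lebesgue C (\<lambda>x. g x $ i)"
    using u locally_integrable_component[OF conjunct1[OF w[unfolded is_weak_grad_def]], of i] C
    unfolding locally_integrable_on_def by simp_all
  \<comment> \<open>The masses of \<open>u\<close> and of the component of \<open>g\<close> on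
    \<open>C\<close>: together they bound how far the identity is disturbed when \<phi> and its
    derivative move by at most \<open>e\<close>.\<close>
  define A where "A = set_lebesgue_integral lebesgue C (\<lambda>x. \<bar>u x\<bar>) + set_lebesgue_integral lebesgue C (\<lambda>x. \<bar>g x $ i\<bar>)"
  have A: "0 \<le> A" unfolding A_def set_lebesgue_integral_def by (intro add_nonneg_nonneg integral_nonneg_AE) auto
  let ?L = "set_lebesgue_integral lebesgue \<Omega> (\<lambda>x. u x * ?D x) + set_lebesgue_integral lebesgue \<Omega> (\<lambda>x. g x $ i * \<phi> x)"
  have key: "\<bar>?L\<bar> \<le> e * A" if e: "0 < e" for e
  proof -
    obtain d1 where d1: "0 < d1" "\<And>x y. norm (x - y) < d1 \<Longrightarrow> norm (\<phi> x - \<phi> y) < e"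
      using uniformly_continuous_bounded_support[OF cp(1) sD(1) e] by blast
    obtain d2 where d2: "0 < d2" "\<And>x y. norm (x - y) < d2 \<Longrightarrow> norm (?D x - ?D y) < e"
      using uniformly_continuous_bounded_support[OF cp(2) bp e] by blast
    define d where "d = min d0 (min d1 d2)"
    have d: "0 < d" "d \<le> d0" "d \<le> d1" "d \<le> d2" using d0 d1(1) d2(1) by (auto simp: d_def)
    obtain k where m: "mollifier k (0::real^'n) d" using mollifier_exists[OF d(1)] by blast
    let ?\<psi> = "conv k \<phi>"
    have "?\<psi> = conv \<phi> k"
      using borel_measurable_continuous_onI[OF cp(1)] by (intro conv_commute mollifierD(8)[OF m]) auto
    then have sm: "smooth_on ?\<psi> UNIV"
      unfolding smooth_on_def
      using Ck_on_conv[OF integrable_bounded_support[OF cp(1) sD(1)] mollifierD(1)[OF m] mollifierD(5)[OF m]] by simp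
    have pk: "partial i ?\<psi> = conv k ?D"
      unfolding partial_def by (rule ext, rule frechet_derivative_conv[OF mollifierD(6)[OF m] p sD(1)])
    have out: "conv k h x = 0" if "{x. h x \<noteq> 0} \<subseteq> closure {x. \<phi> x \<noteq> 0}" "x \<notin> C" for h :: "real^'n \<Rightarrow> real" and x
    proof -
      have "k y *\<^sub>R h (x - y) = 0" for y
      proof (cases "k y = 0")
        case False
        then have "norm y \<le> d0" using mollifierD(3)[OF m, of y] d by auto
        then have "x - y \<notin> closure {x. \<phi> x \<noteq> 0}" using dC[of "x - y" y] that(2) by auto
        then show ?thesis using that(1) by auto
      qed simp
      then show ?thesis unfolding conv_def by (simp only: integral_zero)
    qed
    have supC: "closure {x. \<phi> x \<noteq> 0} \<subseteq> C" using dC[of _ 0] d0 by auto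
    have sp: "{x. \<phi> x \<noteq> 0} \<subseteq> closure {x. \<phi> x \<noteq> 0}" by (rule closure_subset)
    have sps: "{x. ?\<psi> x \<noteq> 0} \<subseteq> C" "{x. conv k ?D x \<noteq> 0} \<subseteq> C" "{x. \<phi> x \<noteq> 0} \<subseteq> C" "{x. ?D x \<noteq> 0} \<subseteq> C"
    proof -
      show "{x. ?\<psi> x \<noteq> 0} \<subseteq> C" by (rule subsetI, rule ccontr) (simp add: out[OF sp])
      show "{x. conv k ?D x \<noteq> 0} \<subseteq> C" by (rule subsetI, rule ccontr) (simp add: out[OF partial_support])
      show "{x. \<phi> x \<noteq> 0} \<subseteq> C" by (rule order_trans[OF sp supC])
      show "{x. ?D x \<noteq> 0} \<subseteq> C" by (rule order_trans[OF partial_support supC])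
    qed
    have cs: "compactly_supported_in ?\<psi> \<Omega>"
      by (rule compactly_supported_inI[OF sps(1) C])
    have "\<forall>\<phi> i. smooth_on \<phi> UNIV \<and> compactly_supported_in \<phi> \<Omega> \<longrightarrow>
        set_lebesgue_integral lebesgue \<Omega> (\<lambda>x. u x * partial i \<phi> x) =
        - set_lebesgue_integral lebesgue \<Omega> (\<lambda>x. g x $ i * \<phi> x)"
      using w unfolding is_weak_grad_def by (rule conjunct2)
    from this[rule_format, OF conjI, OF sm cs, of i]
    have eq: "set_lebesgue_integral lebesgue \<Omega> (\<lambda>x. u x * conv k ?D x) =
        - set_lebesgue_integral lebesgue \<Omega> (\<lambda>x. g x $ i * ?\<psi> x)"
      unfolding pk .
    have "norm (?\<psi> x - \<phi> x) \<le> e" for x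
    proof (rule conv_mollifier_near[OF m cp(1) sD(1)])
      show "norm (\<phi> (x - y) - \<phi> x) \<le> e" if "y \<in> ball 0 d" for y
        using d1(2)[of "x - y" x] that d by auto
    qed
    then have n1: "\<bar>\<phi> x - ?\<psi> x\<bar> \<le> e" for x by (simp add: abs_minus_commute)
    have "norm (conv k ?D x - ?D x) \<le> e" for x
    proof (rule conv_mollifier_near[OF m cp(2) bp])
      show "norm (?D (x - y) - ?D x) \<le> e" if "y \<in> ball 0 d" for y
        using d2(2)[of "x - y" x] that d by auto
    qed
    then have n2: "\<bar>?D x - conv k ?D x\<bar> \<le> e" for x by (simp add: abs_minus_commute)
    have cc: "continuous_on UNIV ?\<psi>" "continuous_on UNIV (conv k ?D)"
      using conv_continuous[OF mollifierD(6)[OF m]] cp sD(1) bp by auto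
    have s1: "{x. \<phi> x - ?\<psi> x \<noteq> 0} \<subseteq> C" "{x. ?D x - conv k ?D x \<noteq> 0} \<subseteq> C"
    proof -
      have "\<phi> x = 0" "?\<psi> x = 0" "?D x = 0" "conv k ?D x = 0" if "x \<notin> C" for x using sps that by blast+
      then show "{x. \<phi> x - ?\<psi> x \<noteq> 0} \<subseteq> C" "{x. ?D x - conv k ?D x \<noteq> 0} \<subseteq> C" by force+
    qed
    note b1 = test_integral_bound(2)[OF gC continuous_on_diff[OF cp(1) cc(1)] n1 s1(1) C(2)]
    note b2 = test_integral_bound(2)[OF uC continuous_on_diff[OF cp(2) cc(2)] n2 s1(2) C(2)]
    have i: "set_integrable lebesgue \<Omega> (\<lambda>x. f x * h x)"
      if a: "set_integrable lebesgue C f" "continuous_on UNIV h" "{x. h x \<noteq> 0} \<subseteq> C" for f h :: "real ^ 'n \<Rightarrow> real"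
    proof -
      obtain B where "\<And>x. norm (h x) \<le> B"
        using bounded_range_bounded_support[OF a(2) bounded_subset[OF compact_imp_bounded[OF C(1)] a(3)]] by blast
      then have "\<bar>h x\<bar> \<le> B" for x by simp
      then show ?thesis by (rule test_integral_bound(1)[OF a(1,2) _ a(3) C(2)])
    qed
    have e1: "set_lebesgue_integral lebesgue \<Omega> (\<lambda>x. g x $ i * (\<phi> x - ?\<psi> x)) =
      set_lebesgue_integral lebesgue \<Omega> (\<lambda>x. g x $ i * \<phi> x) - set_lebesgue_integral lebesgue \<Omega> (\<lambda>x. g x $ i * ?\<psi> x)"
      unfolding right_diff_distrib by (rule set_integral_diff(2)[OF i[OF gC cp(1) sps(3)] i[OF gC cc(1) sps(1)]])
    have e2: "set_lebesgue_integral lebesgue \<Omega> (\<lambda>x. u x * (?D x - conv k ?D x)) =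
      set_lebesgue_integral lebesgue \<Omega> (\<lambda>x. u x * ?D x) - set_lebesgue_integral lebesgue \<Omega> (\<lambda>x. u x * conv k ?D x)"
      unfolding right_diff_distrib by (rule set_integral_diff(2)[OF i[OF uC cp(2) sps(4)] i[OF uC cc(2) sps(2)]])
    show ?thesis using b1 b2 unfolding e1 e2 A_def distrib_left eq by linarith
  qed
  have "\<bar>?L\<bar> \<le> 0 + e" if "0 < e" for e
  proof -
    have "\<bar>?L\<bar> \<le> e / (A + 1) * A" using key[of "e / (A + 1)"] that A by simp
    also have "\<dots> \<le> e" using that A by (simp add: field_simps)
    finally show ?thesis by simp
  qed
  then have "\<bar>?L\<bar> \<le> 0" by (rule field_le_epsilon)
  then show ?thesis by linarith
qed

text \<open>The fundamental lemma of the calculus of variations: for \<open>x\<close> in a compact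
  set, the mollification at \<open>x\<close> is itself a test integral and vanishes, while
  mollifications converge to the function in L1. Countably many compact sets exhaust
  \<Omega>.\<close>

lemma AE_eq_0_if_test_integrals_0:
  fixes f :: "real ^ 'n::finite \<Rightarrow> real"
  assumes "open \<Omega>" "locally_integrable_on f \<Omega>"
    and test: "\<And>\<phi>. smooth_on \<phi> UNIV \<Longrightarrow> compactly_supported_in \<phi> \<Omega> \<Longrightarrow>
      set_lebesgue_integral lebesgue \<Omega> (\<lambda>x. f x * \<phi> x) = 0"
  shows "AE x in lebesgue. x \<in> \<Omega> \<longrightarrow> f x = 0"
proof -
  have cpt: "AE x in lebesgue. x \<in> K \<longrightarrow> f x = 0" if K: "compact K" "K \<subseteq> \<Omega>" for K
  proof -
    obtain d0 C where d0: "0 < d0" and C: "compact C" "C \<subseteq> \<Omega>"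
      and dC: "\<And>x y. x \<in> K \<Longrightarrow> norm y \<le> d0 \<Longrightarrow> x + y \<in> C"
      using compact_nbhd[OF K(1) \<open>open \<Omega>\<close> K(2)] by blast
    have fC: "set_integrable lebesgue C f"
      using assms(2) C by (simp add: locally_integrable_on_def)
    have CB: "C \<in> sets borel" "K \<in> sets borel" using C(1) K(1) by (auto intro: borel_compact)
    obtain f' where f': "integrable lborel f'" "\<And>x. x \<notin> C \<Longrightarrow> f' x = 0" "AE x in lebesgue. x \<in> C \<longrightarrow> f' x = f x"
      using borel_representative[OF fC CB(1)] by blast
    note [measurable] = borel_measurable_integrable[OF f'(1), simplified] CB
    have conv0: "conv f' k x = 0" if m: "mollifier k 0 d" and d: "d \<le> d0" and x: "x \<in> K" for k d x
    proof -
      \<comment> \<open>For fixed \<open>x\<close> in \<open>K\<close> the reflected and shifted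
        kernel is an admissible test function, its support lying in \<open>C\<close>.\<close>
      define \<phi> where "\<phi> = (\<lambda>y. k (x - y))"
      have out: "\<phi> y = 0" if "y \<notin> C" for y
      proof (rule ccontr)
        assume "\<phi> y \<noteq> 0"
        then have "norm (y - x) \<le> d0" using mollifierD(3)[OF m, of "x - y"] d by (auto simp: \<phi>_def norm_minus_commute)
        then show False using dC[OF x, of "y - x"] that by simp
      qed
      have sm: "smooth_on \<phi> UNIV"
        unfolding smooth_on_def \<phi>_def using Ck_on_affine[OF mollifierD(1)[OF m], where c = "-1" and t = x]
        by (simp add: add.commute)
      have cs: "compactly_supported_in \<phi> \<Omega>"
        by (rule compactly_supported_inI[OF _ C]) (use out in blast)
      have m1: "f' \<in> borel_measurable lebesgue" "\<phi> \<in> borel_measurable lebesgue"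
        using borel_measurable_continuous_onI[OF Ck_on_imp_continuous[OF smooth_on_imp_Ck[OF sm, of 0]]]
        by (auto intro!: measurable_completion)
      have "integrable lebesgue (\<lambda>x. indicator C x *\<^sub>R f x)" using fC by (simp add: set_integrable_def)
      then have m2: "(\<lambda>x. indicator C x *\<^sub>R f x) \<in> borel_measurable lebesgue" by (rule borel_measurable_integrable)
      have eq: "indicator \<Omega> y *\<^sub>R (f y * \<phi> y) = (indicator C y *\<^sub>R f y) * \<phi> y" for y
        using out[of y] C(2) by (cases "y \<in> C") (auto simp: indicator_def)
      have "conv f' k x = (\<integral>y. f' y * \<phi> y \<partial>lborel)" by (simp add: conv_def \<phi>_def)
      also have "\<dots> = (\<integral>y. f' y * \<phi> y \<partial>lebesgue)"
        using mollifierD(8)[OF m] by (subst integral_completion) (auto simp: \<phi>_def)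
      also have "\<dots> = (\<integral>y. (indicator C y *\<^sub>R f y) * \<phi> y \<partial>lebesgue)"
      proof (rule integral_cong_AE)
        show "AE y in lebesgue. f' y * \<phi> y = (indicator C y *\<^sub>R f y) * \<phi> y"
          using f'(3) by eventually_elim (use f'(2) in \<open>auto simp: indicator_def\<close>)
      qed (use m1 m2 in measurable)
      also have "\<dots> = set_lebesgue_integral lebesgue \<Omega> (\<lambda>x. f x * \<phi> x)"
        by (simp only: set_lebesgue_integral_def eq)
      also have "\<dots> = 0" by (rule test[OF sm cs])
      finally show ?thesis .
    qed
    let ?I = "\<integral>x. indicator K x * \<bar>f' x\<bar> \<partial>lborel"
    have iK: "integrable lborel (\<lambda>x. indicator K x * \<bar>f' x\<bar>)"
      using integrable_mult_indicator[OF _ integrable_abs[OF f'(1)], of K] CB by simp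
    have "?I \<le> 0 + e" if e: "0 < e" for e
    proof -
      obtain d where d: "0 < d" "\<And>k p r. mollifier k p r \<and> ball p r \<subseteq> ball 0 d \<Longrightarrow> (\<integral>x. \<bar>conv f' k x - f' x\<bar> \<partial>lborel) < e"
        using conv_tendsto_L1[OF f'(1) e] by blast
      have dd: "0 < min d d0" using d0 d(1) by simp
      obtain k where m: "mollifier k (0::real^'n) (min d d0)" using mollifier_exists[OF dd] by blast
      have "?I \<le> (\<integral>x. \<bar>conv f' k x - f' x\<bar> \<partial>lborel)"
      proof (rule integral_mono[OF iK])
        show "integrable lborel (\<lambda>x. \<bar>conv f' k x - f' x\<bar>)"
          using conv_mollifier_L1_le(1)[OF f'(1) m] f'(1) by simp
        show "indicator K x * \<bar>f' x\<bar> \<le> \<bar>conv f' k x - f' x\<bar>" for x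
          using conv0[OF m, of x] by (auto simp: indicator_def)
      qed
      also have "\<dots> < e" using d(2)[of k 0 "min d d0"] m by (simp add: subset_ball)
      finally show ?thesis by simp
    qed
    then have "?I \<le> 0" by (rule field_le_epsilon)
    moreover have "0 \<le> ?I" by (intro integral_nonneg_AE) auto
    ultimately have "AE x in lborel. indicator K x * \<bar>f' x\<bar> = 0"
      using integral_nonneg_eq_0_iff_AE[OF iK] by auto
    then have "AE x in lebesgue. indicator K x * \<bar>f' x\<bar> = 0" by (rule AE_completion)
    then show ?thesis using f'(3)
    proof eventually_elim
      case (elim x)
      then show ?case using dC[of x 0] d0 by (auto simp: indicator_def)
    qed
  qed
  obtain K where K: "\<And>n::nat. compact (K n)" "\<And>n. K n \<subseteq> \<Omega>" "\<Union>(range K) = \<Omega>"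
    using open_Union_compact_subsets[OF assms(1)] by metis
  have "AE x in lebesgue. \<forall>n. x \<in> K n \<longrightarrow> f x = 0" unfolding AE_all_countable by (intro allI cpt K)
  then show ?thesis by eventually_elim (use K(3) in blast)
qed

text \<open>\<open>weak_grad\<close> is an arbitrary choice. Uniqueness allows energies to be
  computed with any gradient at hand, and the gradient to be identified on small balls.\<close>

lemma is_weak_grad_unique:
  fixes u :: "real ^ 'n::finite \<Rightarrow> real"
  assumes o: "open \<Omega>" and g: "is_weak_grad \<Omega> u g" "is_weak_grad \<Omega> u h"
  shows "AE x in lebesgue. x \<in> \<Omega> \<longrightarrow> g x = h x"
proof -
  have "AE x in lebesgue. x \<in> \<Omega> \<longrightarrow> g x $ i - h x $ i = 0" for i
  proof (rule AE_eq_0_if_test_integrals_0[OF o])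
    note lg = locally_integrable_component[OF conjunct1[OF g(1)[unfolded is_weak_grad_def]], of i]
    note lh = locally_integrable_component[OF conjunct1[OF g(2)[unfolded is_weak_grad_def]], of i]
    show "locally_integrable_on (\<lambda>x. g x $ i - h x $ i) \<Omega>"
      using lg lh unfolding locally_integrable_on_def by (auto intro: set_integral_diff)
    fix \<phi> :: "real ^ 'n \<Rightarrow> real" assume p: "smooth_on \<phi> UNIV" "compactly_supported_in \<phi> \<Omega>"
    note c = Ck_on_imp_continuous[OF smooth_on_imp_Ck[OF p(1), of 0]]
    note s = compactly_supported_inD[OF p(2)]
    obtain B where B: "\<And>x. norm (\<phi> x) \<le> B" using bounded_range_bounded_support[OF c s(1)] by blast
    let ?C = "closure {x. \<phi> x \<noteq> 0}"
    have i: "set_integrable lebesgue \<Omega> (\<lambda>x. k x * \<phi> x)" if "locally_integrable_on k \<Omega>" for k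
      using that s B by (intro test_integral_bound(1)[OF _ c _ closure_subset, of k B])
        (auto simp: locally_integrable_on_def)
    have "set_lebesgue_integral lebesgue \<Omega> (\<lambda>x. g x $ i * \<phi> x) = - set_lebesgue_integral lebesgue \<Omega> (\<lambda>x. u x * partial i \<phi> x)"
      "set_lebesgue_integral lebesgue \<Omega> (\<lambda>x. h x $ i * \<phi> x) = - set_lebesgue_integral lebesgue \<Omega> (\<lambda>x. u x * partial i \<phi> x)"
      using g p by (simp_all add: is_weak_grad_def)
    then show "set_lebesgue_integral lebesgue \<Omega> (\<lambda>x. (g x $ i - h x $ i) * \<phi> x) = 0"
      unfolding left_diff_distrib by (simp add: set_integral_diff(2)[OF i[OF lg] i[OF lh]])
  qed
  then have "AE x in lebesgue. \<forall>i. x \<in> \<Omega> \<longrightarrow> g x $ i - h x $ i = 0" by (intro AE_finite_allI[of UNIV, simplified]) auto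
  then show ?thesis by eventually_elim (simp add: vec_eq_iff)
qed

lemma set_integrable_continuous_bounded:
  fixes f :: "'a::euclidean_space \<Rightarrow> 'b::euclidean_space"
  assumes f: "continuous_on UNIV f" and \<Omega>: "bounded \<Omega>" "\<Omega> \<in> sets borel"
  shows "set_integrable lebesgue \<Omega> f" "set_integrable lborel \<Omega> f"
proof -
  have "integrable lborel (\<lambda>x. indicator (closure \<Omega>) x *\<^sub>R f x)"
    using \<Omega> f by (intro borel_integrable_compact) (auto simp: compact_eq_bounded_closed intro: continuous_on_subset)
  from integrable_mult_indicator[of \<Omega> lborel, OF _ this]
  have "integrable lborel (\<lambda>x. indicator \<Omega> x *\<^sub>R (indicator (closure \<Omega>) x *\<^sub>R f x))"
    using \<Omega>(2) by (simp only: sets_lborel)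
  moreover have "indicator \<Omega> x *\<^sub>R (indicator (closure \<Omega>) x *\<^sub>R f x) = indicator \<Omega> x *\<^sub>R f x" for x
    using closure_subset[of \<Omega>] by (auto simp: indicator_def)
  ultimately have 1: "integrable lborel (\<lambda>x. indicator \<Omega> x *\<^sub>R f x)" by (simp only:)
  then show "set_integrable lborel \<Omega> f" by (simp add: set_integrable_def)
  show "set_integrable lebesgue \<Omega> f"
    unfolding set_integrable_def using borel_measurable_integrable[OF 1] by (subst integrable_completion) (auto intro: 1)
qed

lemma integral_by_parts:
  fixes f h :: "real ^ 'n::finite \<Rightarrow> real"
  assumes f: "Ck_on 1 f UNIV" and h: "Ck_on 1 h UNIV" "bounded {x. h x \<noteq> 0}"
  shows "(\<integral>x. f x * partial i h x \<partial>lborel) = - (\<integral>x. partial i f x * h x \<partial>lborel)"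
proof -
  note fd = Ck_on_SucD[OF f[unfolded One_nat_def]] and hd = Ck_on_SucD[OF h(1)[unfolded One_nat_def]]
  have c: "continuous_on UNIV f" "continuous_on UNIV h" "continuous_on UNIV (partial i f)" "continuous_on UNIV (partial i h)"
    using Ck_on_imp_continuous[OF f] Ck_on_imp_continuous[OF h(1)] Ck_on_partial[of 0 f i] Ck_on_partial[of 0 h i] f h(1) by auto
  have b: "bounded {x. partial i h x \<noteq> 0}"
    unfolding partial_def by (rule bounded_frechet_derivative_support[OF h(2)])
  have "frechet_derivative (\<lambda>x. f x * h x) (at x) (axis i 1) = f x * partial i h x + partial i f x * h x" for x
    using frechet_derivative_at[OF has_derivative_mult[OF fd(1)[of x] hd(1)[of x]]] by (simp add: partial_def fun_eq_iff)
  moreover have "(\<integral>x. frechet_derivative (\<lambda>x. f x * h x) (at x) (axis i 1) \<partial>lborel) = 0"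
    by (rule integral_frechet_derivative_0[OF Ck_on_mult[OF f h(1)]]) (rule bounded_subset[OF h(2)], auto)
  ultimately have "(\<integral>x. f x * partial i h x + partial i f x * h x \<partial>lborel) = 0" by simp
  moreover have "integrable lborel (\<lambda>x. f x * partial i h x)"
    by (rule integrable_bounded_support) (intro continuous_intros c, rule bounded_subset[OF b], auto)
  moreover have "integrable lborel (\<lambda>x. partial i f x * h x)"
    by (rule integrable_bounded_support) (intro continuous_intros c, rule bounded_subset[OF h(2)], auto)
  ultimately show ?thesis by simp
qed

lemma C1_in_W12:
  fixes v :: "real ^ 'n::finite \<Rightarrow> real"
  assumes v: "Ck_on 1 v UNIV" and \<Omega>: "open \<Omega>" "bounded \<Omega>"
  shows "is_weak_grad \<Omega> v (grad v)" "v \<in> W12 \<Omega>"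
proof -
  have cv: "continuous_on UNIV v" "continuous_on UNIV (grad v)"
    using Ck_on_imp_continuous[OF v] Ck_on_grad[of 0 v] v by auto
  have loc: "locally_integrable_on h \<Omega>" if "continuous_on UNIV h" for h :: "real ^ 'n \<Rightarrow> 'b::euclidean_space"
    unfolding locally_integrable_on_def
    using that by (auto intro!: set_integrable_continuous_bounded(1) compact_imp_bounded borel_compact)
  show 1: "is_weak_grad \<Omega> v (grad v)"
    unfolding is_weak_grad_def
  proof (intro conjI loc cv allI impI)
    fix \<phi> :: "real ^ 'n \<Rightarrow> real" and i assume p: "smooth_on \<phi> UNIV \<and> compactly_supported_in \<phi> \<Omega>"
    have C1: "Ck_on 1 \<phi> UNIV" using p smooth_on_imp_Ck by blast
    note s = compactly_supported_inD[OF conjunct2[OF p]]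
    have c: "continuous_on UNIV \<phi>" "continuous_on UNIV (partial i \<phi>)" "continuous_on UNIV (partial i v)"
      using Ck_on_imp_continuous[OF C1] Ck_on_partial[of 0 \<phi> i] Ck_on_partial[of 0 v i] v C1 by auto
    have sD: "{x. partial i \<phi> x \<noteq> 0} \<subseteq> \<Omega>" using partial_support[of i \<phi>] s(4) by blast
    have "set_lebesgue_integral lebesgue \<Omega> (\<lambda>x. v x * partial i \<phi> x) = (\<integral>x. v x * partial i \<phi> x \<partial>lborel)"
      by (rule set_integral_lborel) (auto intro!: borel_measurable_continuous_onI continuous_intros cv c, use sD in blast)
    also have "\<dots> = - (\<integral>x. partial i v x * \<phi> x \<partial>lborel)" by (rule integral_by_parts[OF v C1 s(1)])
    also have "(\<integral>x. partial i v x * \<phi> x \<partial>lborel) = set_lebesgue_integral lebesgue \<Omega> (\<lambda>x. partial i v x * \<phi> x)"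
      by (rule set_integral_lborel[symmetric]) (auto intro!: borel_measurable_continuous_onI continuous_intros c, use s(2) in blast)
    finally show "set_lebesgue_integral lebesgue \<Omega> (\<lambda>x. v x * partial i \<phi> x) =
        - set_lebesgue_integral lebesgue \<Omega> (\<lambda>x. grad v x $ i * \<phi> x)"
      by (simp add: partial_eq_grad)
  qed
  show "v \<in> W12 \<Omega>" unfolding W12_def
    using 1 loc[OF cv(1)] \<Omega>
    by (auto intro!: set_integrable_continuous_bounded(1) continuous_intros cv exI[of _ "grad v"])
qed

section \<open>Partitions of unity\<close>

text \<open>The bumps cannot be divided by their sum \<open>S\<close> outside the balls, where it
  vanishes. The denominator is raised by a smooth function of \<open>S\<close> that is zero once
  \<open>S\<close> reaches a positive lower bound \<open>m\<close> for it on \<open>K\<close>; the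
  quotients are then smooth everywhere and still sum to 1 on \<open>K\<close>.\<close>

lemma smooth_partition_of_unity:
  fixes K :: "'a::euclidean_space set"
  assumes K: "compact K" "K \<subseteq> (\<Union>x\<in>F. ball x (r x))" and F: "finite F" "\<And>x. x \<in> F \<Longrightarrow> 0 < r x"
  shows "\<exists>\<zeta>. (\<forall>j\<in>F. smooth_on (\<zeta> j) UNIV \<and> (\<forall>x. (0::real) \<le> \<zeta> j x) \<and> (\<forall>x. \<zeta> j x \<noteq> 0 \<longrightarrow> x \<in> ball j (r j))) \<and>
    (\<forall>x. (\<Sum>j\<in>F. \<zeta> j x) \<le> 1) \<and> (\<forall>x\<in>K. (\<Sum>j\<in>F. \<zeta> j x) = 1)"
proof -
  define S where "S = (\<lambda>x. \<Sum>j\<in>F. bump j (r j) x)"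
  have S0: "0 \<le> S x" for x unfolding S_def by (intro sum_nonneg bump_nonneg)
  have Sk: "Ck_on k S UNIV" for k unfolding S_def by (intro Ck_on_sum Ck_on_bump)
  have Spos: "0 < S x" if x: "x \<in> K" for x
  proof -
    obtain j where j: "j \<in> F" "x \<in> ball j (r j)" using K(2) x by blast
    show ?thesis unfolding S_def
      using F j by (intro sum_pos2[OF _ j(1)]) (auto simp: bump_nonneg bump_pos_iff)
  qed
  obtain m where m: "0 < m" "\<And>x. x \<in> K \<Longrightarrow> m \<le> S x"
  proof (cases "K = {}")
    case False
    obtain x0 where "x0 \<in> K" "\<And>x. x \<in> K \<Longrightarrow> S x0 \<le> S x"
      using continuous_attains_inf[OF K(1) False continuous_on_subset[OF Ck_on_imp_continuous[OF Sk]]] by blast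
    then show ?thesis using Spos that by blast
  qed (use that[of 1] in auto)
  \<comment> \<open>positive everywhere, equal to \<open>S\<close> on \<open>K\<close>\<close>
  define D where "D = (\<lambda>x. S x + exp_recip 1 (m - S x))"
  have e0: "0 \<le> exp_recip 1 t" for t by (simp add: exp_recip_def)
  have Dpos: "0 < D x" for x
    using S0[of x] m(1) e0[of "m - S x"] by (cases "S x < m") (auto simp: D_def exp_recip_def add_nonneg_pos)
  have Dk: "Ck_on k D UNIV" for k
    unfolding D_def by (intro Ck_on_add Ck_on_exp_recip Ck_on_diff Ck_on_const Sk)
  define \<zeta> where "\<zeta> = (\<lambda>j x. bump j (r j) x / D x)"
  have sum: "(\<Sum>j\<in>F. \<zeta> j x) = S x / D x" for x by (simp add: \<zeta>_def S_def sum_divide_distrib)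
  have "smooth_on (\<zeta> j) UNIV" for j
    unfolding \<zeta>_def smooth_on_def using Dpos by (auto intro!: Ck_on_divide Dk less_imp_neq[symmetric])
  moreover have "0 \<le> \<zeta> j x" for j x using Dpos[of x] by (simp add: \<zeta>_def bump_nonneg)
  moreover have "x \<in> ball j (r j)" if "\<zeta> j x \<noteq> 0" "j \<in> F" for j x
    using that F(2)[OF that(2)] bump_eq_0_iff[of "r j" j x] by (auto simp: \<zeta>_def)
  moreover have "S x / D x \<le> 1" for x
    using Dpos[of x] e0[of "m - S x"] by (simp add: D_def)
  moreover have "S x / D x = 1" if "x \<in> K" for x
    using m(2)[OF that] Dpos[of x] by (simp add: D_def exp_recip_def)
  ultimately show ?thesis by (intro exI[of _ \<zeta>]) (unfold sum, blast)
qed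

lemma smooth_cutoff:
  fixes K :: "'a::euclidean_space set"
  assumes "compact K" "open U" "K \<subseteq> U"
  shows "\<exists>\<theta>. smooth_on \<theta> UNIV \<and> compactly_supported_in \<theta> U \<and> (\<forall>x. 0 \<le> \<theta> x \<and> \<theta> x \<le> 1) \<and> (\<forall>x\<in>K. \<theta> x = (1::real))"
proof -
  have "\<exists>r>0. cball x r \<subseteq> U" if "x \<in> K" for x
    using that assms open_contains_cball by blast
  then obtain r where r: "\<And>x. x \<in> K \<Longrightarrow> 0 < r x" "\<And>x. x \<in> K \<Longrightarrow> cball x (r x) \<subseteq> U" by metis
  obtain F where F: "F \<subseteq> K" "finite F" "K \<subseteq> (\<Union>x\<in>F. ball x (r x))"
    by (rule compactE_image[OF assms(1), of K "\<lambda>x. ball x (r x)"]) (use r in auto)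
  obtain \<zeta> where z: "\<And>j. j \<in> F \<Longrightarrow> smooth_on (\<zeta> j) UNIV" "\<And>j x. j \<in> F \<Longrightarrow> (0::real) \<le> \<zeta> j x"
    "\<And>j x. j \<in> F \<Longrightarrow> \<zeta> j x \<noteq> 0 \<Longrightarrow> x \<in> ball j (r j)" "\<And>x. (\<Sum>j\<in>F. \<zeta> j x) \<le> 1" "\<And>x. x \<in> K \<Longrightarrow> (\<Sum>j\<in>F. \<zeta> j x) = 1"
  proof -
    have "0 < r x" if "x \<in> F" for x using r(1) F(1) that by blast
    from smooth_partition_of_unity[OF assms(1) F(3,2) this] show ?thesis using that by blast
  qed
  let ?\<theta> = "\<lambda>x. \<Sum>j\<in>F. \<zeta> j x"
  have "smooth_on ?\<theta> UNIV" unfolding smooth_on_def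
    by (intro allI Ck_on_sum smooth_on_imp_Ck z(1))
  moreover have "compactly_supported_in ?\<theta> U"
  proof (rule compactly_supported_inI)
    show "{x. ?\<theta> x \<noteq> 0} \<subseteq> (\<Union>j\<in>F. cball j (r j))"
    proof
      fix x assume "x \<in> {x. ?\<theta> x \<noteq> 0}"
      then obtain j where "j \<in> F" "\<zeta> j x \<noteq> 0" by (metis (mono_tags, lifting) mem_Collect_eq sum.neutral)
      then show "x \<in> (\<Union>j\<in>F. cball j (r j))" using z(3)[of j x] by force
    qed
    show "(\<Union>j\<in>F. cball j (r j)) \<subseteq> U" using F(1) r(2) by (intro UN_least) blast
  qed (use F(2) in \<open>auto intro: compact_UN\<close>)
  moreover have "0 \<le> ?\<theta> x" for x using z(2) by (intro sum_nonneg)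
  ultimately show ?thesis using z(4,5) by (intro exI[of _ ?\<theta>]) auto
qed

text \<open>Pointwise convergence is all that the later uses ask for, since the cutoffs are fed to
  dominated convergence or to Fatou's lemma.\<close>

lemma smooth_cutoff_sequence:
  fixes U :: "'a::euclidean_space set"
  assumes "open U"
  shows "\<exists>\<theta>. \<forall>n::nat. smooth_on (\<theta> n) UNIV \<and> compactly_supported_in (\<theta> n) U \<and> (\<forall>x. 0 \<le> \<theta> n x \<and> \<theta> n x \<le> 1) \<and>
    (\<forall>x. (\<lambda>n. \<theta> n x) \<longlonglongrightarrow> (indicator U x :: real))"
proof -
  obtain K where K: "\<And>n::nat. compact (K n)" "\<And>n. K n \<subseteq> U" "\<And>n. K n \<subseteq> interior (K (Suc n))" "\<Union>(range K) = U"
    using open_Union_compact_subsets[OF assms] by metis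
  have mono: "K m \<subseteq> K n" if "m \<le> n" for m n
    using that K(3) interior_subset by (metis (no_types, opaque_lifting) lift_Suc_mono_le subset_trans)
  have "\<forall>n. \<exists>\<theta>. smooth_on \<theta> UNIV \<and> compactly_supported_in \<theta> U \<and> (\<forall>x. 0 \<le> \<theta> x \<and> \<theta> x \<le> 1) \<and> (\<forall>x\<in>K n. \<theta> x = (1::real))"
    by (intro allI smooth_cutoff K assms)
  from choice[OF this] obtain \<theta> where c: "\<And>n. smooth_on (\<theta> n) UNIV \<and> compactly_supported_in (\<theta> n) U \<and>
      (\<forall>x. 0 \<le> \<theta> n x \<and> \<theta> n x \<le> 1) \<and> (\<forall>x\<in>K n. \<theta> n x = (1::real))" by blast
  have "(\<lambda>n. \<theta> n x) \<longlonglongrightarrow> indicator U x" for x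
  proof (cases "x \<in> U")
    case True
    then obtain m where "x \<in> K m" using K(4) by blast
    then show ?thesis using True c mono by (intro tendsto_eventually eventually_sequentiallyI[of m]) (auto, blast)
  next
    case False
    then have "\<theta> n x = 0" for n using compactly_supported_inD(2)[of "\<theta> n" U] c[of n] by auto
    then show ?thesis using False by simp
  qed
  then show ?thesis using c by (intro exI[of _ \<theta>]) auto
qed

section \<open>Smooth approximation of functions of bounded variation\<close>

lemma C1_gradient:
  fixes g :: "real ^ 'n::finite \<Rightarrow> real"
  assumes N: "open N" and g: "Ck_on 1 g N"
  shows "\<And>y. y \<in> N \<Longrightarrow> (g has_derivative (\<lambda>v. grad g y \<bullet> v)) (at y)" "continuous_on N (grad g)"
proof -
  have g1: "g differentiable_on N" "\<And>v. continuous_on N (\<lambda>y. frechet_derivative g (at y) v)"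
    using g by auto
  show "(g has_derivative (\<lambda>v. grad g y \<bullet> v)) (at y)" if "y \<in> N" for y
  proof -
    have d: "g differentiable (at y)" using g1(1) N that by (simp add: differentiable_on_eq_differentiable_at)
    then have "(g has_derivative frechet_derivative g (at y)) (at y)" by (simp add: frechet_derivative_works)
    moreover have "frechet_derivative g (at y) = (\<lambda>v. grad g y \<bullet> v)"
      by (rule ext, rule frechet_eq_grad[OF d])
    ultimately show ?thesis by (simp only:)
  qed
  show "continuous_on N (grad g)"
    unfolding grad_def[abs_def] partial_def by (intro continuous_on_vec_lambda g1(2))
qed

text \<open>With both vectors within |G|/4 of G = grad g x, their inner product is at least (1 - 1/4
  - 1/4 - 1/16) |G|^2 > 0. This cone of directions along which \<open>g\<close> increases takes the
  place of a graph representation of the level set, both at the boundary of \<Omega> and for the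
  negligibility of the free boundary.\<close>

lemma C1_gradient_cone:
  fixes g :: "real ^ 'n::finite \<Rightarrow> real"
  assumes N: "open N" "x \<in> N" and g: "Ck_on 1 g N" "grad g x \<noteq> 0"
  shows "\<exists>\<rho>>0. ball x \<rho> \<subseteq> N \<and>
    (\<forall>y\<in>ball x \<rho>. \<forall>z. norm (z - grad g x) \<le> norm (grad g x) / 4 \<longrightarrow> 0 < grad g y \<bullet> z)"
proof -
  define G where "G = grad g x"
  have G: "0 < norm G / 4" using g(2) by (simp add: G_def)
  have cg: "isCont (grad g) x" using C1_gradient(2)[OF N(1) g(1)] N continuous_on_eq_continuous_at by blast
  from cg[unfolded continuous_at_eps_delta, rule_format, OF G]
  obtain d where d: "0 < d \<and> (\<forall>y. dist y x < d \<longrightarrow> dist (grad g y) (grad g x) < norm G / 4)" by (elim exE)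
  obtain \<rho>2 where \<rho>2: "0 < \<rho>2" "ball x \<rho>2 \<subseteq> N" using N open_contains_ball by blast
  have pos: "0 < grad g y \<bullet> z" if y: "dist y x < d" and z: "norm (z - G) \<le> norm G / 4" for y z
  proof -
    let ?a = "grad g y - G" and ?b = "z - G"
    have a: "norm ?a \<le> norm G / 4" using d y by (simp add: dist_norm G_def less_imp_le)
    have "grad g y \<bullet> z = (G + ?a) \<bullet> (G + ?b)" by simp
    also have "\<dots> = (norm G)\<^sup>2 + G \<bullet> ?b + ?a \<bullet> G + ?a \<bullet> ?b"
      unfolding power2_norm_eq_inner by (simp only: inner_add_left inner_add_right)
    finally have eq: "grad g y \<bullet> z = (norm G)\<^sup>2 + G \<bullet> ?b + ?a \<bullet> G + ?a \<bullet> ?b" .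
    have "\<bar>G \<bullet> ?b\<bar> \<le> norm G * (norm G / 4)"
      by (rule order_trans[OF Cauchy_Schwarz_ineq2 mult_left_mono[OF z]]) simp
    moreover have "\<bar>?a \<bullet> G\<bar> \<le> (norm G / 4) * norm G"
      by (rule order_trans[OF Cauchy_Schwarz_ineq2 mult_right_mono[OF a]]) simp
    moreover have "\<bar>?a \<bullet> ?b\<bar> \<le> (norm G / 4) * (norm G / 4)"
      by (rule order_trans[OF Cauchy_Schwarz_ineq2 mult_mono[OF a z]]) auto
    moreover have "0 < norm G * norm G" using G by simp
    ultimately show ?thesis unfolding eq power2_eq_square by (simp add: abs_le_iff)
  qed
  show ?thesis
    using d \<rho>2 pos by (intro exI[of _ "min d \<rho>2"]) (auto simp: G_def dist_commute)
qed

lemma strict_increasing_along_segment: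
  fixes g :: "real ^ 'n::finite \<Rightarrow> real"
  assumes s: "0 < s" and g: "\<And>t. 0 \<le> t \<Longrightarrow> t \<le> s \<Longrightarrow> (g has_derivative (\<lambda>v. grad g (y + t *\<^sub>R z) \<bullet> v)) (at (y + t *\<^sub>R z))"
    and pos: "\<And>t. 0 \<le> t \<Longrightarrow> t \<le> s \<Longrightarrow> 0 < grad g (y + t *\<^sub>R z) \<bullet> z"
  shows "g y < g (y + s *\<^sub>R z)"
proof -
  have "g (y + 0 *\<^sub>R z) < g (y + s *\<^sub>R z)"
  proof (rule DERIV_pos_imp_increasing[OF s])
    fix t assume t: "0 \<le> t" "t \<le> s"
    have "((\<lambda>t. g (y + t *\<^sub>R z)) has_derivative (\<lambda>h. grad g (y + t *\<^sub>R z) \<bullet> (h *\<^sub>R z))) (at t)"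
    proof (rule has_derivative_compose[where f = "\<lambda>t. y + t *\<^sub>R z" and g = g])
      show "((\<lambda>t. y + t *\<^sub>R z) has_derivative (\<lambda>h. h *\<^sub>R z)) (at t)"
        by (auto intro!: derivative_eq_intros)
    qed (rule g[OF t])
    then have "((\<lambda>t. g (y + t *\<^sub>R z)) has_real_derivative grad g (y + t *\<^sub>R z) \<bullet> z) (at t)"
      by (simp add: has_field_derivative_def mult.commute[of _ "grad g (y + t *\<^sub>R z) \<bullet> z"])
    then show "\<exists>d. ((\<lambda>t. g (y + t *\<^sub>R z)) has_real_derivative d) (at t) \<and> 0 < d"
      using pos[OF t] by blast
  qed
  then show ?thesis by simp
qed

text \<open>At a boundary point the gradient G points outward; along directions near -G the defining
  function decreases, so points of \<Omega> stay in {g < 0}. A full ball of directions is kept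
  because it will carry the support of a mollifier. At interior points the ball around direction 0
  serves.\<close>

lemma smooth_boundary_cone:
  fixes \<Omega> :: "(real ^ 'n::finite) set"
  assumes \<Omega>: "open \<Omega>" "smooth_boundary \<Omega>" and x: "x \<in> closure \<Omega>"
  shows "\<exists>r e \<kappa> s0. 0 < r \<and> 0 < \<kappa> \<and> 0 < s0 \<and>
    (\<forall>y\<in>\<Omega> \<inter> cball x r. \<forall>z\<in>cball e \<kappa>. \<forall>s. 0 < s \<and> s < s0 \<longrightarrow> y + s *\<^sub>R z \<in> \<Omega>)"
proof (cases "x \<in> \<Omega>")
  case True
  then obtain \<rho> where \<rho>: "0 < \<rho>" "ball x \<rho> \<subseteq> \<Omega>" using \<Omega>(1) open_contains_ball by blast
  have "y + s *\<^sub>R z \<in> \<Omega>" if "y \<in> cball x (\<rho> / 2)" "z \<in> cball 0 1" "0 < s" "s < \<rho> / 2" for y z s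
  proof -
    have "norm (s *\<^sub>R z) \<le> s" using that(2,3) by simp
    then have "dist x (y + s *\<^sub>R z) < \<rho>"
      using that(1,4) norm_triangle_ineq4[of "x - y" "s *\<^sub>R z"] by (simp add: dist_norm algebra_simps)
    then show ?thesis using \<rho>(2) by auto
  qed
  then show ?thesis using \<rho>(1) by (intro exI[of _ "\<rho> / 2"] exI[of _ "0 :: real ^ 'n"] exI[of _ 1]) auto
next
  case False
  then have "x \<in> frontier \<Omega>" using x \<Omega>(1) by (simp add: frontier_def interior_open)
  then have "\<exists>N g. open N \<and> x \<in> N \<and> smooth_on g N \<and> (\<forall>y\<in>N. grad g y \<noteq> 0) \<and> \<Omega> \<inter> N = {y \<in> N. g y < 0}"
    by (rule \<Omega>(2)[unfolded smooth_boundary_def, THEN bspec])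
  then obtain N g where Ng: "open N \<and> x \<in> N \<and> smooth_on g N \<and> (\<forall>y\<in>N. grad g y \<noteq> 0) \<and> \<Omega> \<inter> N = {y \<in> N. g y < 0}"
    by (elim exE)
  have N: "open N" "x \<in> N" "smooth_on g N" "\<And>y. y \<in> N \<Longrightarrow> grad g y \<noteq> 0" "\<Omega> \<inter> N = {y \<in> N. g y < 0}"
    using Ng by simp_all
  define G where "G = grad g x"
  have G: "0 < norm G" using N(2,4) by (simp add: G_def)
  have g1: "Ck_on 1 g N" using N(3) by (simp only: smooth_on_def)
  from C1_gradient_cone[OF N(1,2) g1 N(4)[OF N(2)]]
  obtain \<rho>1 where \<rho>1: "0 < \<rho>1 \<and> ball x \<rho>1 \<subseteq> N \<and>
    (\<forall>y\<in>ball x \<rho>1. \<forall>z. norm (z - G) \<le> norm G / 4 \<longrightarrow> 0 < grad g y \<bullet> z)"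
    unfolding G_def by (elim exE)
  define \<rho> where "\<rho> = \<rho>1 / 2"
  have \<rho>: "0 < \<rho>" using \<rho>1 by (simp add: \<rho>_def)
  \<comment> \<open>Directions in the ball have norm at most 2 |G|, so steps below \<open>s0\<close>
    move points by less than \<rho>, half the radius on which the cone condition is known.\<close>
  define s0 where "s0 = \<rho> / (2 * norm G)"
  have s0: "0 < s0" using G \<rho> by (simp add: s0_def)
  have "y + s *\<^sub>R z \<in> \<Omega>" if y: "y \<in> \<Omega>" "y \<in> cball x \<rho>" and z: "z \<in> cball (- G) (norm G / 4)" and s: "0 < s" "s < s0" for y z s
  proof -
    have "- z - G = - G - z" by simp
    then have zG: "norm (- z - G) \<le> norm G / 4" using z by (simp only: mem_cball dist_norm)
    have nz: "norm z \<le> 2 * norm G"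
    proof -
      have "norm z \<le> norm G + norm (- z - G)" using norm_triangle_ineq[of G "- z - G"] by simp
      then show ?thesis using zG G by linarith
    qed
    have near: "y + t *\<^sub>R z \<in> ball x \<rho>1" if "0 \<le> t" "t \<le> s" for t
    proof -
      have "norm (t *\<^sub>R z) \<le> s * (2 * norm G)" using that nz by (simp add: mult_mono)
      also have "\<dots> < s0 * (2 * norm G)" using s G by (intro mult_strict_right_mono) auto
      also have "\<dots> = \<rho>" using G by (simp add: s0_def)
      finally show ?thesis
        using y(2) norm_triangle_ineq[of "y - x" "t *\<^sub>R z"]
        by (simp add: dist_norm norm_minus_commute[of x] algebra_simps \<rho>_def)
    qed
    \<comment> \<open>The segment is run backwards from the shifted point to \<open>y\<close>: the
      direction -z lies in the cone around G, where \<open>g\<close> increases.\<close>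
    have "g (y + s *\<^sub>R z) < g (y + s *\<^sub>R z + s *\<^sub>R (- z))"
    proof (rule strict_increasing_along_segment[OF s(1)])
      fix t assume t: "0 \<le> t" "t \<le> s"
      have eq: "y + s *\<^sub>R z + t *\<^sub>R (- z) = y + (s - t) *\<^sub>R z" by (simp add: algebra_simps)
      have in1: "y + s *\<^sub>R z + t *\<^sub>R (- z) \<in> ball x \<rho>1" unfolding eq using t by (intro near) auto
      show "(g has_derivative (\<lambda>v. grad g (y + s *\<^sub>R z + t *\<^sub>R (- z)) \<bullet> v)) (at (y + s *\<^sub>R z + t *\<^sub>R (- z)))"
        using \<rho>1 in1 by (intro C1_gradient(1)[OF N(1) g1]) blast
      show "0 < grad g (y + s *\<^sub>R z + t *\<^sub>R (- z)) \<bullet> (- z)" using \<rho>1 in1 zG by blast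
    qed
    moreover have "y \<in> {y \<in> N. g y < 0}"
      unfolding N(5)[symmetric] using y(1) near[of 0] s(1) \<rho>1 by auto
    moreover have "y + s *\<^sub>R z \<in> N" using near[of s] s(1) \<rho>1 by auto
    ultimately have "y + s *\<^sub>R z \<in> {y \<in> N. g y < 0}" by simp
    then have "y + s *\<^sub>R z \<in> \<Omega> \<inter> N" by (simp only: N(5))
    then show ?thesis by (rule IntD1)
  qed
  then show ?thesis using \<rho> G s0
    by (intro exI[of _ \<rho>] exI[of _ "- G"] exI[of _ "norm G / 4"] exI[of _ s0]) auto
qed

section \<open>The variation by duality with test fields\<close>

lemma integral_divergence_by_parts:
  fixes w :: "real ^ 'n::finite \<Rightarrow> real"
  assumes w: "Ck_on 1 w UNIV" and p: "Ck_on 1 \<phi> UNIV" "bounded {x. \<phi> x \<noteq> 0}"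
  shows "(\<integral>x. w x * divergence \<phi> x \<partial>lborel) = - (\<integral>x. grad w x \<bullet> \<phi> x \<partial>lborel)"
    "integrable lborel (\<lambda>x. w x * divergence \<phi> x)" "integrable lborel (\<lambda>x. grad w x \<bullet> \<phi> x)"
proof -
  have pi: "Ck_on 1 (\<lambda>x. \<phi> x $ i) UNIV" for i by (rule Ck_on_bounded_linear[OF bounded_linear_vec_nth p(1)])
  have bi: "bounded {x. \<phi> x $ i \<noteq> 0}" for i by (rule bounded_subset[OF p(2)]) auto
  have c: "continuous_on UNIV w" "continuous_on UNIV (\<lambda>x. \<phi> x $ i)" "continuous_on UNIV (partial i w)"
    "continuous_on UNIV (partial i (\<lambda>x. \<phi> x $ i))" for i
    using Ck_on_imp_continuous[OF w] Ck_on_imp_continuous[OF pi] Ck_on_partial[of 0 w i] Ck_on_partial[of 0 "\<lambda>x. \<phi> x $ i" i] w pi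
    by auto
  have i1: "integrable lborel (\<lambda>x. w x * partial i (\<lambda>x. \<phi> x $ i) x)" for i
  proof (rule integrable_bounded_support)
    show "bounded {x. w x * partial i (\<lambda>x. \<phi> x $ i) x \<noteq> 0}"
      by (rule bounded_subset[OF bounded_frechet_derivative_support[OF bi[of i], where v = "axis i 1"]]) (auto simp: partial_def)
  qed (intro continuous_intros c)
  have i2: "integrable lborel (\<lambda>x. partial i w x * \<phi> x $ i)" for i
    by (rule integrable_bounded_support) (intro continuous_intros c, rule bounded_subset[OF bi[of i]], auto)
  show "integrable lborel (\<lambda>x. w x * divergence \<phi> x)"
    unfolding divergence_def sum_distrib_left by (intro Bochner_Integration.integrable_sum i1)
  show "integrable lborel (\<lambda>x. grad w x \<bullet> \<phi> x)"
    unfolding inner_vec_def inner_real_def partial_eq_grad[symmetric] by (intro Bochner_Integration.integrable_sum i2)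
  show "(\<integral>x. w x * divergence \<phi> x \<partial>lborel) = - (\<integral>x. grad w x \<bullet> \<phi> x \<partial>lborel)"
    unfolding divergence_def sum_distrib_left inner_vec_def inner_real_def partial_eq_grad[symmetric]
    using i1 i2 integral_by_parts[OF w pi bi]
    by (simp add: Bochner_Integration.integral_sum sum_negf)
qed

lemma divergence_support: "{x. divergence \<phi> x \<noteq> 0} \<subseteq> closure {x. \<phi> x \<noteq> 0}"
proof
  fix x assume "x \<in> {x. divergence \<phi> x \<noteq> 0}"
  then obtain i where "partial i (\<lambda>y. \<phi> y $ i) x \<noteq> 0"
    unfolding divergence_def by (metis (mono_tags, lifting) mem_Collect_eq sum.neutral)
  then have "x \<in> closure {x. \<phi> x $ i \<noteq> 0}" using partial_support by blast
  moreover have "closure {x. \<phi> x $ i \<noteq> 0} \<subseteq> closure {x. \<phi> x \<noteq> 0}" by (intro closure_mono) auto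
  ultimately show "x \<in> closure {x. \<phi> x \<noteq> 0}" by blast
qed

lemma conv_bounded_support:
  assumes "bounded {x. q x \<noteq> 0}" "bounded {x. p x \<noteq> 0}"
  shows "bounded {x. conv q p x \<noteq> 0}"
proof (rule bounded_subset[OF bounded_plus[OF assms]], rule subsetI)
  fix y assume "y \<in> {x. conv q p x \<noteq> 0}"
  have "\<exists>x. q x *\<^sub>R p (y - x) \<noteq> 0"
  proof (rule ccontr)
    assume "\<not> ?thesis"
    then have "q x *\<^sub>R p (y - x) = 0" for x by blast
    then have "conv q p y = 0" unfolding conv_def by (simp only: integral_zero)
    then show False using \<open>y \<in> _\<close> by simp
  qed
  then obtain x where x: "q x \<noteq> 0" "p (y - x) \<noteq> 0" by auto
  have "y = x + (y - x)" by simp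
  then show "y \<in> (\<lambda>(x, y). x + y) ` ({x. q x \<noteq> 0} \<times> {x. p x \<noteq> 0})"
    using x by (intro image_eqI[of _ _ "(x, y - x)"]) auto
qed

lemma integrable_mult_bounded_support:
  fixes v h :: "'a::euclidean_space \<Rightarrow> real"
  assumes "integrable lborel v" "continuous_on UNIV h" "bounded {x. h x \<noteq> 0}"
  shows "integrable lborel (\<lambda>x. v x * h x)"
proof -
  have "continuous_on UNIV (\<lambda>x. h (- x))"
    using Ck_on_affine[of 0 h "-1" 0] assms(2) by simp
  moreover have "bounded {x. h (- x) \<noteq> 0}"
    by (rule bounded_subset[OF bounded_uminus[THEN iffD2, OF assms(3)]]) force
  ultimately show ?thesis using conv_integrable[of v "\<lambda>x. h (- x)" 0] assms(1) by simp
qed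

definition test_field :: "(real ^ 'n::finite) set \<Rightarrow> (real ^ 'n \<Rightarrow> real ^ 'n) \<Rightarrow> bool" where
  "test_field U \<phi> \<longleftrightarrow> Ck_on 1 \<phi> UNIV \<and> compactly_supported_in \<phi> U \<and> (\<forall>x. norm (\<phi> x) \<le> 1)"

lemma variation_eq_SUP_test_field:
  "variation U f = (SUP \<phi> \<in> {\<phi>. test_field U \<phi>}. ennreal (set_lebesgue_integral lebesgue U (\<lambda>x. f x * divergence \<phi> x)))"
  by (simp add: variation_def test_field_def)

lemma variation_leI:
  assumes "\<And>\<phi>. test_field U \<phi> \<Longrightarrow> set_lebesgue_integral lebesgue U (\<lambda>x. f x * divergence \<phi> x) \<le> C"
  shows "variation U f \<le> ennreal C"
  unfolding variation_eq_SUP_test_field by (intro SUP_least ennreal_leI assms) simp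

lemma test_field_le_variation:
  assumes "test_field U \<phi>" "variation U f \<le> ennreal C" "0 \<le> C"
  shows "set_lebesgue_integral lebesgue U (\<lambda>x. f x * divergence \<phi> x) \<le> C"
proof -
  have "ennreal (set_lebesgue_integral lebesgue U (\<lambda>x. f x * divergence \<phi> x)) \<le> variation U f"
    unfolding variation_eq_SUP_test_field using assms(1) by (intro SUP_upper) simp
  then have "ennreal (set_lebesgue_integral lebesgue U (\<lambda>x. f x * divergence \<phi> x)) \<le> ennreal C"
    using assms(2) by (rule order_trans)
  then show ?thesis using assms(3) by (simp add: ennreal_le_iff)
qed

lemma test_fieldD:
  assumes "test_field U \<phi>"
  shows "Ck_on 1 \<phi> UNIV" "compactly_supported_in \<phi> U" "norm (\<phi> x) \<le> 1" "continuous_on UNIV \<phi>"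
    "continuous_on UNIV (divergence \<phi>)" "{x. divergence \<phi> x \<noteq> 0} \<subseteq> closure {x. \<phi> x \<noteq> 0}"
    "bounded {x. \<phi> x \<noteq> 0}" "bounded {x. divergence \<phi> x \<noteq> 0}" "{x. divergence \<phi> x \<noteq> 0} \<subseteq> U"
proof -
  show 1: "Ck_on 1 \<phi> UNIV" and 2: "compactly_supported_in \<phi> U" and "norm (\<phi> x) \<le> 1"
    using assms by (auto simp: test_field_def)
  show "continuous_on UNIV \<phi>" by (rule Ck_on_imp_continuous[OF 1])
  show "continuous_on UNIV (divergence \<phi>)"
    using Ck_on_divergence[of 0 \<phi>] 1 by simp
  show 3: "{x. divergence \<phi> x \<noteq> 0} \<subseteq> closure {x. \<phi> x \<noteq> 0}" by (rule divergence_support)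
  note s = compactly_supported_inD[OF 2]
  show "bounded {x. \<phi> x \<noteq> 0}" by (rule s(1))
  show "bounded {x. divergence \<phi> x \<noteq> 0}" by (rule bounded_subset[OF compact_imp_bounded[OF s(3)] 3])
  show "{x. divergence \<phi> x \<noteq> 0} \<subseteq> U" using 3 s(4) by blast
qed

lemma variation_scaled_test:
  assumes p: "Ck_on 1 \<phi> UNIV" "compactly_supported_in \<phi> U" "\<And>x. norm (\<phi> x) \<le> M" and M: "0 < M"
    and C: "variation U f \<le> ennreal C" "0 \<le> C"
  shows "set_lebesgue_integral lebesgue U (\<lambda>x. f x * divergence \<phi> x) \<le> M * C"
proof -
  let ?\<psi> = "\<lambda>x. (1 / M) *\<^sub>R \<phi> x"
  have "test_field U ?\<psi>" unfolding test_field_def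
  proof (intro conjI allI)
    show "Ck_on 1 ?\<psi> UNIV" by (rule Ck_on_bounded_linear[OF bounded_linear_scaleR_right p(1)])
    show "compactly_supported_in ?\<psi> U" using p(2) M by (simp add: compactly_supported_in_def)
    show "norm (?\<psi> x) \<le> 1" for x using p(3)[of x] M by simp
  qed
  then have "set_lebesgue_integral lebesgue U (\<lambda>x. f x * divergence ?\<psi> x) \<le> C"
    by (rule test_field_le_variation[OF _ C])
  moreover have "divergence ?\<psi> x = (1 / M) * divergence \<phi> x" for x
  proof -
    have "grad (\<lambda>x. 1 / M) x = (0 :: real ^ 'a)" for x by (rule grad_eqI) simp
    then show ?thesis using divergence_scaleR[of "\<lambda>x. 1 / M" \<phi> x] p(1) by simp
  qed
  moreover have "(\<lambda>x. f x * (1 / M * divergence \<phi> x)) = (\<lambda>x. (1 / M) * (f x * divergence \<phi> x))"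
    by (simp add: fun_eq_iff)
  ultimately have "(1 / M) * set_lebesgue_integral lebesgue U (\<lambda>x. f x * divergence \<phi> x) \<le> C"
    by (simp only: set_integral_mult_right)
  then show ?thesis using M by (simp add: field_simps)
qed

text \<open>\<open>w\<close> is tested with the field -\<theta>_n grad w / a, of norm at most 1, and
  the cutoffs \<theta>_n exhaust \<Omega>. Unlike |grad w|, the regularized length \<open>a\<close>
  is C1 and bounded below by \<eta>, so it may serve as a divisor here and in the recovery
  sequence.\<close>

lemma integral_gradient_le_variation:
  fixes w :: "real ^ 'n::finite \<Rightarrow> real"
  assumes w: "smooth_on w UNIV" and \<Omega>: "open \<Omega>" "bounded \<Omega>" and \<eta>: "0 < \<eta>"
    and V: "variation \<Omega> w \<le> ennreal V" "0 \<le> V"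
  defines "a \<equiv> \<lambda>x. sqrt ((norm (grad w x))\<^sup>2 + \<eta>\<^sup>2)"
  shows "set_lebesgue_integral lborel \<Omega> a \<le> V + \<eta> * measure lborel \<Omega>"
    "Ck_on 1 a UNIV" "\<And>x. \<eta> \<le> a x" "\<And>x. norm (grad w x) \<le> a x"
proof -
  have w1: "Ck_on 1 w UNIV" and gw: "Ck_on 1 (grad w) UNIV"
    using smooth_on_imp_Ck[OF w, of 1] Ck_on_grad[of 1 w] smooth_on_imp_Ck[OF w, of "Suc 1"] by auto
  have pos: "0 < (norm (grad w x))\<^sup>2 + \<eta>\<^sup>2" for x using \<eta> by (simp add: add_nonneg_pos)
  have q1: "Ck_on 1 (\<lambda>x. (norm (grad w x))\<^sup>2 + \<eta>\<^sup>2) UNIV"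
    unfolding power2_norm_eq_inner by (intro Ck_on_add Ck_on_inner gw Ck_on_const)
  show a1: "Ck_on 1 a UNIV" unfolding a_def
  proof (rule Ck_on_1_compose(1)[OF q1])
    show "(sqrt has_real_derivative inverse (sqrt ((norm (grad w x))\<^sup>2 + \<eta>\<^sup>2)) / 2) (at ((norm (grad w x))\<^sup>2 + \<eta>\<^sup>2))" for x
      by (rule DERIV_real_sqrt[OF pos])
    show "continuous_on UNIV (\<lambda>x. inverse (sqrt ((norm (grad w x))\<^sup>2 + \<eta>\<^sup>2)) / 2)"
      using pos by (intro continuous_intros Ck_on_imp_continuous[OF gw]) (auto simp: less_imp_neq[symmetric])
  qed
  show ge: "\<eta> \<le> a x" for x unfolding a_def using \<eta> by (intro real_le_rsqrt) auto
  show gea: "norm (grad w x) \<le> a x" for x unfolding a_def by (intro real_le_rsqrt) auto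
  have apos: "0 < a x" for x using ge[of x] \<eta> by linarith
  have asq: "grad w x \<bullet> grad w x = (a x)\<^sup>2 - \<eta>\<^sup>2" for x
    unfolding a_def using pos[of x] by (simp add: power2_norm_eq_inner less_imp_le)
  have ca: "continuous_on UNIV a" by (rule Ck_on_imp_continuous[OF a1])
  obtain \<theta> where \<theta>: "\<And>n::nat. smooth_on (\<theta> n) UNIV" "\<And>n. compactly_supported_in (\<theta> n) \<Omega>"
    "\<And>n x. 0 \<le> \<theta> n x \<and> \<theta> n x \<le> 1" "\<And>x. (\<lambda>n. \<theta> n x) \<longlonglongrightarrow> (indicator \<Omega> x :: real)"
    using smooth_cutoff_sequence[OF \<Omega>(1)] by blast
  have c\<theta>: "continuous_on UNIV (\<theta> n)" for n using Ck_on_imp_continuous[OF smooth_on_imp_Ck[OF \<theta>(1)]] by blast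
  have bd: "(\<integral>x. \<theta> n x * (a x - \<eta>) \<partial>lborel) \<le> V" for n
  proof -
    define h where "h = (\<lambda>x. - (\<theta> n x / a x))"
    let ?\<phi> = "\<lambda>x. h x *\<^sub>R grad w x"
    have h1: "Ck_on 1 h UNIV" unfolding h_def
      using apos by (intro Ck_on_uminus Ck_on_divide smooth_on_imp_Ck[OF \<theta>(1)] a1) (auto simp: less_imp_neq[symmetric])
    note s = compactly_supported_inD[OF \<theta>(2), of n]
    have h0: "{x. h x \<noteq> 0} \<subseteq> {x. \<theta> n x \<noteq> 0}" by (auto simp: h_def)
    have sup: "{x. ?\<phi> x \<noteq> 0} \<subseteq> closure {x. \<theta> n x \<noteq> 0}" using h0 closure_subset[of "{x. \<theta> n x \<noteq> 0}"] by auto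
    have tf: "test_field \<Omega> ?\<phi>" unfolding test_field_def
    proof (intro conjI allI)
      show "Ck_on 1 ?\<phi> UNIV" by (rule Ck_on_scaleR[OF h1 gw])
      show "compactly_supported_in ?\<phi> \<Omega>" by (rule compactly_supported_inI[OF sup s(3,4)])
      fix x
      have "\<theta> n x * norm (grad w x) \<le> 1 * a x" using \<theta>(3)[of n x] gea[of x] by (intro mult_mono) auto
      then show "norm (?\<phi> x) \<le> 1" using apos[of x] \<theta>(3)[of n x] by (simp add: h_def)
    qed
    note tD = test_fieldD[OF tf]
    note ibp = integral_divergence_by_parts[OF w1 tD(1,7)]
    have "set_lebesgue_integral lebesgue \<Omega> (\<lambda>x. w x * divergence ?\<phi> x) = (\<integral>x. w x * divergence ?\<phi> x \<partial>lborel)"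
      by (rule set_integral_lborel)
        (use borel_measurable_integrable[OF ibp(2)] tD(9) in auto)
    then have "- (\<integral>x. grad w x \<bullet> ?\<phi> x \<partial>lborel) \<le> V"
      using test_field_le_variation[OF tf V] ibp(1) by simp
    moreover have "(\<integral>x. \<theta> n x * (a x - \<eta>) \<partial>lborel) \<le> (\<integral>x. - (grad w x \<bullet> ?\<phi> x) \<partial>lborel)"
    proof (rule integral_mono)
      show "integrable lborel (\<lambda>x. \<theta> n x * (a x - \<eta>))"
        by (rule integrable_bounded_support) (intro continuous_intros c\<theta> ca, rule bounded_subset[OF s(1)], auto)
      show "integrable lborel (\<lambda>x. - (grad w x \<bullet> ?\<phi> x))" using ibp(3) by simp
      fix x
      \<comment> \<open>The right-hand side is a - \<eta>^2 / a, and \<eta> / a is at most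
        1.\<close>
      have "a x - \<eta> \<le> ((a x)\<^sup>2 - \<eta>\<^sup>2) / a x"
        using apos[of x] ge[of x] \<eta> by (simp add: field_simps power2_eq_square)
      from mult_left_mono[OF this, of "\<theta> n x"]
      show "\<theta> n x * (a x - \<eta>) \<le> - (grad w x \<bullet> ?\<phi> x)"
        using \<theta>(3)[of n x] by (simp add: h_def asq)
    qed
    ultimately show ?thesis by simp
  qed
  have \<Omega>b: "\<Omega> \<in> sets borel" using \<Omega>(1) by simp
  have ia: "integrable lborel (\<lambda>x. indicator \<Omega> x *\<^sub>R (a x - \<eta>))"
    using set_integrable_continuous_bounded(2)[OF continuous_on_diff[OF ca continuous_on_const] \<Omega>(2) \<Omega>b]
    by (simp add: set_integrable_def)
  have "(\<lambda>n. \<integral>x. \<theta> n x * (a x - \<eta>) \<partial>lborel) \<longlonglongrightarrow> (\<integral>x. indicator \<Omega> x * (a x - \<eta>) \<partial>lborel)"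
  proof (rule integral_dominated_convergence[OF _ _ ia])
    show "AE x in lborel. (\<lambda>n. \<theta> n x * (a x - \<eta>)) \<longlonglongrightarrow> indicator \<Omega> x * (a x - \<eta>)"
      by (intro AE_I2 tendsto_intros \<theta>(4))
    show "AE x in lborel. norm (\<theta> n x * (a x - \<eta>)) \<le> indicator \<Omega> x *\<^sub>R (a x - \<eta>)" for n
    proof (intro AE_I2)
      fix x
      show "norm (\<theta> n x * (a x - \<eta>)) \<le> indicator \<Omega> x *\<^sub>R (a x - \<eta>)"
      proof (cases "x \<in> \<Omega>")
        case True
        have "\<theta> n x * (a x - \<eta>) \<le> 1 * (a x - \<eta>)" using \<theta>(3)[of n x] ge[of x] by (intro mult_right_mono) auto
        then show ?thesis using True \<theta>(3)[of n x] ge[of x] by (simp add: abs_mult)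
      next
        case False
        then have "\<theta> n x = 0" using compactly_supported_inD(2)[OF \<theta>(2), of n] by auto
        then show ?thesis by (simp add: False)
      qed
    qed
    show "(\<lambda>x. indicator \<Omega> x * (a x - \<eta>)) \<in> borel_measurable lborel" using borel_measurable_integrable[OF ia] by simp
    show "(\<lambda>x. \<theta> n x * (a x - \<eta>)) \<in> borel_measurable lborel" for n
      using borel_measurable_continuous_onI[OF c\<theta>] borel_measurable_continuous_onI[OF ca] by auto
  qed
  then have le: "(\<integral>x. indicator \<Omega> x * (a x - \<eta>) \<partial>lborel) \<le> V"
    by (rule LIMSEQ_le_const2) (use bd in auto)
  have i1: "integrable lborel (\<lambda>x. indicator \<Omega> x * a x)"
    using set_integrable_continuous_bounded(2)[OF ca \<Omega>(2) \<Omega>b] by (simp add: set_integrable_def)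
  have i2: "integrable lborel (\<lambda>x. indicator \<Omega> x * \<eta>)"
    using emeasure_bounded_finite[OF \<Omega>(2)] \<Omega>b by (intro integrable_mult_left integrable_real_indicator) auto
  have "(\<integral>x. indicator \<Omega> x * (a x - \<eta>) \<partial>lborel) = (\<integral>x. indicator \<Omega> x * a x \<partial>lborel) - \<eta> * measure lborel \<Omega>"
    unfolding right_diff_distrib using i1 i2 by (subst Bochner_Integration.integral_diff) (simp_all add: mult.commute)
  then show "set_lebesgue_integral lborel \<Omega> a \<le> V + \<eta> * measure lborel \<Omega>"
    using le by (simp add: set_lebesgue_integral_def)
qed

text \<open>No extension of \<open>v\<close> beyond \<open>\<Omega>\<close> is needed: near each boundary point \<open>v\<close> is mollified by a kernel
  supported off centre, in the inward cone of \<open>smooth_boundary_cone\<close>. The variation is estimated by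
  duality, moving the mollification onto the test field; the errors \<open>v\<^sub>j \<nabla>\<zeta>\<^sub>j\<close> of the localization cancel
  in the limit because \<open>\<Sum>\<^sub>j \<nabla>\<zeta>\<^sub>j = 0\<close> on \<open>\<Omega>\<close>.\<close>

lemma BV_smooth_approx:
  fixes v :: "real ^ 'n::finite \<Rightarrow> real"
  assumes \<Omega>: "open \<Omega>" "bounded \<Omega>" "smooth_boundary \<Omega>"
    and v: "integrable lborel v" "\<And>x. x \<notin> \<Omega> \<Longrightarrow> v x = 0"
    and V: "variation \<Omega> v \<le> ennreal V" "0 \<le> V" and \<eta>: "0 < \<eta>"
  shows "\<exists>w. smooth_on w UNIV \<and> (\<integral>x. indicator \<Omega> x * \<bar>w x - v x\<bar> \<partial>lborel) < \<eta> \<and>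
    variation \<Omega> w \<le> ennreal ((1 + \<eta>) * V + \<eta>)"
proof -
  have cpt: "compact (closure \<Omega>)" using \<Omega>(2) by (simp add: compact_closure)
  \<comment> \<open>Radius, direction, opening and step bound of the cone are packed into one tuple,
    so that a single choice function suffices.\<close>
  have "\<forall>x\<in>closure \<Omega>. \<exists>p. 0 < fst p \<and> 0 < fst (snd (snd p)) \<and> 0 < snd (snd (snd p)) \<and>
    (\<forall>y\<in>\<Omega> \<inter> cball x (fst p). \<forall>z\<in>cball (fst (snd p)) (fst (snd (snd p))). \<forall>s. 0 < s \<and> s < snd (snd (snd p)) \<longrightarrow> y + s *\<^sub>R z \<in> \<Omega>)"
  proof
    fix x assume "x \<in> closure \<Omega>"
    from smooth_boundary_cone[OF \<Omega>(1,3) this] obtain r e \<kappa> s0 where "0 < r \<and> 0 < \<kappa> \<and> 0 < s0 \<and>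
      (\<forall>y\<in>\<Omega> \<inter> cball x r. \<forall>z\<in>cball e \<kappa>. \<forall>s. 0 < s \<and> s < s0 \<longrightarrow> y + s *\<^sub>R z \<in> \<Omega>)" by (elim exE)
    then show "\<exists>p. 0 < fst p \<and> 0 < fst (snd (snd p)) \<and> 0 < snd (snd (snd p)) \<and>
      (\<forall>y\<in>\<Omega> \<inter> cball x (fst p). \<forall>z\<in>cball (fst (snd p)) (fst (snd (snd p))). \<forall>s. 0 < s \<and> s < snd (snd (snd p)) \<longrightarrow> y + s *\<^sub>R z \<in> \<Omega>)"
      by (intro exI[of _ "(r, e, \<kappa>, s0)"]) simp
  qed
  from bchoice[OF this] obtain p where p: "\<forall>x\<in>closure \<Omega>. 0 < fst (p x) \<and> 0 < fst (snd (snd (p x))) \<and> 0 < snd (snd (snd (p x))) \<and>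
    (\<forall>y\<in>\<Omega> \<inter> cball x (fst (p x)). \<forall>z\<in>cball (fst (snd (p x))) (fst (snd (snd (p x)))). \<forall>s. 0 < s \<and> s < snd (snd (snd (p x))) \<longrightarrow> y + s *\<^sub>R z \<in> \<Omega>)"
    by (elim exE)
  define r e \<kappa> s0 where "r = (\<lambda>x. fst (p x))" and "e = (\<lambda>x. fst (snd (p x)))"
    and "\<kappa> = (\<lambda>x. fst (snd (snd (p x))))" and "s0 = (\<lambda>x. snd (snd (snd (p x))))"
  have pos: "0 < r x" "0 < \<kappa> x" "0 < s0 x" if "x \<in> closure \<Omega>" for x
    using bspec[OF p that] by (simp_all add: r_def \<kappa>_def s0_def)
  have cone: "y + s *\<^sub>R z \<in> \<Omega>" if "x \<in> closure \<Omega>" "y \<in> \<Omega>" "y \<in> cball x (r x)" "z \<in> cball (e x) (\<kappa> x)" "0 < s" "s < s0 x" for x y z s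
    using bspec[OF p that(1)] that(2-) unfolding r_def \<kappa>_def s0_def e_def by blast
  obtain F where F: "F \<subseteq> closure \<Omega>" "finite F" "closure \<Omega> \<subseteq> (\<Union>x\<in>F. ball x (r x))"
    by (rule compactE_image[OF cpt, of "closure \<Omega>" "\<lambda>x. ball x (r x)"]) (use pos in auto)
  have rF: "0 < r x" if "x \<in> F" for x using pos(1) F(1) that by blast
  have "\<exists>\<zeta>. (\<forall>j\<in>F. smooth_on (\<zeta> j) UNIV \<and> (\<forall>x. (0::real) \<le> \<zeta> j x) \<and> (\<forall>x. \<zeta> j x \<noteq> 0 \<longrightarrow> x \<in> ball j (r j))) \<and>
    (\<forall>x. (\<Sum>j\<in>F. \<zeta> j x) \<le> 1) \<and> (\<forall>x\<in>closure \<Omega>. (\<Sum>j\<in>F. \<zeta> j x) = 1)"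
    by (rule smooth_partition_of_unity[OF cpt F(3,2)]) (rule rF)
  then obtain \<zeta> where
    z: "(\<forall>j\<in>F. smooth_on (\<zeta> j) UNIV \<and> (\<forall>x. (0::real) \<le> \<zeta> j x) \<and> (\<forall>x. \<zeta> j x \<noteq> 0 \<longrightarrow> x \<in> ball j (r j))) \<and>
    (\<forall>x. (\<Sum>j\<in>F. \<zeta> j x) \<le> 1) \<and> (\<forall>x\<in>closure \<Omega>. (\<Sum>j\<in>F. \<zeta> j x) = 1)" by (elim exE)
  have z1: "Ck_on k (\<zeta> j) UNIV" and z2: "0 \<le> \<zeta> j x" and z3: "\<zeta> j x \<noteq> 0 \<Longrightarrow> x \<in> ball j (r j)" if "j \<in> F" for j x k
    using bspec[OF conjunct1[OF z] that] by (auto simp: smooth_on_def)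
  have z4: "(\<Sum>j\<in>F. \<zeta> j x) \<le> 1" and z5: "x \<in> \<Omega> \<Longrightarrow> (\<Sum>j\<in>F. \<zeta> j x) = 1" for x
    using conjunct2[OF z] closure_subset[of \<Omega>] by auto
  have zb: "bounded {x. \<zeta> j x \<noteq> 0}" if "j \<in> F" for j
    by (rule bounded_subset[OF bounded_ball[of j "r j"]]) (use z3[OF that] in blast)
  have zle: "\<zeta> j x \<le> 1" if "j \<in> F" for j x
    using member_le_sum[of j F "\<lambda>j. \<zeta> j x"] that z2 F(2) z4[of x] by force
  have zg: "continuous_on UNIV (grad (\<zeta> j))" "bounded {x. grad (\<zeta> j) x \<noteq> 0}" if "j \<in> F" for j
  proof -
    show "continuous_on UNIV (grad (\<zeta> j))" by (rule Ck_on_imp_continuous[of 0, OF Ck_on_grad[OF z1[OF that]]])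
    have "{x. grad (\<zeta> j) x \<noteq> 0} \<subseteq> closure {x. \<zeta> j x \<noteq> 0}"
    proof
      fix x assume "x \<in> {x. grad (\<zeta> j) x \<noteq> 0}"
      then obtain i where "partial i (\<zeta> j) x \<noteq> 0" by (auto simp: vec_eq_iff partial_eq_grad)
      then show "x \<in> closure {x. \<zeta> j x \<noteq> 0}" using partial_support by blast
    qed
    then show "bounded {x. grad (\<zeta> j) x \<noteq> 0}" by (rule bounded_subset[OF bounded_closure[OF zb[OF that]]])
  qed
  have "\<forall>j\<in>F. \<exists>B>0. \<forall>x. norm (grad (\<zeta> j) x) \<le> B"
  proof
    fix j assume j: "j \<in> F"
    obtain B where "0 < B" "\<And>x. norm (grad (\<zeta> j) x) \<le> B" using bounded_range_bounded_support[OF zg[OF j]] by blast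
    then show "\<exists>B>0. \<forall>x. norm (grad (\<zeta> j) x) \<le> B" by blast
  qed
  from bchoice[OF this] obtain B0 where B0: "\<forall>j\<in>F. 0 < B0 j \<and> (\<forall>x. norm (grad (\<zeta> j) x) \<le> B0 j)" by (elim exE)
  define B where "B = (\<Sum>j\<in>F. B0 j)"
  have B: "0 \<le> B" "\<And>j x. j \<in> F \<Longrightarrow> norm (grad (\<zeta> j) x) \<le> B"
  proof -
    show "0 \<le> B" using B0 unfolding B_def by (intro sum_nonneg) (simp add: less_imp_le)
    fix j x assume j: "j \<in> F"
    have "B0 j \<le> B" unfolding B_def using B0 j F(2) by (intro member_le_sum) (auto simp: less_imp_le)
    then show "norm (grad (\<zeta> j) x) \<le> B" using B0 j by (meson order_trans)
  qed
  define N where "N = real (card F) + 1"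
  have N: "0 < N" "real (card F) < N" by (auto simp: N_def)
  \<comment> \<open>One L1 tolerance for two budgets: summed over \<open>F\<close> it stays below
    \<eta>, and the sum of its products with the gradient bound \<open>B\<close> of the cutoffs is
    at most \<eta>. \<open>N\<close> exceeds \<open>card F\<close>, and B + 1 is positive.\<close>
  define \<eta>1 where "\<eta>1 = \<eta> / (N * (B + 1))"
  have \<eta>1: "0 < \<eta>1" using \<eta> N B by (simp add: \<eta>1_def)
  have \<eta>N: "0 < \<eta> / N" using \<eta> N by simp
  obtain \<delta> where \<delta>: "0 < \<delta>" "\<And>k p r. mollifier k p r \<and> ball p r \<subseteq> ball 0 \<delta> \<Longrightarrow> (\<integral>x. \<bar>conv v k x - v x\<bar> \<partial>lborel) < \<eta>1"
    using conv_tendsto_L1[OF v(1) \<eta>1] by blast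
  have "\<forall>j\<in>F. \<exists>d>0. \<forall>x y. norm (x - y) < d \<longrightarrow> norm (\<zeta> j x - \<zeta> j y) < \<eta> / N"
    by (intro ballI uniformly_continuous_bounded_support[OF _ _ \<eta>N] Ck_on_imp_continuous[of 0] z1 zb)
  from bchoice[OF this] obtain d where d: "\<forall>j\<in>F. 0 < d j \<and> (\<forall>x y. norm (x - y) < d j \<longrightarrow> norm (\<zeta> j x - \<zeta> j y) < \<eta> / N)"
    by (elim exE)
  have "\<forall>\<^sub>F s in at_right 0. \<forall>j\<in>F. s < s0 j \<and> s * (norm (e j) + \<kappa> j) < d j \<and> s * (norm (e j) + \<kappa> j) < \<delta>"
  proof (rule eventually_ball_finite[OF F(2)], intro ballI eventually_conj)
    fix j assume j: "j \<in> F"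
    then have jc: "j \<in> closure \<Omega>" using F(1) by blast
    have lim: "((\<lambda>s. s * (norm (e j) + \<kappa> j)) \<longlongrightarrow> 0 * (norm (e j) + \<kappa> j)) (at_right 0)" by (intro tendsto_intros)
    show "\<forall>\<^sub>F s in at_right 0. s < s0 j" using order_tendstoD(2)[OF tendsto_ident_at pos(3)[OF jc]] .
    show "\<forall>\<^sub>F s in at_right 0. s * (norm (e j) + \<kappa> j) < d j" using order_tendstoD(2)[OF lim] d j by simp
    show "\<forall>\<^sub>F s in at_right 0. s * (norm (e j) + \<kappa> j) < \<delta>" using order_tendstoD(2)[OF lim] \<delta>(1) by simp
  qed
  moreover have "\<forall>\<^sub>F s in at_right 0. (0::real) < s" by (simp add: eventually_at_right_less)
  ultimately have "\<forall>\<^sub>F s in at_right 0. 0 < s \<and> (\<forall>j\<in>F. s < s0 j \<and> s * (norm (e j) + \<kappa> j) < d j \<and> s * (norm (e j) + \<kappa> j) < \<delta>)"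
    by eventually_elim simp
  then have "\<exists>s. 0 < s \<and> (\<forall>j\<in>F. s < s0 j \<and> s * (norm (e j) + \<kappa> j) < d j \<and> s * (norm (e j) + \<kappa> j) < \<delta>)"
    by (rule eventually_happens'[rotated]) simp
  \<comment> \<open>The scale meets three demands: it respects the cone, and shifts shorter than s
    (|e_j| + \<kappa>_j) change \<zeta>_j by less than \<eta>/N and keep the mollifications of
    \<open>v\<close> within \<eta>1 in L1.\<close>
  then obtain s where s: "0 < s" "\<And>j. j \<in> F \<Longrightarrow> s < s0 j" "\<And>j. j \<in> F \<Longrightarrow> s * (norm (e j) + \<kappa> j) < d j"
    "\<And>j. j \<in> F \<Longrightarrow> s * (norm (e j) + \<kappa> j) < \<delta>"
    by blast
  \<comment> \<open>Centred at -s e_j, so that \<open>conv v (k j)\<close> at \<open>x\<close>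
    averages \<open>v\<close> over points x + s z with z in the cone. The reflected kernel is
    centred at s e_j and pushes test fields inward.\<close>
  have "\<forall>j\<in>F. \<exists>k. mollifier k (- (s *\<^sub>R e j)) (s * \<kappa> j)"
  proof
    fix j assume "j \<in> F"
    then have "0 < s * \<kappa> j" using s(1) pos(2) F(1) by auto
    then show "\<exists>k. mollifier k (- (s *\<^sub>R e j)) (s * \<kappa> j)" by (rule mollifier_exists)
  qed
  from bchoice[OF this] obtain k where k: "\<forall>j\<in>F. mollifier (k j) (- (s *\<^sub>R e j)) (s * \<kappa> j)" by (elim exE)
  have km: "mollifier (k j) (- (s *\<^sub>R e j)) (s * \<kappa> j)" if "j \<in> F" for j using k that by blast
  have small: "norm y < s * (norm (e j) + \<kappa> j)" if "y \<in> ball (c *\<^sub>R (s *\<^sub>R e j)) (s * \<kappa> j)" "\<bar>c\<bar> = 1" for y j c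
  proof -
    have "norm y \<le> norm (c *\<^sub>R (s *\<^sub>R e j)) + norm (c *\<^sub>R (s *\<^sub>R e j) - y)"
      using norm_triangle_ineq4[of "c *\<^sub>R (s *\<^sub>R e j)" "c *\<^sub>R (s *\<^sub>R e j) - y"] by simp
    moreover have "norm (c *\<^sub>R (s *\<^sub>R e j)) = s * norm (e j)"
      unfolding norm_scaleR that(2) using s(1) by simp
    moreover have "norm (c *\<^sub>R (s *\<^sub>R e j) - y) < s * \<kappa> j" using that(1) by (simp add: dist_norm)
    ultimately show ?thesis unfolding distrib_left by linarith
  qed
  have L1: "(\<integral>x. \<bar>conv v (k j) x - v x\<bar> \<partial>lborel) < \<eta>1" if j: "j \<in> F" for j
  proof (rule \<delta>(2), intro conjI)
    show "mollifier (k j) (- (s *\<^sub>R e j)) (s * \<kappa> j)" by (rule km[OF j])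
    show "ball (- (s *\<^sub>R e j)) (s * \<kappa> j) \<subseteq> ball 0 \<delta>"
      using small[of _ "-1" j] s(4)[OF j] by fastforce
  qed
  define vj where "vj = (\<lambda>j. conv v (k j))"
  have vjk: "Ck_on l (vj j) UNIV" if "j \<in> F" for j l
    unfolding vj_def by (rule Ck_on_conv[OF v(1) mollifierD(1,5)[OF km[OF that]]])
  have vji: "integrable lborel (vj j)" if "j \<in> F" for j
    unfolding vj_def by (rule conv_mollifier_L1_le(1)[OF v(1) km[OF that]])
  define w where "w = (\<lambda>x. \<Sum>j\<in>F. \<zeta> j x * vj j x)"
  have "smooth_on w UNIV" unfolding smooth_on_def w_def by (intro allI Ck_on_sum Ck_on_mult z1 vjk)
  note [measurable] = borel_measurable_integrable[OF v(1), simplified]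
  have [measurable]: "\<Omega> \<in> sets borel" using \<Omega>(1) by simp
  have wc: "continuous_on UNIV w" by (rule Ck_on_imp_continuous[of 0, OF smooth_on_imp_Ck[OF \<open>smooth_on w UNIV\<close>]])
  have wv: "(\<integral>x. indicator \<Omega> x * \<bar>w x - v x\<bar> \<partial>lborel) < \<eta>"
  proof -
    have "(\<integral>x. indicator \<Omega> x * \<bar>w x - v x\<bar> \<partial>lborel) \<le> (\<integral>x. (\<Sum>j\<in>F. \<bar>vj j x - v x\<bar>) \<partial>lborel)"
    proof (rule Bochner_Integration.integral_mono')
      show "integrable lborel (\<lambda>x. \<Sum>j\<in>F. \<bar>vj j x - v x\<bar>)" using vji v(1) by auto
      show "indicator \<Omega> x * \<bar>w x - v x\<bar> \<le> (\<Sum>j\<in>F. \<bar>vj j x - v x\<bar>)" for x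
      proof (cases "x \<in> \<Omega>")
        case True
        have "w x - v x = (\<Sum>j\<in>F. \<zeta> j x * vj j x) - (\<Sum>j\<in>F. \<zeta> j x) * v x" using z5[OF True] by (simp add: w_def)
        also have "\<dots> = (\<Sum>j\<in>F. \<zeta> j x * (vj j x - v x))" by (simp add: sum_distrib_right sum_subtractf right_diff_distrib)
        also have "\<bar>\<dots>\<bar> \<le> (\<Sum>j\<in>F. \<bar>\<zeta> j x * (vj j x - v x)\<bar>)" by (rule sum_abs)
        also have "\<dots> \<le> (\<Sum>j\<in>F. 1 * \<bar>vj j x - v x\<bar>)"
          unfolding abs_mult using zle z2 by (intro sum_mono mult_right_mono) auto
        finally show ?thesis using True by simp
      qed (simp add: sum_nonneg)
    qed (simp add: sum_nonneg)
    also have "\<dots> = (\<Sum>j\<in>F. \<integral>x. \<bar>vj j x - v x\<bar> \<partial>lborel)" using vji v(1) by (intro Bochner_Integration.integral_sum) auto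
    also have "\<dots> \<le> (\<Sum>j\<in>F. \<eta>1)" by (intro sum_mono less_imp_le) (simp add: vj_def L1)
    also have "\<dots> \<le> real (card F) * (\<eta> / N)"
    proof -
      have "\<eta> / (N * (B + 1)) \<le> \<eta> / (N * 1)" using \<eta> N B by (intro divide_left_mono mult_left_mono) auto
      from mult_left_mono[OF this, of "real (card F)"] show ?thesis by (simp add: \<eta>1_def)
    qed
    also have "\<dots> < \<eta>" using \<eta> N by (simp add: field_simps)
    finally show ?thesis .
  qed
  have "variation \<Omega> w \<le> ennreal ((1 + \<eta>) * V + \<eta>)"
  proof (rule variation_leI)
    fix \<phi> assume "test_field \<Omega> \<phi>"
    note t = test_fieldD[OF this]
    note s\<phi> = compactly_supported_inD[OF t(2)]
    define P where "P = (\<lambda>j x. \<zeta> j x *\<^sub>R \<phi> x)"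
    have P1: "Ck_on 1 (P j) UNIV" if "j \<in> F" for j unfolding P_def by (rule Ck_on_scaleR[OF z1[OF that] t(1)])
    have Pb: "bounded {x. P j x \<noteq> 0}" for j by (rule bounded_subset[OF t(7)]) (auto simp: P_def)
    define k' where "k' = (\<lambda>j x. k j (- x))"
    have k'm: "mollifier (k' j) (s *\<^sub>R e j) (s * \<kappa> j)" if "j \<in> F" for j
      using mollifier_reflect[OF km[OF that]] by (simp add: k'_def)
    define \<Psi>j where "\<Psi>j = (\<lambda>j. conv (k' j) (P j))"
    define \<Psi> where "\<Psi> = (\<lambda>x. \<Sum>j\<in>F. \<Psi>j j x)"
    have \<Psi>j1: "Ck_on 1 (\<Psi>j j) UNIV" if "j \<in> F" for j
      unfolding \<Psi>j_def by (rule Ck_on_conv[OF mollifierD(6)[OF k'm[OF that]] P1[OF that] Pb])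
    have \<Psi>1: "Ck_on 1 \<Psi> UNIV" unfolding \<Psi>_def by (intro Ck_on_sum \<Psi>j1)
    \<comment> \<open>Each summand is compared with \<zeta>_j(y), not with 1: the partition of unity
      then keeps the sum near 1 whatever the number of pieces.\<close>
    have \<Psi>n: "norm (\<Psi> y) \<le> 1 + \<eta>" for y
    proof -
      have "norm (\<Psi>j j y) \<le> \<zeta> j y + \<eta> / N" if j: "j \<in> F" for j
      proof -
        have "norm (conv (k' j) (P j) y - 0) \<le> \<zeta> j y + \<eta> / N"
        proof (rule conv_mollifier_near[OF k'm[OF j] Ck_on_imp_continuous[OF P1[OF j]] Pb])
          fix x assume "x \<in> ball (s *\<^sub>R e j) (s * \<kappa> j)"
          then have "norm x < d j" using small[of x 1 j] s(3)[OF j] by simp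
          then have "\<bar>\<zeta> j (y - x) - \<zeta> j y\<bar> < \<eta> / N" using d j by simp
          moreover have "norm (P j (y - x)) \<le> \<zeta> j (y - x) * 1"
            unfolding P_def norm_scaleR using t(3) z2[OF j, of "y - x"] by (intro mult_mono) auto
          ultimately show "norm (P j (y - x) - 0) \<le> \<zeta> j y + \<eta> / N" by simp
        qed
        then show ?thesis by (simp add: \<Psi>j_def)
      qed
      then have "norm (\<Psi> y) \<le> (\<Sum>j\<in>F. \<zeta> j y + \<eta> / N)" unfolding \<Psi>_def by (rule sum_norm_le)
      also have "\<dots> = (\<Sum>j\<in>F. \<zeta> j y) + real (card F) * (\<eta> / N)" by (simp add: sum.distrib)
      also have "\<dots> \<le> 1 + \<eta>" using z4[of y] \<eta> N by (intro add_mono) (simp_all add: field_simps)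
      finally show ?thesis .
    qed
    define K where "K = closure {x. \<phi> x \<noteq> 0}"
    \<comment> \<open>\<Psi> is supported in shifts, along the cone at j, of the part of the support
      of \<phi> near j. The cone property keeps these shifts in \<Omega>, so \<Psi> is admissible
      for the variation of \<open>v\<close>.\<close>
    define C where "C = (\<Union>j\<in>F. {x + y |x y. x \<in> K \<inter> cball j (r j) \<and> y \<in> cball (s *\<^sub>R e j) (s * \<kappa> j)})"
    have Cc: "compact C" unfolding C_def
      using F(2) s\<phi>(3) by (intro compact_UN compact_sums compact_Int) (auto simp: K_def)
    have C\<Omega>: "C \<subseteq> \<Omega>" unfolding C_def
    proof (intro UN_least subsetI)
      fix j u assume j: "j \<in> F" and u: "u \<in> {x + y |x y. x \<in> K \<inter> cball j (r j) \<and> y \<in> cball (s *\<^sub>R e j) (s * \<kappa> j)}"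
      then obtain x y where xy: "u = x + y" "x \<in> K" "x \<in> cball j (r j)" "y \<in> cball (s *\<^sub>R e j) (s * \<kappa> j)" by blast
      have deq: "dist (e j) ((1 / s) *\<^sub>R y) = (1 / s) * dist (s *\<^sub>R e j) y"
      proof -
        have "e j - (1 / s) *\<^sub>R y = (1 / s) *\<^sub>R (s *\<^sub>R e j - y)" using s(1) by (simp add: scaleR_diff_right)
        then show ?thesis using s(1) by (simp only: dist_norm norm_scaleR) simp
      qed
      have "dist (s *\<^sub>R e j) y \<le> s * \<kappa> j" using xy(4) by simp
      from mult_left_mono[OF this, of "1 / s"]
      have "(1 / s) *\<^sub>R y \<in> cball (e j) (\<kappa> j)" using s(1) unfolding mem_cball deq by simp
      then have "x + s *\<^sub>R ((1 / s) *\<^sub>R y) \<in> \<Omega>"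
        using j F(1) xy(2,3) s\<phi>(4) s(1) s(2)[OF j] by (intro cone[of j]) (auto simp: K_def)
      then show "u \<in> \<Omega>" using xy(1) s(1) by simp
    qed
    have \<Psi>s: "{y. \<Psi> y \<noteq> 0} \<subseteq> C"
    proof
      fix y assume "y \<in> {y. \<Psi> y \<noteq> 0}"
      then have "\<Psi> y \<noteq> 0" by simp
      then obtain j where j: "j \<in> F" "\<Psi>j j y \<noteq> 0" unfolding \<Psi>_def using sum.not_neutral_contains_not_neutral by blast
      have "\<exists>x. k' j x *\<^sub>R P j (y - x) \<noteq> 0"
      proof (rule ccontr)
        assume "\<not> ?thesis"
        then have "k' j x *\<^sub>R P j (y - x) = 0" for x by blast
        then have "\<Psi>j j y = 0" unfolding \<Psi>j_def conv_def by (simp only: integral_zero)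
        then show False using j(2) by simp
      qed
      then obtain x where x: "k' j x \<noteq> 0" "P j (y - x) \<noteq> 0" by auto
      have "x \<in> cball (s *\<^sub>R e j) (s * \<kappa> j)" using mollifierD(3)[OF k'm[OF j(1)] x(1)] by simp
      moreover have "\<zeta> j (y - x) \<noteq> 0" "\<phi> (y - x) \<noteq> 0" using x(2) by (auto simp: P_def)
      then have "y - x \<in> cball j (r j)" "y - x \<in> K"
        using z3[OF j(1), of "y - x"] closure_subset[of "{x. \<phi> x \<noteq> 0}"] by (auto simp: K_def)
      moreover have "y = (y - x) + x" by simp
      ultimately show "y \<in> C" unfolding C_def using j(1) by blast
    qed
    have \<Psi>cs: "compactly_supported_in \<Psi> \<Omega>" by (rule compactly_supported_inI[OF \<Psi>s Cc C\<Omega>])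
    have "set_lebesgue_integral lebesgue \<Omega> (\<lambda>x. v x * divergence \<Psi> x) \<le> (1 + \<eta>) * V"
      by (rule variation_scaled_test[OF \<Psi>1 \<Psi>cs \<Psi>n _ V]) (use \<eta> in simp)
    moreover have "set_lebesgue_integral lebesgue \<Omega> (\<lambda>x. v x * divergence \<Psi> x) = (\<integral>x. v x * divergence \<Psi> x \<partial>lborel)"
    proof (rule set_integral_lborel)
      have "continuous_on UNIV (divergence \<Psi>)" using Ck_on_divergence[of 0 \<Psi>] \<Psi>1 by simp
      from borel_measurable_continuous_onI[OF this]
      show "(\<lambda>x. v x * divergence \<Psi> x) \<in> borel_measurable borel" by measurable
      show "{x. v x * divergence \<Psi> x \<noteq> 0} \<subseteq> \<Omega>" using v(2) by auto
    qed
    ultimately have main: "(\<integral>x. v x * divergence \<Psi> x \<partial>lborel) \<le> (1 + \<eta>) * V" by simp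
    have Pd: "continuous_on UNIV (divergence (P j))" "bounded {x. divergence (P j) x \<noteq> 0}" if "j \<in> F" for j
    proof -
      have dP: "divergence (P j) x = \<zeta> j x * divergence \<phi> x + grad (\<zeta> j) x \<bullet> \<phi> x" for x
        unfolding P_def by (rule divergence_scaleR[OF z1[OF that] t(1)])
      show "continuous_on UNIV (divergence (P j))" using Ck_on_divergence[of 0 "P j"] P1[OF that] by simp
      show "bounded {x. divergence (P j) x \<noteq> 0}"
        by (rule bounded_subset[OF bounded_Un[THEN iffD2, OF conjI, OF t(7,8)]]) (auto simp: dP)
    qed
    \<comment> \<open>Mollification passes from \<open>v\<close> to the localized field by duality
      and commutes with the divergence.\<close>
    have A: "(\<integral>x. vj j x * divergence (P j) x \<partial>lborel) = (\<integral>x. v x * divergence (\<Psi>j j) x \<partial>lborel)"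
      "integrable lborel (\<lambda>x. vj j x * divergence (P j) x)" if "j \<in> F" for j
      using integral_conv_mult[OF v(1) mollifierD(7,5)[OF km[OF that]] integrable_bounded_support[OF Pd[OF that]]]
        divergence_conv[OF mollifierD(6)[OF k'm[OF that]] P1[OF that] Pb]
      unfolding vj_def \<Psi>j_def k'_def by simp_all
    have vd: "integrable lborel (\<lambda>x. v x * divergence (\<Psi>j j) x)" if j: "j \<in> F" for j
    proof -
      have "bounded {x. \<Psi>j j x \<noteq> 0}"
        unfolding \<Psi>j_def by (rule conv_bounded_support[OF mollifierD(5)[OF k'm[OF j]] Pb])
      then have "bounded {x. divergence (\<Psi>j j) x \<noteq> 0}"
        by (rule bounded_subset[OF bounded_closure divergence_support])
      moreover have "continuous_on UNIV (divergence (\<Psi>j j))" using Ck_on_divergence[of 0 "\<Psi>j j"] \<Psi>j1[OF j] by simp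
      ultimately show ?thesis by (intro integrable_mult_bounded_support v(1))
    qed
    have "(\<integral>x. v x * divergence \<Psi> x \<partial>lborel) = (\<integral>x. (\<Sum>j\<in>F. v x * divergence (\<Psi>j j) x) \<partial>lborel)"
      unfolding \<Psi>_def using divergence_sum[of F \<Psi>j, OF \<Psi>j1] by (simp add: sum_distrib_left)
    also have "\<dots> = (\<Sum>j\<in>F. \<integral>x. vj j x * divergence (P j) x \<partial>lborel)"
      using vd A(1) by (simp add: Bochner_Integration.integral_sum)
    finally have S: "(\<Sum>j\<in>F. \<integral>x. vj j x * divergence (P j) x \<partial>lborel) \<le> (1 + \<eta>) * V" using main by simp
    define h where "h = (\<lambda>j x. grad (\<zeta> j) x \<bullet> \<phi> x)"
    have hc: "continuous_on UNIV (h j)" if "j \<in> F" for j unfolding h_def by (intro continuous_intros zg(1)[OF that] t(4))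
    have hb: "bounded {x. h j x \<noteq> 0}" for j by (rule bounded_subset[OF t(7)]) (auto simp: h_def)
    have hB: "\<bar>h j x\<bar> \<le> B" if j: "j \<in> F" for j x
    proof -
      have "\<bar>h j x\<bar> \<le> norm (grad (\<zeta> j) x) * norm (\<phi> x)" unfolding h_def by (rule Cauchy_Schwarz_ineq2)
      also have "\<dots> \<le> B * 1" using B t(3) j by (intro mult_mono) auto
      finally show ?thesis by simp
    qed
    have h0: "v x * (\<Sum>j\<in>F. h j x) = 0" for x
    proof (cases "x \<in> \<Omega>")
      case True
      have "((\<lambda>x. \<Sum>j\<in>F. \<zeta> j x) has_derivative (\<lambda>u. \<Sum>j\<in>F. grad (\<zeta> j) x \<bullet> u)) (at x)"
        by (intro has_derivative_sum has_derivative_grad[OF z1])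
      then have "((\<lambda>x. 1) has_derivative (\<lambda>u. \<Sum>j\<in>F. grad (\<zeta> j) x \<bullet> u)) (at x)"
        by (rule has_derivative_transform_within_open[OF _ \<Omega>(1) True]) (rule z5)
      from has_derivative_unique[OF this has_derivative_const]
      have "(\<Sum>j\<in>F. grad (\<zeta> j) x \<bullet> \<phi> x) = 0" by (rule fun_cong)
      then show ?thesis by (simp add: h_def)
    qed (simp add: v(2))
    have vh: "integrable lborel (\<lambda>x. v x * h j x)" "integrable lborel (\<lambda>x. vj j x * h j x)" if "j \<in> F" for j
      by (intro integrable_mult_bounded_support v(1) vji that hc hb)+
    have "(\<Sum>j\<in>F. \<integral>x. v x * h j x \<partial>lborel) = (\<integral>x. v x * (\<Sum>j\<in>F. h j x) \<partial>lborel)"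
      unfolding sum_distrib_left using vh(1) by (simp add: Bochner_Integration.integral_sum)
    also have "\<dots> = 0" by (simp only: h0 integral_zero)
    finally have v0: "(\<Sum>j\<in>F. \<integral>x. v x * h j x \<partial>lborel) = 0" .
    \<comment> \<open>Replacing the mollified v_j by \<open>v\<close> costs at most B \<eta>1 per
      piece; with \<open>v\<close> itself the localization terms add up to zero.\<close>
    have hj: "- (\<integral>x. vj j x * h j x \<partial>lborel) \<le> B * \<eta>1 - (\<integral>x. v x * h j x \<partial>lborel)" if j: "j \<in> F" for j
    proof -
      have "(\<integral>x. v x * h j x \<partial>lborel) - (\<integral>x. vj j x * h j x \<partial>lborel) = (\<integral>x. v x * h j x - vj j x * h j x \<partial>lborel)"
        by (rule Bochner_Integration.integral_diff[symmetric]) (intro vh j)+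
      also have "\<dots> \<le> (\<integral>x. B * \<bar>vj j x - v x\<bar> \<partial>lborel)"
      proof (rule integral_mono)
        fix x
        have "v x * h j x - vj j x * h j x \<le> \<bar>h j x\<bar> * \<bar>vj j x - v x\<bar>"
          unfolding abs_mult[symmetric] by (simp add: algebra_simps abs_le_iff abs_if)
        also have "\<dots> \<le> B * \<bar>vj j x - v x\<bar>" by (rule mult_right_mono[OF hB[OF j]]) simp
        finally show "v x * h j x - vj j x * h j x \<le> B * \<bar>vj j x - v x\<bar>" .
      qed (use vh[OF j] vji[OF j] v(1) in auto)
      also have "\<dots> \<le> B * \<eta>1" using L1[OF j] B(1) by (simp add: vj_def mult_left_mono)
      finally show ?thesis by linarith
    qed
    have pw: "w x * divergence \<phi> x = (\<Sum>j\<in>F. vj j x * divergence (P j) x - vj j x * h j x)" for x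
    proof -
      have "divergence (P j) x = \<zeta> j x * divergence \<phi> x + h j x" if "j \<in> F" for j
        unfolding P_def h_def by (rule divergence_scaleR[OF z1[OF that] t(1)])
      then show ?thesis unfolding w_def sum_distrib_right by (intro sum.cong refl) (simp add: algebra_simps)
    qed
    have "set_lebesgue_integral lebesgue \<Omega> (\<lambda>x. w x * divergence \<phi> x) = (\<integral>x. w x * divergence \<phi> x \<partial>lborel)"
      by (rule set_integral_lborel)
        (auto intro!: borel_measurable_continuous_onI continuous_intros wc t(5), use t(9) in blast)
    also have "\<dots> = (\<Sum>j\<in>F. (\<integral>x. vj j x * divergence (P j) x \<partial>lborel) - (\<integral>x. vj j x * h j x \<partial>lborel))"
      unfolding pw using A(2) vh(2) by (simp add: Bochner_Integration.integral_sum)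
    also have "\<dots> \<le> (\<Sum>j\<in>F. (\<integral>x. vj j x * divergence (P j) x \<partial>lborel) + (B * \<eta>1 - (\<integral>x. v x * h j x \<partial>lborel)))"
      using hj by (intro sum_mono) (simp add: algebra_simps)
    also have "\<dots> = (\<Sum>j\<in>F. \<integral>x. vj j x * divergence (P j) x \<partial>lborel) + real (card F) * (B * \<eta>1)"
      using v0 by (simp add: sum.distrib sum_subtractf)
    also have "\<dots> \<le> (1 + \<eta>) * V + \<eta>"
    proof (intro add_mono S)
      have "real (card F) * (B * \<eta>1) \<le> N * ((B + 1) * \<eta>1)"
        using N B(1) \<eta>1 by (intro mult_mono) auto
      also have "\<dots> = \<eta>" using N B(1) by (simp add: \<eta>1_def)
      finally show "real (card F) * (B * \<eta>1) \<le> \<eta>" .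
    qed
    finally show "set_lebesgue_integral lebesgue \<Omega> (\<lambda>x. w x * divergence \<phi> x) \<le> (1 + \<eta>) * V + \<eta>" .
  qed
  then show ?thesis using \<open>smooth_on w UNIV\<close> wv by blast
qed

section \<open>The recovery sequence\<close>

lemma DERIV_half_square_pos_part: "((\<lambda>x. (max 0 x)\<^sup>2 / 2) has_real_derivative max 0 x) (at (x::real))"
proof -
  consider "x > 0" | "x < 0" | "x = 0" by linarith
  then show ?thesis
  proof cases
    case 1
    have "((\<lambda>x. x\<^sup>2 / 2) has_real_derivative max 0 x) (at x)"
      using 1 by (auto intro!: derivative_eq_intros)
    then show ?thesis
      by (rule has_field_derivative_transform_within_open[where S = "{0<..}"]) (use 1 in auto)
  next
    case 2
    have "((\<lambda>x. 0) has_real_derivative max 0 x) (at x)" using 2 by simp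
    then show ?thesis
      by (rule has_field_derivative_transform_within_open[where S = "{..<0}"]) (use 2 in auto)
  next
    case 3
    have "((\<lambda>h::real. max 0 h / 2) \<longlongrightarrow> max 0 0 / 2) (at 0)" by (intro tendsto_intros) auto
    moreover have "(\<lambda>h::real. ((max 0 (0 + h))\<^sup>2 / 2 - (max 0 0)\<^sup>2 / 2) / h) = (\<lambda>h. max 0 h / 2)"
      by (auto simp: fun_eq_iff power2_eq_square max_def)
    ultimately show ?thesis using 3 by (simp add: DERIV_def)
  qed
qed

text \<open>A \<open>C\<^sup>1\<close> replacement of the truncation to \<open>[-1, 1]\<close>: its average over windows of length
  \<open>2\<delta>\<close>.\<close>

definition soft_clamp :: "real \<Rightarrow> real \<Rightarrow> real" where
  "soft_clamp \<delta> s = ((max 0 (s + 1 + \<delta>))\<^sup>2 / 2 - (max 0 (s + 1 - \<delta>))\<^sup>2 / 2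
     - (max 0 (s - 1 + \<delta>))\<^sup>2 / 2 + (max 0 (s - 1 - \<delta>))\<^sup>2 / 2) / (2 * \<delta>) - 1"

text \<open>For 0 < \<delta> < 1 a trapezoid: 1 where |s| \<le> 1 - \<delta>, 0 where |s| \<ge> 1 +
  \<delta>, linear in between.\<close>

definition soft_clamp' :: "real \<Rightarrow> real \<Rightarrow> real" where
  "soft_clamp' \<delta> s = (max 0 (s + 1 + \<delta>) - max 0 (s + 1 - \<delta>)
     - max 0 (s - 1 + \<delta>) + max 0 (s - 1 - \<delta>)) / (2 * \<delta>)"

lemma soft_clamp:
  assumes \<delta>: "0 < \<delta>" "\<delta> < 1"
  shows "(soft_clamp \<delta> has_real_derivative soft_clamp' \<delta> s) (at s)"
    "0 \<le> soft_clamp' \<delta> s" "soft_clamp' \<delta> s \<le> 1"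
    "1 + \<delta> \<le> s \<Longrightarrow> soft_clamp \<delta> s = 1" "s \<le> - 1 - \<delta> \<Longrightarrow> soft_clamp \<delta> s = - 1"
    "1 + \<delta> \<le> \<bar>s\<bar> \<Longrightarrow> soft_clamp' \<delta> s = 0" "\<bar>soft_clamp \<delta> s\<bar> \<le> 1"
proof -
  have sh: "((\<lambda>s. (max 0 (s + c))\<^sup>2 / 2) has_real_derivative max 0 (s + c)) (at s)" for s c :: real
    using DERIV_shift[THEN iffD1, OF DERIV_half_square_pos_part] .
  show d: "(soft_clamp \<delta> has_real_derivative soft_clamp' \<delta> s) (at s)" for s
  proof -
    have "((\<lambda>s. ((max 0 (s + (1 + \<delta>)))\<^sup>2 / 2 - (max 0 (s + (1 - \<delta>)))\<^sup>2 / 2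
     - (max 0 (s + (- 1 + \<delta>)))\<^sup>2 / 2 + (max 0 (s + (- 1 - \<delta>)))\<^sup>2 / 2) / (2 * \<delta>) - 1) has_real_derivative
      (max 0 (s + (1 + \<delta>)) - max 0 (s + (1 - \<delta>)) - max 0 (s + (- 1 + \<delta>)) + max 0 (s + (- 1 - \<delta>))) / (2 * \<delta>) - 0) (at s)"
      by (intro DERIV_diff DERIV_add DERIV_cdivide sh DERIV_const)
    then show ?thesis unfolding soft_clamp_def[abs_def] soft_clamp'_def by (simp add: algebra_simps)
  qed
  show nn: "0 \<le> soft_clamp' \<delta> s" for s
    unfolding soft_clamp'_def using \<delta> by (intro divide_nonneg_pos) (auto simp: max_def)
  show "soft_clamp' \<delta> s \<le> 1" for s
    unfolding soft_clamp'_def using \<delta> by (auto simp: max_def divide_le_eq)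
  show 1: "soft_clamp \<delta> s = 1" if "1 + \<delta> \<le> s" for s
  proof -
    have "(s + 1 + \<delta>)\<^sup>2 / 2 - (s + 1 - \<delta>)\<^sup>2 / 2 - (s - 1 + \<delta>)\<^sup>2 / 2 + (s - 1 - \<delta>)\<^sup>2 / 2 = 2 * (2 * \<delta>)"
      by (simp add: power2_eq_square field_simps)
    then show ?thesis using that \<delta> by (simp add: soft_clamp_def max_absorb2)
  qed
  show 2: "soft_clamp \<delta> s = - 1" if "s \<le> - 1 - \<delta>" for s
    using that \<delta> by (simp add: soft_clamp_def max_absorb1)
  show "soft_clamp' \<delta> s = 0" if "1 + \<delta> \<le> \<bar>s\<bar>"
    using that \<delta> by (auto simp: soft_clamp'_def max_def abs_if split: if_splits)
  \<comment> \<open>Monotonicity reduces the bound by 1 to the two plateaus.\<close>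
  have mono: "soft_clamp \<delta> x \<le> soft_clamp \<delta> y" if "x \<le> y" for x y
    by (rule DERIV_nonneg_imp_nondecreasing[OF that]) (use d nn in blast)
  have "soft_clamp \<delta> s \<le> 1" using mono[of s "max s (1 + \<delta>)"] 1[of "max s (1 + \<delta>)"] by simp
  moreover have "- 1 \<le> soft_clamp \<delta> s" using mono[of "min s (- 1 - \<delta>)" s] 2[of "min s (- 1 - \<delta>)"] by simp
  ultimately show "\<bar>soft_clamp \<delta> s\<bar> \<le> 1" by linarith
qed

text \<open>By Fubini, the measures of the strips have integral \<open>2 c \<integral> a\<close> over all levels \<open>t\<close>.\<close>

lemma exists_level_small_strip:
  fixes w a :: "'a::euclidean_space \<Rightarrow> real"
  assumes [measurable]: "w \<in> borel_measurable borel" "a \<in> borel_measurable borel" "\<Omega> \<in> sets borel"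
    and a: "set_integrable lborel \<Omega> a" "\<And>x. 0 \<le> a x" "set_lebesgue_integral lborel \<Omega> a < A"
    and c: "0 < c" and \<alpha>\<beta>: "\<alpha> < \<beta>"
  shows "\<exists>t\<in>{\<alpha><..<\<beta>}. emeasure lborel {x \<in> \<Omega>. \<bar>w x - t\<bar> < c * a x} \<le> ennreal (2 * c * A / (\<beta> - \<alpha>))"
proof (rule ccontr)
  assume "\<not> ?thesis"
  \<comment> \<open>If every level in the interval had a large strip, integrating over the levels
    would exceed the total given by Fubini.\<close>
  then have big: "ennreal (2 * c * A / (\<beta> - \<alpha>)) \<le> emeasure lborel {x \<in> \<Omega>. \<bar>w x - t\<bar> < c * a x}"
    if "t \<in> {\<alpha><..<\<beta>}" for t using that by (meson linear)
  let ?S = "{z :: 'a \<times> real. fst z \<in> \<Omega> \<and> \<bar>w (fst z) - snd z\<bar> < c * a (fst z)}"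
  have a0: "0 \<le> set_lebesgue_integral lborel \<Omega> a"
    unfolding set_lebesgue_integral_def using a(2) by (intro integral_nonneg_AE AE_I2) simp
  have A: "0 < A" using a(3) a0 by linarith
  have "ennreal (2 * c * A) = (\<integral>\<^sup>+t. ennreal (2 * c * A / (\<beta> - \<alpha>)) * indicator {\<alpha><..<\<beta>} t \<partial>lborel)"
    using \<alpha>\<beta> c A by (simp add: nn_integral_cmult_indicator ennreal_mult[symmetric])
  also have "\<dots> \<le> (\<integral>\<^sup>+t. (\<integral>\<^sup>+x. indicator ?S (x, t) \<partial>lborel) \<partial>lborel)"
  proof (rule nn_integral_mono)
    fix t :: real
    have "(\<integral>\<^sup>+x. indicator ?S (x, t) \<partial>lborel) = (\<integral>\<^sup>+x. indicator {x \<in> \<Omega>. \<bar>w x - t\<bar> < c * a x} x \<partial>lborel)"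
      by (intro nn_integral_cong) (auto simp: indicator_def)
    also have "\<dots> = emeasure lborel {x \<in> \<Omega>. \<bar>w x - t\<bar> < c * a x}" by (rule nn_integral_indicator) measurable
    finally show "ennreal (2 * c * A / (\<beta> - \<alpha>)) * indicator {\<alpha><..<\<beta>} t \<le> (\<integral>\<^sup>+x. indicator ?S (x, t) \<partial>lborel)"
      using big[of t] by (cases "t \<in> {\<alpha><..<\<beta>}") auto
  qed
  also have "\<dots> = (\<integral>\<^sup>+x. (\<integral>\<^sup>+t. indicator ?S (x, t) \<partial>lborel) \<partial>lborel)"
    by (rule lborel_pair.Fubini') measurable
  also have "\<dots> = (\<integral>\<^sup>+x. ennreal (indicator \<Omega> x * (2 * c * a x)) \<partial>lborel)"
  proof (rule nn_integral_cong)
    \<comment> \<open>For fixed \<open>x\<close> in \<Omega> the levels whose strip contains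
      \<open>x\<close> form an interval of length 2 c a(x).\<close>
    fix x
    have "(\<integral>\<^sup>+t. indicator ?S (x, t) \<partial>lborel) = (\<integral>\<^sup>+t. indicator \<Omega> x * indicator {w x - c * a x<..<w x + c * a x} t \<partial>lborel)"
      by (intro nn_integral_cong) (auto simp: indicator_def)
    also have "\<dots> = indicator \<Omega> x * emeasure lborel {w x - c * a x<..<w x + c * a x}"
      by (rule nn_integral_cmult_indicator) simp
    also have "\<dots> = indicator \<Omega> x * ennreal (2 * c * a x)"
      using mult_nonneg_nonneg[of c "a x"] a(2)[of x] c by (subst emeasure_lborel_Ioo) (simp_all add: mult.assoc)
    finally show "(\<integral>\<^sup>+t. indicator ?S (x, t) \<partial>lborel) = ennreal (indicator \<Omega> x * (2 * c * a x))"
      by (auto simp: indicator_def)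
  qed
  also have "\<dots> = ennreal (\<integral>x. indicator \<Omega> x * (2 * c * a x) \<partial>lborel)"
  proof (rule nn_integral_eq_integral)
    have "integrable lborel (\<lambda>x. 2 * c * (indicator \<Omega> x * a x))"
      using a(1) by (intro integrable_mult_right) (simp add: set_integrable_def)
    then show "integrable lborel (\<lambda>x. indicator \<Omega> x * (2 * c * a x))" by (simp add: mult.left_commute mult.assoc)
  qed (use a(2) c in auto)
  also have "(\<integral>x. indicator \<Omega> x * (2 * c * a x) \<partial>lborel) = 2 * c * set_lebesgue_integral lborel \<Omega> a"
    unfolding set_lebesgue_integral_def
    by (subst integral_mult_right_zero[symmetric]) (simp add: mult.left_commute mult.assoc)
  finally have "2 * c * A \<le> 2 * c * set_lebesgue_integral lborel \<Omega> a"
    using c a0 by (subst (asm) ennreal_le_iff) auto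
  then show False using c a(3) by simp
qed

section \<open>Independence of representatives\<close>

lemma set_integral_cong_AE_test:
  assumes f: "set_integrable lebesgue \<Omega> f" and g: "set_integrable lebesgue \<Omega> g"
    and ae: "AE x in lebesgue. x \<in> \<Omega> \<longrightarrow> f x = g x" and U: "U \<subseteq> \<Omega>" "U \<in> sets lebesgue"
    and h: "continuous_on UNIV (h :: 'a::euclidean_space \<Rightarrow> real)"
  shows "set_lebesgue_integral lebesgue U (\<lambda>x. f x * h x) = set_lebesgue_integral lebesgue U (\<lambda>x. g x * h x)"
proof -
  have eq: "indicator U x *\<^sub>R (k x * h x) = indicator U x * ((indicator \<Omega> x *\<^sub>R k x) * h x)" for k :: "'a \<Rightarrow> real" and x
    using U(1) by (auto simp: indicator_def)
  have [measurable]: "h \<in> borel_measurable lebesgue"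
    using borel_measurable_continuous_onI[OF h] by (intro measurable_completion) auto
  have [measurable]: "(\<lambda>x. indicator \<Omega> x *\<^sub>R f x) \<in> borel_measurable lebesgue" "(\<lambda>x. indicator \<Omega> x *\<^sub>R g x) \<in> borel_measurable lebesgue"
    using f g unfolding set_integrable_def by (auto dest: borel_measurable_integrable)
  note [measurable] = U(2)
  show ?thesis unfolding set_lebesgue_integral_def eq
  proof (rule integral_cong_AE)
    show "AE x in lebesgue. indicator U x * ((indicator \<Omega> x *\<^sub>R f x) * h x) = indicator U x * ((indicator \<Omega> x *\<^sub>R g x) * h x)"
      using ae by eventually_elim (auto simp: indicator_def)
  qed measurable
qed

lemma variation_cong_AE:
  assumes "set_integrable lebesgue \<Omega> f" "set_integrable lebesgue \<Omega> g"
    "AE x in lebesgue. x \<in> \<Omega> \<longrightarrow> f x = g x" "U \<subseteq> \<Omega>" "U \<in> sets lebesgue"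
  shows "variation U f = variation U g"
  unfolding variation_eq_SUP_test_field
  by (intro SUP_cong refl arg_cong[where f = ennreal] set_integral_cong_AE_test[OF assms] test_fieldD(5)[of U]) simp

lemma J_eq_if_weak_grad:
  assumes "open \<Omega>" "v \<in> W12 \<Omega>" "is_weak_grad \<Omega> v g"
  shows "J \<Omega> \<epsilon> v = (\<integral>\<^sup>+x\<in>\<Omega>. ennreal (\<epsilon> * (norm (g x))\<^sup>2 + indicator {-1<..<1} (v x) / \<epsilon>) \<partial>lebesgue)"
proof -
  have "AE x in lebesgue. x \<in> \<Omega> \<longrightarrow> weak_grad \<Omega> v x = g x"
    by (rule is_weak_grad_unique[OF assms(1) is_weak_grad_weak_grad[OF assms(2)] assms(3)])
  then show ?thesis unfolding J_def energy_density_def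
  proof (intro nn_integral_cong_AE, eventually_elim)
    case (elim x)
    then show ?case by (cases "x \<in> \<Omega>") simp_all
  qed
qed

text \<open>For q = (w - t) / (\<epsilon> a) the quotient rule gives grad q = grad w / (\<epsilon>
  a) - (q / a) grad a. The first term has norm at most 1/\<epsilon> because |grad w| \<le> a; the
  second is at most \<open>M\<close> on the strip, where |q| < 1 + \<delta>, and \<open>M\<close>
  does not involve \<epsilon>.\<close>

lemma soft_clamp_energy:
  fixes w a :: "real ^ 'n::finite \<Rightarrow> real" and \<Omega> :: "(real ^ 'n) set" and t :: real
  assumes \<Omega>: "open \<Omega>" "bounded \<Omega>" and w: "Ck_on 1 w UNIV" and a: "Ck_on 1 a UNIV" "\<And>x. \<eta> \<le> a x" "0 < \<eta>"
    "\<And>x. norm (grad w x) \<le> a x" and G: "\<And>x. x \<in> \<Omega> \<Longrightarrow> norm (grad a x) \<le> G"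
    and \<delta>: "0 < \<delta>" "\<delta> < 1" and \<epsilon>: "0 < \<epsilon>"
  defines "v \<equiv> \<lambda>x. soft_clamp \<delta> ((w x - t) / (\<epsilon> * a x))"
    and "M \<equiv> (1 + \<delta>) * G / \<eta>"
  shows "v \<in> W12_unit \<Omega>"
    "J \<Omega> \<epsilon> v \<le> ennreal (\<epsilon> * (1 / \<epsilon> + M)\<^sup>2 + 1 / \<epsilon>) * emeasure lborel {x \<in> \<Omega>. \<bar>w x - t\<bar> < (1 + \<delta>) * \<epsilon> * a x}"
proof -
  define q where "q = (\<lambda>x. (w x - t) / (\<epsilon> * a x))"
  have apos: "0 < a x" for x using a(2)[of x] a(3) by linarith
  have q1: "Ck_on 1 q UNIV" unfolding q_def
    using apos \<epsilon> by (intro Ck_on_divide Ck_on_diff Ck_on_mult w a(1) Ck_on_const) (simp add: less_imp_neq[symmetric])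
  have vq: "v = (\<lambda>x. soft_clamp \<delta> (q x))" by (simp add: v_def q_def)
  have cs': "continuous_on UNIV (soft_clamp' \<delta>)" unfolding soft_clamp'_def using \<delta> by (intro continuous_intros) auto
  have "continuous_on UNIV (\<lambda>x. soft_clamp' \<delta> (q x))"
    using continuous_on_compose2[OF cs' Ck_on_imp_continuous[OF q1]] by simp
  note comp = Ck_on_1_compose[OF q1 soft_clamp(1)[OF \<delta>] this]
  have v1: "Ck_on 1 v UNIV" unfolding vq by (rule comp(1))
  have gv: "grad v x = soft_clamp' \<delta> (q x) *\<^sub>R grad q x" for x
  proof (rule grad_eqI)
    have "q differentiable (at x)" using Ck_on_SucD(1)[OF q1[unfolded One_nat_def]] differentiable_def by blast
    from frechet_eq_grad[OF this]
    have "(\<lambda>v. soft_clamp' \<delta> (q x) * frechet_derivative q (at x) v) = (\<bullet>) (soft_clamp' \<delta> (q x) *\<^sub>R grad q x)"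
      by (simp add: fun_eq_iff)
    then show "(v has_derivative (\<bullet>) (soft_clamp' \<delta> (q x) *\<^sub>R grad q x)) (at x)"
      using comp(2)[of x] unfolding vq by (simp only:)
  qed
  have gq: "grad q x = (1 / (\<epsilon> * a x)) *\<^sub>R grad w x - (q x / a x) *\<^sub>R grad a x" for x
  proof (rule grad_eqI)
    have "((\<lambda>x. \<epsilon> * a x) has_derivative (\<lambda>h. \<epsilon> * (grad a x \<bullet> h))) (at x)"
      by (intro has_derivative_mult_right has_derivative_grad[OF a(1)[unfolded One_nat_def]])
    moreover have "((\<lambda>x. w x - t) has_derivative (\<lambda>h. grad w x \<bullet> h - 0)) (at x)"
      by (intro has_derivative_diff has_derivative_const has_derivative_grad[OF w[unfolded One_nat_def]])
    ultimately have "(q has_derivative (\<lambda>h. ((grad w x \<bullet> h - 0) * (\<epsilon> * a x) - (w x - t) * (\<epsilon> * (grad a x \<bullet> h))) / (\<epsilon> * a x * (\<epsilon> * a x)))) (at x)"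
      unfolding q_def using apos[of x] \<epsilon> by (intro has_derivative_divide') auto
    moreover have "((grad w x \<bullet> h - 0) * (\<epsilon> * a x) - (w x - t) * (\<epsilon> * (grad a x \<bullet> h))) / (\<epsilon> * a x * (\<epsilon> * a x)) =
      ((1 / (\<epsilon> * a x)) *\<^sub>R grad w x - (q x / a x) *\<^sub>R grad a x) \<bullet> h" for h
      using apos[of x] \<epsilon> by (simp add: q_def inner_diff_left field_simps)
    ultimately show "(q has_derivative (\<bullet>) ((1 / (\<epsilon> * a x)) *\<^sub>R grad w x - (q x / a x) *\<^sub>R grad a x)) (at x)" by simp
  qed
  have ng: "norm (grad q x) \<le> 1 / \<epsilon> + M" if x: "x \<in> \<Omega>" "\<bar>q x\<bar> < 1 + \<delta>" for x
  proof -
    have "norm ((1 / (\<epsilon> * a x)) *\<^sub>R grad w x) = norm (grad w x) / (\<epsilon> * a x)" using apos[of x] \<epsilon> by simp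
    also have "\<dots> \<le> a x / (\<epsilon> * a x)" using a(4) apos[of x] \<epsilon> by (intro divide_right_mono) auto
    also have "\<dots> = 1 / \<epsilon>" using apos[of x] by simp
    finally have 1: "norm ((1 / (\<epsilon> * a x)) *\<^sub>R grad w x) \<le> 1 / \<epsilon>" .
    have "norm ((q x / a x) *\<^sub>R grad a x) = (\<bar>q x\<bar> * norm (grad a x)) / a x" using apos[of x] by simp
    also have "\<dots> \<le> ((1 + \<delta>) * G) / \<eta>"
      using x G[OF x(1)] a(2)[of x] a(3) \<delta> order_trans[OF norm_ge_zero G[OF x(1)]]
      by (intro frac_le mult_mono mult_nonneg_nonneg) auto
    finally have 2: "norm ((q x / a x) *\<^sub>R grad a x) \<le> M" by (simp add: M_def)
    show ?thesis unfolding gq using 1 2 norm_triangle_ineq4[of "(1 / (\<epsilon> * a x)) *\<^sub>R grad w x" "(q x / a x) *\<^sub>R grad a x"] by linarith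
  qed
  have W: "v \<in> W12 \<Omega>" "is_weak_grad \<Omega> v (grad v)" by (rule C1_in_W12[OF v1 \<Omega>])+
  show "v \<in> W12_unit \<Omega>" unfolding W12_unit_def using W(1) soft_clamp(7)[OF \<delta>] by (auto simp: vq abs_le_iff minus_le_iff)
  let ?S = "{x \<in> \<Omega>. \<bar>w x - t\<bar> < (1 + \<delta>) * \<epsilon> * a x}"
  let ?F = "\<epsilon> * (1 / \<epsilon> + M)\<^sup>2 + 1 / \<epsilon>"
  have Sb: "?S \<in> sets borel"
  proof -
    have [measurable]: "w \<in> borel_measurable borel" "a \<in> borel_measurable borel" "\<Omega> \<in> sets borel"
      using borel_measurable_continuous_onI[OF Ck_on_imp_continuous[OF w]]
        borel_measurable_continuous_onI[OF Ck_on_imp_continuous[OF a(1)]] \<Omega>(1) by simp_all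
    show ?thesis by measurable
  qed
  have qS: "\<bar>q x\<bar> < 1 + \<delta> \<longleftrightarrow> \<bar>w x - t\<bar> < (1 + \<delta>) * \<epsilon> * a x" for x
    using apos[of x] \<epsilon> by (simp add: q_def abs_mult pos_divide_less_eq mult.assoc)
  have "J \<Omega> \<epsilon> v = (\<integral>\<^sup>+x\<in>\<Omega>. ennreal (\<epsilon> * (norm (grad v x))\<^sup>2 + indicator {-1<..<1} (v x) / \<epsilon>) \<partial>lebesgue)"
    by (rule J_eq_if_weak_grad[OF \<Omega>(1) W])
  also have "\<dots> \<le> (\<integral>\<^sup>+x. ennreal ?F * indicator ?S x \<partial>lebesgue)"
  proof (rule nn_integral_mono)
    fix x
    show "ennreal (\<epsilon> * (norm (grad v x))\<^sup>2 + indicator {-1<..<1} (v x) / \<epsilon>) * indicator \<Omega> x \<le> ennreal ?F * indicator ?S x"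
    proof (cases "x \<in> \<Omega> \<and> \<bar>q x\<bar> < 1 + \<delta>")
      case True
      have "norm (grad v x) \<le> 1 * (1 / \<epsilon> + M)"
        unfolding gv norm_scaleR using soft_clamp(2,3)[OF \<delta>, of "q x"] ng[of x] True by (intro mult_mono) auto
      then have "(norm (grad v x))\<^sup>2 \<le> (1 / \<epsilon> + M)\<^sup>2" by (intro power_mono) auto
      then have "\<epsilon> * (norm (grad v x))\<^sup>2 + indicator {-1<..<1} (v x) / \<epsilon> \<le> ?F"
        using \<epsilon> by (intro add_mono mult_left_mono divide_right_mono) (auto simp: indicator_def)
      then show ?thesis using True qS[of x] by (auto intro: ennreal_leI)
    next
      case False
      then show ?thesis
      proof (cases "x \<in> \<Omega>")
        case True
        with False have q: "1 + \<delta> \<le> \<bar>q x\<bar>" by simp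
        \<comment> \<open>Off the strip the truncation sits on a plateau: its gradient vanishes and
          its value is 1 or -1, so neither term of the density contributes.\<close>
        have "grad v x = 0" unfolding gv using soft_clamp(6)[OF \<delta> q] by simp
        moreover have "v x \<notin> {-1<..<1}" using soft_clamp(4,5)[OF \<delta>, of "q x"] q by (auto simp: vq abs_if split: if_splits)
        ultimately show ?thesis by simp
      qed simp
    qed
  qed
  also have "\<dots> = ennreal ?F * emeasure lebesgue ?S" using Sb by (intro nn_integral_cmult_indicator) auto
  also have "emeasure lebesgue ?S = emeasure lborel ?S" using Sb by simp
  finally show "J \<Omega> \<epsilon> v \<le> ennreal ?F * emeasure lborel ?S" .
qed

lemma continuous_bounded_on_bounded:
  fixes f :: "'a::euclidean_space \<Rightarrow> 'b::real_normed_vector"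
  assumes "continuous_on UNIV f" "bounded \<Omega>"
  shows "\<exists>B\<ge>0. \<forall>x\<in>\<Omega>. norm (f x) \<le> B"
proof -
  have "compact (f ` closure \<Omega>)"
    using assms by (intro compact_continuous_image) (auto simp: compact_closure intro: continuous_on_subset)
  then obtain B where "0 < B" "\<And>y. y \<in> f ` closure \<Omega> \<Longrightarrow> norm y \<le> B"
    using compact_imp_bounded bounded_pos by metis
  then show ?thesis using closure_subset[of \<Omega>] by (intro exI[of _ B]) auto
qed

text \<open>The parameter \<delta> is fixed before \<epsilon>: it governs the smooth approximation
  \<open>w\<close>, the rounding of the truncation and the distance of the level \<open>t\<close>
  from the values -1 and 1. After that \<open>w\<close>, \<open>a\<close> and the bounds
  \<open>a1\<close> and \<open>M\<close> are fixed, and letting \<epsilon> tend to 0 removes their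
  effect.\<close>

lemma recovery_exists:
  fixes v0 :: "real ^ 'n::finite \<Rightarrow> real"
  assumes \<Omega>: "open \<Omega>" "bounded \<Omega>" "smooth_boundary \<Omega>" and v0: "v0 \<in> BV_pm1 \<Omega>"
    and V: "variation \<Omega> v0 \<le> ennreal V" "0 \<le> V" and e: "0 < e"
  shows "\<forall>\<^sub>F \<epsilon> in at_right 0. \<exists>v. v \<in> W12_unit \<Omega> \<and> set_integrable lebesgue \<Omega> v \<and>
    set_lebesgue_integral lebesgue \<Omega> (\<lambda>x. \<bar>v0 x - v x\<bar>) < e \<and> J \<Omega> \<epsilon> v \<le> ennreal (2 * V + e)"
proof -
  have \<Omega>b[measurable]: "\<Omega> \<in> sets borel" using \<Omega>(1) by simp
  have v0i: "set_integrable lebesgue \<Omega> v0" and v0pm: "AE x in lebesgue. x \<in> \<Omega> \<longrightarrow> v0 x \<in> {-1, 1}"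
    using v0 by (auto simp: BV_pm1_def BV_def)
  \<comment> \<open>A Borel version that vanishes off \<Omega>, as the approximation result asks;
    the variation is insensitive to the change.\<close>
  obtain v where v: "integrable lborel v" "\<And>x. x \<notin> \<Omega> \<Longrightarrow> v x = 0" "AE x in lebesgue. x \<in> \<Omega> \<longrightarrow> v x = v0 x"
    using borel_representative[OF v0i \<Omega>b] by blast
  note [measurable] = borel_measurable_integrable[OF v(1), simplified]
  have "indicator \<Omega> x *\<^sub>R v x = v x" for x using v(2)[of x] by (auto simp: indicator_def)
  then have vi: "set_integrable lebesgue \<Omega> v" using v(1) by (simp only: set_integrable_def) (simp add: integrable_completion)
  have vV: "variation \<Omega> v \<le> ennreal V"
    using variation_cong_AE[OF vi v0i v(3) order_refl] V(1) by simp
  have vpm: "AE x in lebesgue. x \<in> \<Omega> \<longrightarrow> v x = -1 \<or> v x = 1"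
    using v(3) v0pm by eventually_elim auto
  define m where "m = measure lborel \<Omega>"
  have m: "0 \<le> m" by (simp add: m_def)
  \<comment> \<open>A strict upper bound for the integral of \<open>a\<close>: the variation of
    \<open>w\<close> from an approximation with tolerance \<delta>^2, the regularization \<delta>^2
    times the measure of \<Omega>, and \<delta> for strictness.\<close>
  define A where "A = (\<lambda>\<delta>. (1 + \<delta>\<^sup>2) * V + \<delta>\<^sup>2 + \<delta>\<^sup>2 * m + \<delta>)"
  have "((\<lambda>\<delta>. (1 + \<delta>) / (1 - \<delta>) * 2 * A \<delta>) \<longlongrightarrow> (1 + 0) / (1 - 0) * 2 * ((1 + 0\<^sup>2) * V + 0\<^sup>2 + 0\<^sup>2 * m + 0)) (at_right 0)"
    unfolding A_def by (intro tendsto_intros) auto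
  then have "\<forall>\<^sub>F \<delta> in at_right 0. (1 + \<delta>) / (1 - \<delta>) * 2 * A \<delta> < 2 * V + e"
    using e by (intro order_tendstoD(2)) auto
  moreover have "\<forall>\<^sub>F \<delta> in at_right (0::real). \<delta> < e / 4" "\<forall>\<^sub>F \<delta> in at_right (0::real). \<delta> < 1"
    by (rule order_tendstoD(2)[OF tendsto_ident_at], use e in simp)+
  moreover have "\<forall>\<^sub>F \<delta> in at_right (0::real). 0 < \<delta>" by (simp add: eventually_at_right_less)
  ultimately have "\<forall>\<^sub>F \<delta> in at_right (0::real). 0 < \<delta> \<and> \<delta> < 1 \<and> \<delta> < e / 4 \<and> (1 + \<delta>) / (1 - \<delta>) * 2 * A \<delta> < 2 * V + e"
    by eventually_elim simp
  then have "\<exists>\<delta>. 0 < \<delta> \<and> \<delta> < 1 \<and> \<delta> < e / 4 \<and> (1 + \<delta>) / (1 - \<delta>) * 2 * A \<delta> < 2 * V + e"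
    by (rule eventually_happens'[rotated]) simp
  then obtain \<delta> where \<delta>: "0 < \<delta>" "\<delta> < 1" "\<delta> < e / 4" "(1 + \<delta>) / (1 - \<delta>) * 2 * A \<delta> < 2 * V + e"
    by blast
  \<comment> \<open>The tolerance is a square because the L1 error of \<open>w\<close> gets
    multiplied by 4/\<delta> below, which must leave 4 \<delta> < e.\<close>
  have \<eta>: "0 < \<delta>\<^sup>2" using \<delta>(1) by simp
  obtain w where w: "smooth_on w UNIV" "(\<integral>x. indicator \<Omega> x * \<bar>w x - v x\<bar> \<partial>lborel) < \<delta>\<^sup>2"
    "variation \<Omega> w \<le> ennreal ((1 + \<delta>\<^sup>2) * V + \<delta>\<^sup>2)"
    using BV_smooth_approx[OF \<Omega> v(1,2) vV V(2) \<eta>] by blast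
  have V1: "0 \<le> (1 + \<delta>\<^sup>2) * V + \<delta>\<^sup>2" using V(2) by simp
  define a where "a = (\<lambda>x. sqrt ((norm (grad w x))\<^sup>2 + (\<delta>\<^sup>2)\<^sup>2))"
  note ga' = integral_gradient_le_variation[OF w(1) \<Omega>(1,2) \<eta> w(3) V1, folded a_def]
  have ga: "set_lebesgue_integral lborel \<Omega> a \<le> (1 + \<delta>\<^sup>2) * V + \<delta>\<^sup>2 + \<delta>\<^sup>2 * measure lborel \<Omega>"
    "Ck_on 1 a UNIV" "\<And>x. \<delta>\<^sup>2 \<le> a x" "\<And>x. norm (grad w x) \<le> a x"
    using ga' by (simp_all add: a_def)
  have aA: "set_lebesgue_integral lborel \<Omega> a < A \<delta>" using ga(1) \<delta>(1) by (simp add: A_def m_def)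
  have w1: "Ck_on 1 w UNIV" by (rule smooth_on_imp_Ck[OF w(1)])
  have cw: "continuous_on UNIV w" "continuous_on UNIV a" "continuous_on UNIV (grad a)"
    using Ck_on_imp_continuous[OF w1] Ck_on_imp_continuous[OF ga(2)] Ck_on_grad[of 0 a] ga(2) by auto
  have [measurable]: "w \<in> borel_measurable borel" "a \<in> borel_measurable borel"
    using borel_measurable_continuous_onI cw by auto
  obtain G where G: "0 \<le> G" "\<And>x. x \<in> \<Omega> \<Longrightarrow> norm (grad a x) \<le> G"
    using continuous_bounded_on_bounded[OF cw(3) \<Omega>(2)] by blast
  obtain a1 where a1: "0 \<le> a1" "\<And>x. x \<in> \<Omega> \<Longrightarrow> norm (a x) \<le> a1"
    using continuous_bounded_on_bounded[OF cw(2) \<Omega>(2)] by blast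
  define M where "M = (1 + \<delta>) * G / \<delta>\<^sup>2"
  have M: "0 \<le> M" using G(1) \<delta> by (simp add: M_def)
  have apos: "0 \<le> a x" for x using ga(3)[of x] \<eta> by linarith
  have ai: "set_integrable lborel \<Omega> a" by (rule set_integrable_continuous_bounded(2)[OF cw(2) \<Omega>(2) \<Omega>b])
  have Apos: "0 < A \<delta>"
  proof -
    have "0 \<le> set_lebesgue_integral lborel \<Omega> a"
      unfolding set_lebesgue_integral_def using apos by (intro integral_nonneg_AE AE_I2) simp
    then show ?thesis using aA by linarith
  qed
  \<comment> \<open>The middle factor is \<epsilon> times the density bound \<epsilon> (1/\<epsilon>
    + M)^2 + 1/\<epsilon>. The quotient compares the widening 1 + \<delta> of the strips with 1 -
    \<delta>, half the length of the range of levels.\<close>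
  have "((\<lambda>\<epsilon>. (1 + \<delta>) / (1 - \<delta>) * (2 + 2 * M * \<epsilon> + M\<^sup>2 * \<epsilon>\<^sup>2) * A \<delta>) \<longlongrightarrow> (1 + \<delta>) / (1 - \<delta>) * (2 + 2 * M * 0 + M\<^sup>2 * 0\<^sup>2) * A \<delta>) (at_right 0)"
    by (intro tendsto_intros)
  then have "\<forall>\<^sub>F \<epsilon> in at_right 0. (1 + \<delta>) / (1 - \<delta>) * (2 + 2 * M * \<epsilon> + M\<^sup>2 * \<epsilon>\<^sup>2) * A \<delta> < 2 * V + e"
    using \<delta>(4) by (intro order_tendstoD(2)) auto
  moreover have "((\<lambda>\<epsilon>. (1 + \<delta>) * \<epsilon> * a1) \<longlongrightarrow> (1 + \<delta>) * 0 * a1) (at_right 0)" by (intro tendsto_intros)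
  then have "\<forall>\<^sub>F \<epsilon> in at_right 0. (1 + \<delta>) * \<epsilon> * a1 < \<delta> / 2"
    using \<delta>(1) by (intro order_tendstoD(2)) auto
  moreover have "\<forall>\<^sub>F \<epsilon> in at_right (0::real). 0 < \<epsilon>" by (simp add: eventually_at_right_less)
  ultimately show ?thesis
  proof eventually_elim
    case (elim \<epsilon>)
    \<comment> \<open>Levels stay \<delta> away from -1 and 1: where the truncation differs from
      \<open>v\<close>, the function \<open>w\<close> is then off by at least \<delta>/2.\<close>
    obtain t where t: "- 1 + \<delta> < t" "t < 1 - \<delta>"
      "emeasure lborel {x \<in> \<Omega>. \<bar>w x - t\<bar> < (1 + \<delta>) * \<epsilon> * a x} \<le> ennreal (2 * ((1 + \<delta>) * \<epsilon>) * A \<delta> / ((1 - \<delta>) - (- 1 + \<delta>)))"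
      using exists_level_small_strip[of w a \<Omega> "A \<delta>" "(1 + \<delta>) * \<epsilon>" "- 1 + \<delta>" "1 - \<delta>"] ai apos aA elim \<delta> \<Omega>b by auto
    define v' where "v' = (\<lambda>x. soft_clamp \<delta> ((w x - t) / (\<epsilon> * a x)))"
    note en = soft_clamp_energy[OF \<Omega>(1,2) w1 ga(2,3) \<eta> ga(4) G(2) \<delta>(1,2) elim(3), of t, folded v'_def M_def]
    have "J \<Omega> \<epsilon> v' \<le> ennreal (\<epsilon> * (1 / \<epsilon> + M)\<^sup>2 + 1 / \<epsilon>) * ennreal (2 * ((1 + \<delta>) * \<epsilon>) * A \<delta> / ((1 - \<delta>) - (- 1 + \<delta>)))"
      by (rule order_trans[OF en(2) mult_left_mono[OF t(3) zero_le]])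
    also have "\<dots> = ennreal ((\<epsilon> * (1 / \<epsilon> + M)\<^sup>2 + 1 / \<epsilon>) * (2 * ((1 + \<delta>) * \<epsilon>) * A \<delta> / ((1 - \<delta>) - (- 1 + \<delta>))))"
      using elim(3) by (intro ennreal_mult'[symmetric]) simp
    also have "(\<epsilon> * (1 / \<epsilon> + M)\<^sup>2 + 1 / \<epsilon>) * (2 * ((1 + \<delta>) * \<epsilon>) * A \<delta> / ((1 - \<delta>) - (- 1 + \<delta>)))
      = (1 + \<delta>) / (1 - \<delta>) * (2 + 2 * M * \<epsilon> + M\<^sup>2 * \<epsilon>\<^sup>2) * A \<delta>"
    proof -
      have 1: "(\<epsilon> * (1 / \<epsilon> + M)\<^sup>2 + 1 / \<epsilon>) * \<epsilon> = 2 + 2 * M * \<epsilon> + M\<^sup>2 * \<epsilon>\<^sup>2"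
        using elim(3) by (simp add: field_simps power2_eq_square)
      have 2: "2 * ((1 + \<delta>) * \<epsilon>) * A \<delta> / ((1 - \<delta>) - (- 1 + \<delta>)) = \<epsilon> * ((1 + \<delta>) / (1 - \<delta>) * A \<delta>)"
        using \<delta>(2) by (simp add: field_simps)
      show ?thesis unfolding 2 1[symmetric] by (simp add: mult.assoc mult.left_commute)
    qed
    finally have J: "J \<Omega> \<epsilon> v' \<le> ennreal (2 * V + e)"
      using elim(1) by (meson ennreal_leI less_imp_le order_trans)
    have dist: "set_lebesgue_integral lebesgue \<Omega> (\<lambda>x. \<bar>v0 x - v' x\<bar>) < e"
    proof -
      have apos': "0 < a x" for x using ga(3)[of x] \<eta> by linarith
      \<comment> \<open>A Chebyshev-type estimate: the difference is at most 2, and nonzero only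
        where |w - v| \<ge> \<delta>/2.\<close>
      have pw: "\<bar>v x - v' x\<bar> \<le> 4 / \<delta> * \<bar>w x - v x\<bar>" if x: "x \<in> \<Omega>" "v x = -1 \<or> v x = 1" for x
      proof (cases "v' x = v x")
        case True then show ?thesis using \<delta>(1) by simp
      next
        case False
        have strip: "(1 + \<delta>) * \<epsilon> * a x < \<delta> / 2"
        proof -
          have "a x \<le> a1" "0 \<le> (1 + \<delta>) * \<epsilon>" using a1(2)[OF x(1)] elim(3) \<delta>(1) by auto
          from mult_left_mono[OF this] elim(2) show ?thesis by (rule order.strict_trans1)
        qed
        have "\<delta> / 2 \<le> \<bar>w x - v x\<bar>"
          using x(2)
        proof
          assume v: "v x = 1"
          have "(w x - t) / (\<epsilon> * a x) < 1 + \<delta>"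
          proof (rule ccontr)
            assume "\<not> ?thesis"
            then have "v' x = 1" unfolding v'_def by (intro soft_clamp(4)[OF \<delta>(1,2)]) simp
            then show False using False v by simp
          qed
          then have "w x - t < (1 + \<delta>) * \<epsilon> * a x" using apos'[of x] elim(3) by (simp add: pos_divide_less_eq mult.assoc)
          then show ?thesis using strip t(2) v by linarith
        next
          assume v: "v x = -1"
          have "- 1 - \<delta> < (w x - t) / (\<epsilon> * a x)"
          proof (rule ccontr)
            assume "\<not> ?thesis"
            then have "v' x = - 1" unfolding v'_def by (intro soft_clamp(5)[OF \<delta>(1,2)]) simp
            then show False using False v by simp
          qed
          then have "(- 1 - \<delta>) * (\<epsilon> * a x) < w x - t"
            using pos_less_divide_eq[of "\<epsilon> * a x" "- 1 - \<delta>" "w x - t"] apos'[of x] elim(3) by simp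
          then have "- ((1 + \<delta>) * \<epsilon> * a x) < w x - t" by (simp add: algebra_simps)
          then show ?thesis using strip t(1) v by linarith
        qed
        then have "2 \<le> 4 / \<delta> * \<bar>w x - v x\<bar>" using \<delta>(1) by (simp add: field_simps)
        moreover have "\<bar>v x - v' x\<bar> \<le> 2" using x(2) soft_clamp(7)[OF \<delta>(1,2), of "(w x - t) / (\<epsilon> * a x)"] by (auto simp: v'_def)
        ultimately show ?thesis by linarith
      qed
      have i1: "integrable lborel (\<lambda>x. indicator \<Omega> x * \<bar>w x - v x\<bar>)"
      proof -
        have "integrable lborel (\<lambda>x. indicator \<Omega> x *\<^sub>R w x)"
          using set_integrable_continuous_bounded(2)[OF cw(1) \<Omega>(2) \<Omega>b] by (simp add: set_integrable_def)
        from Bochner_Integration.integrable_diff[OF this v(1)]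
        have "integrable lborel (\<lambda>x. \<bar>indicator \<Omega> x *\<^sub>R w x - v x\<bar>)" by (rule integrable_abs)
        moreover have "\<bar>indicator \<Omega> x *\<^sub>R w x - v x\<bar> = indicator \<Omega> x * \<bar>w x - v x\<bar>" for x
          using v(2)[of x] by (auto simp: indicator_def)
        ultimately show ?thesis by simp
      qed
      then have i2: "integrable lebesgue (\<lambda>x. 4 / \<delta> * (indicator \<Omega> x * \<bar>w x - v x\<bar>))"
        using integrable_completion[of "\<lambda>x. indicator \<Omega> x * \<bar>w x - v x\<bar>" lborel] by simp
      have "set_lebesgue_integral lebesgue \<Omega> (\<lambda>x. \<bar>v0 x - v' x\<bar>) \<le> (\<integral>x. 4 / \<delta> * (indicator \<Omega> x * \<bar>w x - v x\<bar>) \<partial>lebesgue)"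
        unfolding set_lebesgue_integral_def
      proof (rule integral_mono_AE'[OF i2])
        show "AE x in lebesgue. indicator \<Omega> x *\<^sub>R \<bar>v0 x - v' x\<bar> \<le> 4 / \<delta> * (indicator \<Omega> x * \<bar>w x - v x\<bar>)"
          using vpm v(3)
        proof eventually_elim
          case (elim x)
          then show ?case using pw[of x] by (cases "x \<in> \<Omega>") auto
        qed
      qed (use \<delta>(1) in auto)
      also have "\<dots> = 4 / \<delta> * (\<integral>x. indicator \<Omega> x * \<bar>w x - v x\<bar> \<partial>lborel)"
        by (subst integral_completion) auto
      also have "\<dots> \<le> 4 / \<delta> * \<delta>\<^sup>2" using w(2) \<delta>(1) by (intro mult_left_mono) auto
      also have "\<dots> = 4 * \<delta>" using \<delta>(1) by (simp add: power2_eq_square)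
      also have "\<dots> < e" using \<delta>(3) by simp
      finally show ?thesis .
    qed
    have "continuous_on UNIV v'"
    proof -
      have "continuous_on UNIV (soft_clamp \<delta>)"
        using soft_clamp(1)[OF \<delta>(1,2), THEN DERIV_isCont] by (simp add: continuous_on_eq_continuous_at)
      moreover have "continuous_on UNIV (\<lambda>x. (w x - t) / (\<epsilon> * a x))"
      proof (intro continuous_intros cw ballI)
        show "\<epsilon> * a x \<noteq> 0" for x using less_le_trans[OF \<eta> ga(3)[of x]] elim(3) by simp
      qed
      ultimately show ?thesis unfolding v'_def using continuous_on_compose2[of UNIV "soft_clamp \<delta>" UNIV] by simp
    qed
    then have "set_integrable lebesgue \<Omega> v'" by (rule set_integrable_continuous_bounded(1)[OF _ \<Omega>(2) \<Omega>b])
    then show ?case using en(1) dist J by blast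
  qed
qed

section \<open>The weak gradient on the set where the solution is constant\<close>

lemma AE_lebesgue_iff_negligible: "(AE x in lebesgue. P x) \<longleftrightarrow> negligible {x. \<not> P x}"
proof
  assume "AE x in lebesgue. P x"
  then obtain N where "N \<in> null_sets lebesgue" "{x. \<not> P x} \<subseteq> N"
    unfolding eventually_ae_filter by auto
  then show "negligible {x. \<not> P x}" using negligible_iff_null_sets negligible_subset by blast
next
  assume "negligible {x. \<not> P x}"
  then show "AE x in lebesgue. P x"
    unfolding eventually_ae_filter negligible_iff_null_sets by (intro bexI[of _ "{x. \<not> P x}"]) auto
qed

text \<open>The surface near \<open>x\<close> is viewed from the point x - G, with G = grad g x.
  Rays from there towards a small ball have directions in the cone, so \<open>g\<close> strictly
  increases between two points of the ball on one ray, and the zero set meets each ray at most once.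
  Closed sets with that property are null.\<close>

lemma locally_C1_surface_negligible:
  fixes S :: "(real ^ 'n::finite) set"
  assumes "locally_C1_surface S"
  shows "negligible S"
proof (subst locally_negligible_alt, intro ballI)
  fix x assume x: "x \<in> S"
  from assms[unfolded locally_C1_surface_def, THEN bspec, OF x]
  obtain N g where Ng: "open N \<and> x \<in> N \<and> Ck_on 1 g N \<and> (\<forall>y\<in>N. grad g y \<noteq> 0) \<and> S \<inter> N = {y \<in> N. g y = 0}"
    by (elim exE)
  have N: "open N" "x \<in> N" "Ck_on 1 g N" "grad g x \<noteq> 0" "S \<inter> N = {y \<in> N. g y = 0}"
    using Ng by (simp_all del: Ck_on.simps One_nat_def)
  define G where "G = grad g x"
  from C1_gradient_cone[OF N(1-4)] obtain \<rho> where \<rho>0: "0 < \<rho> \<and> ball x \<rho> \<subseteq> N \<and>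
    (\<forall>y\<in>ball x \<rho>. \<forall>z. norm (z - grad g x) \<le> norm (grad g x) / 4 \<longrightarrow> 0 < grad g y \<bullet> z)" by (elim exE)
  \<comment> \<open>The bound |G|/4 puts the vector from x - G to any point of the ball into the
    cone.\<close>
  define r where "r = min (\<rho> / 2) (norm G / 4)"
  have r: "0 < r" "r < \<rho>" "r \<le> norm G / 4" using \<rho>0 N(4) by (auto simp: r_def G_def min_def)
  have sub: "cball x r \<subseteq> ball x \<rho>" using r(2) by auto
  define Z where "Z = {y \<in> cball x r. g y = 0}"
  have cr: "cball x r \<subseteq> N" using sub \<rho>0 by blast
  have "continuous_on N g"
    using C1_gradient(1)[OF N(1,3)] has_derivative_continuous
    by (intro continuous_at_imp_continuous_on) blast
  then have "continuous_on (cball x r) g" using cr by (rule continuous_on_subset)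
  then have "closed Z" unfolding Z_def
    by (intro continuous_closed_preimage_constant) auto
  moreover have "x - G + c *\<^sub>R z \<notin> Z" if c: "0 \<le> c" "c < 1" and z: "x - G + z \<in> Z" for c z
  proof
    assume in1: "x - G + c *\<^sub>R z \<in> Z"
    let ?y = "x - G + c *\<^sub>R z"
    have zz: "norm (z - grad g x) \<le> norm (grad g x) / 4"
    proof -
      have "dist x (x - G + z) \<le> r" using z by (simp add: Z_def)
      moreover have "dist x (x - G + z) = norm (z - G)" by (simp add: dist_norm norm_minus_commute)
      ultimately show ?thesis using r(3) by (simp add: G_def)
    qed
    have seg: "?y + t *\<^sub>R z \<in> ball x \<rho>" if t: "0 \<le> t" "t \<le> 1 - c" for t
    proof -
      have "?y + t *\<^sub>R z = (1 - t / (1 - c)) *\<^sub>R ?y + (t / (1 - c)) *\<^sub>R (x - G + z)"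
      proof -
        have "(1 - t / (1 - c)) *\<^sub>R ?y + (t / (1 - c)) *\<^sub>R (x - G + z) = ?y + (t / (1 - c)) *\<^sub>R ((x - G + z) - ?y)"
          by (simp add: algebra_simps)
        also have "(x - G + z) - ?y = (1 - c) *\<^sub>R z" by (simp add: algebra_simps)
        finally show ?thesis using c by simp
      qed
      moreover have "(1 - t / (1 - c)) *\<^sub>R ?y + (t / (1 - c)) *\<^sub>R (x - G + z) \<in> cball x r"
      proof (rule convexD[OF convex_cball])
        show "?y \<in> cball x r" "x - G + z \<in> cball x r" using in1 z unfolding Z_def by blast+
      qed (use t c in \<open>auto simp: divide_le_eq\<close>)
      ultimately show ?thesis using sub by auto
    qed
    have "g ?y < g (?y + (1 - c) *\<^sub>R z)"
    proof (rule strict_increasing_along_segment)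
      fix t :: real assume t: "0 \<le> t" "t \<le> 1 - c"
      show "(g has_derivative (\<lambda>v. grad g (?y + t *\<^sub>R z) \<bullet> v)) (at (?y + t *\<^sub>R z))"
        using seg[OF t] \<rho>0 by (intro C1_gradient(1)[OF N(1,3)]) blast
      show "0 < grad g (?y + t *\<^sub>R z) \<bullet> z" using \<rho>0 seg[OF t] zz by blast
    qed (use c in simp)
    moreover have "?y + (1 - c) *\<^sub>R z = x - G + z" by (simp add: algebra_simps)
    ultimately show False using in1 z by (simp add: Z_def)
  qed
  ultimately have "negligible Z" by (rule starlike_negligible_strong)
  moreover have "S \<inter> ball x r \<subseteq> Z"
  proof
    fix y assume y: "y \<in> S \<inter> ball x r"
    then have "y \<in> cball x r" "y \<in> S \<inter> N" using cr by auto
    then show "y \<in> Z" unfolding N(5) Z_def by blast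
  qed
  ultimately have "negligible (S \<inter> ball x r)" by (rule negligible_subset)
  then show "\<exists>U. openin (top_of_set S) U \<and> x \<in> U \<and> negligible U"
    using x r(1) by (intro exI[of _ "S \<inter> ball x r"]) (auto intro: openin_open_Int)
qed

lemma is_weak_grad_subset:
  fixes u :: "real ^ 'n::finite \<Rightarrow> real"
  assumes g: "is_weak_grad \<Omega> u g" and B: "B \<subseteq> \<Omega>"
  shows "is_weak_grad B u g"
  unfolding is_weak_grad_def
proof (intro conjI allI impI)
  show "locally_integrable_on g B"
    using conjunct1[OF g[unfolded is_weak_grad_def]] B unfolding locally_integrable_on_def by blast
  fix \<phi> :: "real ^ 'n \<Rightarrow> real" and i
  assume p: "smooth_on \<phi> UNIV \<and> compactly_supported_in \<phi> B"
  note s = compactly_supported_inD[OF conjunct2[OF p]]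
  have eq: "set_lebesgue_integral lebesgue B h = set_lebesgue_integral lebesgue \<Omega> h"
    if "\<And>x. x \<notin> B \<Longrightarrow> h x = 0" for h :: "real ^ 'n \<Rightarrow> real"
  proof -
    have "indicator B x *\<^sub>R h x = indicator \<Omega> x *\<^sub>R h x" for x using that[of x] B by (auto simp: indicator_def)
    then show ?thesis unfolding set_lebesgue_integral_def by (simp only:)
  qed
  have "compactly_supported_in \<phi> \<Omega>" using p B by (auto simp: compactly_supported_in_def)
  then have "set_lebesgue_integral lebesgue \<Omega> (\<lambda>x. u x * partial i \<phi> x) = - set_lebesgue_integral lebesgue \<Omega> (\<lambda>x. g x $ i * \<phi> x)"
    using g p unfolding is_weak_grad_def by blast
  moreover have "partial i \<phi> x = 0" if "x \<notin> B" for x using partial_support[of i \<phi>] s(4) that by blast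
  moreover have "\<phi> x = 0" if "x \<notin> B" for x using s(2) that by blast
  ultimately show "set_lebesgue_integral lebesgue B (\<lambda>x. u x * partial i \<phi> x) = - set_lebesgue_integral lebesgue B (\<lambda>x. g x $ i * \<phi> x)"
    by (simp add: eq)
qed

lemma is_weak_grad_const:
  fixes u :: "real ^ 'n::finite \<Rightarrow> real"
  assumes "open B" "bounded B" "\<And>x. x \<in> B \<Longrightarrow> u x = c"
  shows "is_weak_grad B u (\<lambda>x. 0)"
proof -
  have "is_weak_grad B (\<lambda>x. c) (grad (\<lambda>x. c))" by (rule C1_in_W12(1)[OF Ck_on_const assms(1,2)])
  moreover have "grad (\<lambda>x. c) = (\<lambda>x. 0 :: real ^ 'n)" by (rule ext, rule grad_eqI) simp
  moreover have "indicator B x *\<^sub>R (u x * h x) = indicator B x *\<^sub>R (c * h x)" for h :: "real ^ 'n \<Rightarrow> real" and x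
    using assms(3)[of x] by (auto simp: indicator_def)
  ultimately show ?thesis unfolding is_weak_grad_def set_lebesgue_integral_def by (simp only:) blast
qed

text \<open>This gives the second term of the energy density its full value 1/\<epsilon> wherever
  the gradient contributes, as the pointwise lower bound requires.\<close>

lemma classical_solution_weak_grad_0:
  fixes u :: "real ^ 'n::finite \<Rightarrow> real"
  assumes \<Omega>: "open \<Omega>" and cs: "classical_solution \<Omega> \<epsilon> u" and g: "is_weak_grad \<Omega> u g"
  shows "AE x in lebesgue. x \<in> \<Omega> \<longrightarrow> g x \<noteq> 0 \<longrightarrow> \<bar>u x\<bar> < 1"
proof -
  define T where "T = transition_set \<Omega> u"
  have cu: "continuous_on \<Omega> u" and ub: "\<And>x. x \<in> \<Omega> \<Longrightarrow> u x \<in> {-1..1}"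
    and surf: "locally_C1_surface (\<Omega> \<inter> frontier T)"
    using cs unfolding classical_solution_def T_def by blast+
  have fr: "negligible (\<Omega> \<inter> frontier T)" by (rule locally_C1_surface_negligible[OF surf])
  let ?S = "{x \<in> \<Omega> - closure T. g x \<noteq> 0}"
  have "negligible ?S"
  proof (subst locally_negligible_alt, intro ballI)
    fix x assume x: "x \<in> ?S"
    have "open (\<Omega> - closure T)" using \<Omega> by (intro open_Diff) auto
    then obtain r where r: "0 < r" "ball x r \<subseteq> \<Omega> - closure T" using x open_contains_ball by blast
    have pm: "u y \<in> {-1, 1}" if "y \<in> ball x r" for y
    proof -
      have "y \<in> \<Omega>" "y \<notin> T" using that r(2) closure_subset[of T] by blast+
      then show ?thesis using ub[of y] by (auto simp: T_def transition_set_def)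
    qed
    \<comment> \<open>Continuity and only two possible values make \<open>u\<close> constant on the
      ball; uniqueness of weak gradients there then forces g = 0.\<close>
    have "u constant_on ball x r"
    proof (rule continuous_finite_range_constant)
      show "continuous_on (ball x r) u" by (rule continuous_on_subset[OF cu]) (use r(2) in blast)
      show "finite (u ` ball x r)" by (rule finite_subset[of _ "{-1, 1}"]) (use pm in blast, simp)
    qed simp
    then obtain c where "\<And>y. y \<in> ball x r \<Longrightarrow> u y = c" unfolding constant_on_def by blast
    then have "is_weak_grad (ball x r) u (\<lambda>x. 0)" by (intro is_weak_grad_const) auto
    moreover have "is_weak_grad (ball x r) u g" by (rule is_weak_grad_subset[OF g]) (use r in blast)
    ultimately have "AE y in lebesgue. y \<in> ball x r \<longrightarrow> g y = 0" by (intro is_weak_grad_unique[of "ball x r" u]) auto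
    then have "negligible {y. \<not> (y \<in> ball x r \<longrightarrow> g y = 0)}" unfolding AE_lebesgue_iff_negligible .
    then have "negligible (?S \<inter> ball x r)" by (rule negligible_subset) auto
    then show "\<exists>U. openin (top_of_set ?S) U \<and> x \<in> U \<and> negligible U"
      using x r(1) by (intro exI[of _ "?S \<inter> ball x r"]) (auto intro: openin_open_Int)
  qed
  then have "negligible (?S \<union> (\<Omega> \<inter> frontier T))" using fr by (rule negligible_Un)
  then show ?thesis unfolding AE_lebesgue_iff_negligible
  proof (rule negligible_subset, intro subsetI)
    fix x assume "x \<in> {x. \<not> (x \<in> \<Omega> \<longrightarrow> g x \<noteq> 0 \<longrightarrow> \<bar>u x\<bar> < 1)}"
    then have x: "x \<in> \<Omega>" "g x \<noteq> 0" "x \<notin> T" by (auto simp: T_def transition_set_def)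
    then have "x \<notin> interior T" using interior_subset by blast
    then show "x \<in> ?S \<union> (\<Omega> \<inter> frontier T)" using x by (auto simp: frontier_def)
  qed
qed

section \<open>The energy controls the associated varifold\<close>

text \<open>A symmetric idempotent of rank n - 1 annihilates a unit vector p orthogonal to its range
  and fixes the orthogonal complement of p. As a continuous image of the sphere the Grassmannian is
  compact, which admits functions of position alone as varifold test functions.\<close>

lemma grassmannian_eq: "grassmannian = normal_projection ` sphere (0 :: real ^ 'n::finite) 1"
proof
  show "normal_projection ` sphere (0 :: real ^ 'n) 1 \<subseteq> grassmannian"
    by (force intro: normal_projection_in_grassmannian)
  show "grassmannian \<subseteq> normal_projection ` sphere (0 :: real ^ 'n) 1"
  proof
    fix P :: "real ^ 'n ^ 'n" assume "P \<in> grassmannian"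
    then have P: "transpose P = P" "P ** P = P" "rank P = CARD('n) - 1" by (auto simp: grassmannian_def)
    have sym: "(P *v x) \<bullet> y = x \<bullet> (P *v y)" for x y
      using dot_lmul_matrix[of x P y] P(1) by (metis transpose_matrix_vector)
    have d: "dim (range ((*v) P)) = CARD('n) - 1" using P(3) by (simp add: rank_dim_range)
    then have "dim (range ((*v) P)) < DIM(real ^ 'n)" by simp
    from orthogonal_to_subspace_exists[OF this]
    obtain p0 where p0: "p0 \<noteq> 0" "\<And>y. y \<in> span (range ((*v) P)) \<Longrightarrow> orthogonal p0 y" by blast
    define p where "p = (1 / norm p0) *\<^sub>R p0"
    have p: "norm p = 1" "p \<noteq> 0" using p0(1) by (simp_all add: p_def)
    have orth: "p \<bullet> (P *v y) = 0" for y
      using p0(2)[of "P *v y"] by (simp add: p_def orthogonal_def span_base)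
    have Pp: "P *v p = 0"
    proof -
      have "(P *v p) \<bullet> (P *v p) = p \<bullet> (P *v (P *v p))" by (rule sym)
      also have "\<dots> = 0" by (rule orth)
      finally show ?thesis by simp
    qed
    have sub: "subspace (range ((*v) P))" by (simp add: linear_subspace_image[OF matrix_vector_mul_linear])
    have "range ((*v) P) = {x. p \<bullet> x = 0}"
    proof (rule subspace_dim_equal[OF sub])
      show "subspace {x. p \<bullet> x = 0}" by (rule subspace_hyperplane)
      show "range ((*v) P) \<subseteq> {x. p \<bullet> x = 0}" using orth by auto
      show "dim {x. p \<bullet> x = 0} \<le> dim (range ((*v) P))" using dim_hyperplane[OF p(2)] d by simp
    qed
    then have fix_orth: "P *v x = x" if x: "p \<bullet> x = 0" for x
    proof -
      have "x \<in> range ((*v) P)" using x \<open>range ((*v) P) = _\<close> by simp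
      then obtain y where y: "x = P *v y" by blast
      show ?thesis unfolding y using P(2) by (simp add: matrix_vector_mul_assoc)
    qed
    have "P *v x = normal_projection p *v x" for x
    proof -
      have "p \<bullet> (x - (p \<bullet> x) *\<^sub>R p) = 0" using p(1) by (simp add: inner_diff_right dot_square_norm)
      from fix_orth[OF this] have "P *v x - (p \<bullet> x) *\<^sub>R (P *v p) = x - (p \<bullet> x) *\<^sub>R p"
        by (simp add: matrix_vector_mult_diff_distrib linear_cmul[OF matrix_vector_mul_linear[of P]])
      then show ?thesis using p(1) by (simp add: Pp normal_projection_mult)
    qed
    then have "P = normal_projection p" by (simp add: matrix_eq)
    then show "P \<in> normal_projection ` sphere 0 1" using p(1) by simp
  qed
qed

lemma compact_grassmannian: "compact (grassmannian :: (real ^ 'n ^ 'n::finite) set)"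
  unfolding grassmannian_eq
proof (rule compact_continuous_image)
  show "continuous_on (sphere 0 1) (normal_projection :: real ^ 'n \<Rightarrow> _)"
    unfolding normal_projection_def[abs_def]
    by (intro continuous_intros continuous_on_vec_lambda) auto
qed simp

lemma Cc_on_fst:
  fixes f :: "real ^ 'n::finite \<Rightarrow> real"
  assumes f: "continuous_on UNIV f" "compactly_supported_in f \<Omega>"
  shows "(\<lambda>z. f (fst z)) \<in> Cc_on (\<Omega> \<times> (grassmannian :: (real ^ 'n ^ 'n) set))"
proof -
  note s = compactly_supported_inD[OF f(2)]
  let ?G = "grassmannian :: (real ^ 'n ^ 'n) set"
  show ?thesis unfolding Cc_on_def
  proof (intro CollectI conjI exI[of _ "closure {x. f x \<noteq> 0} \<times> ?G"])
    show "continuous_on (\<Omega> \<times> ?G) (\<lambda>z. f (fst z))"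
      by (rule continuous_on_compose2[OF f(1)]) (auto intro: continuous_intros)
    show "compact (closure {x. f x \<noteq> 0} \<times> ?G)"
      by (rule compact_Times[OF s(3) compact_grassmannian])
    show "closure {x. f x \<noteq> 0} \<times> ?G \<subseteq> \<Omega> \<times> ?G"
      by (rule Sigma_mono[OF s(4) order_refl])
    show "\<forall>z\<in>\<Omega> \<times> ?G - closure {x. f x \<noteq> 0} \<times> ?G. f (fst z) = 0"
    proof
      fix z assume "z \<in> \<Omega> \<times> ?G - closure {x. f x \<noteq> 0} \<times> ?G"
      then have "fst z \<notin> closure {x. f x \<noteq> 0}" by auto
      then show "f (fst z) = 0" using closure_subset[of "{x. f x \<noteq> 0}"] by blast
    qed
  qed
qed

section \<open>Comparison of the energy with the mass of the associated varifold\<close>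

lemma energy_density_integrable:
  fixes u :: "real ^ 'n::finite \<Rightarrow> real"
  assumes \<Omega>: "open \<Omega>" and u: "u \<in> W12 \<Omega>" and \<epsilon>: "0 < \<epsilon>" and J: "J \<Omega> \<epsilon> u \<le> ennreal C" "0 \<le> C"
  shows "integrable lebesgue (\<lambda>x. indicator \<Omega> x * energy_density \<Omega> \<epsilon> u x)"
    "(\<integral>x. indicator \<Omega> x * energy_density \<Omega> \<epsilon> u x \<partial>lebesgue) \<le> C"
proof -
  have \<Omega>l: "\<Omega> \<inter> space lebesgue \<in> sets lebesgue" using \<Omega> by simp
  have gm: "weak_grad \<Omega> u \<in> borel_measurable (restrict_space lebesgue \<Omega>)"
    using open_locally_integrable_measurable[OF \<Omega>] is_weak_grad_weak_grad[OF u] unfolding is_weak_grad_def by blast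
  have um: "u \<in> borel_measurable (restrict_space lebesgue \<Omega>)"
    using u open_locally_integrable_measurable[OF \<Omega>] unfolding W12_def by blast
  have "energy_density \<Omega> \<epsilon> u \<in> borel_measurable (restrict_space lebesgue \<Omega>)"
    unfolding energy_density_def[abs_def] using gm um by measurable
  then have m: "(\<lambda>x. indicator \<Omega> x * energy_density \<Omega> \<epsilon> u x) \<in> borel_measurable lebesgue"
    using borel_measurable_restrict_space_iff[OF \<Omega>l, of "energy_density \<Omega> \<epsilon> u"] by simp
  have nn: "0 \<le> indicator \<Omega> x * energy_density \<Omega> \<epsilon> u x" for x
    using \<epsilon> by (simp add: energy_density_def)
  have "(\<integral>\<^sup>+x. ennreal (indicator \<Omega> x * energy_density \<Omega> \<epsilon> u x) \<partial>lebesgue) = J \<Omega> \<epsilon> u"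
    unfolding J_def by (intro nn_integral_cong) (auto simp: indicator_def)
  then have le: "(\<integral>\<^sup>+x. ennreal (indicator \<Omega> x * energy_density \<Omega> \<epsilon> u x) \<partial>lebesgue) \<le> ennreal C" using J(1) by simp
  show i: "integrable lebesgue (\<lambda>x. indicator \<Omega> x * energy_density \<Omega> \<epsilon> u x)"
    using nn le by (intro integrableI_nonneg[OF m]) (auto intro: le_less_trans)
  have "ennreal (\<integral>x. indicator \<Omega> x * energy_density \<Omega> \<epsilon> u x \<partial>lebesgue) \<le> ennreal C"
    using nn_integral_eq_integral[OF i] nn le by simp
  then show "(\<integral>x. indicator \<Omega> x * energy_density \<Omega> \<epsilon> u x \<partial>lebesgue) \<le> C" using J(2) by (simp add: ennreal_le_iff)
qed

lemma integral_assoc_varifold_fst: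
  fixes u :: "real ^ 'n::finite \<Rightarrow> real"
  assumes \<Omega>: "open \<Omega>" and u: "u \<in> W12 \<Omega>" and \<epsilon>: "0 < \<epsilon>"
    and f: "continuous_on UNIV f" "compactly_supported_in f \<Omega>"
  shows "(\<integral>z. f (fst z) \<partial>assoc_varifold \<Omega> \<epsilon> u) =
    (\<integral>x. indicator {x \<in> \<Omega>. weak_grad \<Omega> u x \<noteq> 0} x * (f x * (indicator \<Omega> x * energy_density \<Omega> \<epsilon> u x)) \<partial>lebesgue)"
  unfolding integral_assoc_varifold[OF \<Omega> u \<epsilon> Cc_on_fst[OF f]] set_lebesgue_integral_def
  by (intro Bochner_Integration.integral_cong refl) (auto simp: energy_density_def indicator_def)

text \<open>The varifold integrates the density only where the gradient is nonzero, so its mass does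
  not exceed the energy.\<close>

lemma assoc_varifold_le_J:
  fixes u :: "real ^ 'n::finite \<Rightarrow> real"
  assumes \<Omega>: "open \<Omega>" and u: "u \<in> W12 \<Omega>" and \<epsilon>: "0 < \<epsilon>" and J: "J \<Omega> \<epsilon> u \<le> ennreal C" "0 \<le> C"
    and f: "continuous_on UNIV f" "compactly_supported_in f \<Omega>" "\<And>x. 0 \<le> f x \<and> f x \<le> 1"
  shows "(\<integral>z. f (fst z) \<partial>assoc_varifold \<Omega> \<epsilon> u) \<le> C"
proof -
  note e = energy_density_integrable[OF \<Omega> u \<epsilon> J]
  have nn: "0 \<le> indicator \<Omega> x * energy_density \<Omega> \<epsilon> u x" for x using \<epsilon> by (simp add: energy_density_def)
  have "(\<integral>z. f (fst z) \<partial>assoc_varifold \<Omega> \<epsilon> u) \<le> (\<integral>x. indicator \<Omega> x * energy_density \<Omega> \<epsilon> u x \<partial>lebesgue)"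
    unfolding integral_assoc_varifold_fst[OF \<Omega> u \<epsilon> f(1,2)]
  proof (rule Bochner_Integration.integral_mono'[OF e(1) _ nn])
    fix x
    have "f x * (indicator \<Omega> x * energy_density \<Omega> \<epsilon> u x) \<le> 1 * (indicator \<Omega> x * energy_density \<Omega> \<epsilon> u x)"
      using f(3)[of x] nn[of x] by (intro mult_right_mono) auto
    then show "indicator {x \<in> \<Omega>. weak_grad \<Omega> u x \<noteq> 0} x * (f x * (indicator \<Omega> x * energy_density \<Omega> \<epsilon> u x))
      \<le> indicator \<Omega> x * energy_density \<Omega> \<epsilon> u x"
      using nn[of x] by (cases "x \<in> {x \<in> \<Omega>. weak_grad \<Omega> u x \<noteq> 0}") auto
  qed
  also have "\<dots> \<le> C" by (rule e(2))
  finally show ?thesis .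
qed

lemma weak_grad_divergence:
  fixes u :: "real ^ 'n::finite \<Rightarrow> real"
  assumes \<Omega>: "open \<Omega>" and g: "is_weak_grad \<Omega> u g" and u: "locally_integrable_on u \<Omega>"
    and p: "Ck_on 1 \<phi> UNIV" "compactly_supported_in \<phi> \<Omega>"
  shows "set_lebesgue_integral lebesgue \<Omega> (\<lambda>x. u x * divergence \<phi> x) = - set_lebesgue_integral lebesgue \<Omega> (\<lambda>x. g x \<bullet> \<phi> x)"
    "set_integrable lebesgue \<Omega> (\<lambda>x. g x \<bullet> \<phi> x)"
proof -
  note s = compactly_supported_inD[OF p(2)]
  let ?C = "closure {x. \<phi> x \<noteq> 0}"
  have pi: "Ck_on 1 (\<lambda>x. \<phi> x $ i) UNIV" for i by (rule Ck_on_bounded_linear[OF bounded_linear_vec_nth p(1)])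
  have csub: "{x. \<phi> x $ i \<noteq> 0} \<subseteq> ?C" for i using closure_subset[of "{x. \<phi> x \<noteq> 0}"] by auto
  have ci: "compactly_supported_in (\<lambda>x. \<phi> x $ i) \<Omega>" for i
    by (rule compactly_supported_inI[OF csub s(3,4)])
  have i: "set_integrable lebesgue \<Omega> (\<lambda>x. k x * h x)"
    if k: "locally_integrable_on k \<Omega>" and h: "continuous_on UNIV h" "{x. h x \<noteq> 0} \<subseteq> ?C" for k h :: "real ^ 'n \<Rightarrow> real"
  proof -
    obtain B where "\<And>x. norm (h x) \<le> B"
      using bounded_range_bounded_support[OF h(1) bounded_subset[OF compact_imp_bounded[OF s(3)] h(2)]] by blast
    then have B: "\<bar>h x\<bar> \<le> B" for x by simp
    have "set_integrable lebesgue ?C k" using k s(3,4) by (simp add: locally_integrable_on_def)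
    then show ?thesis by (rule test_integral_bound(1)[OF _ h(1) B h(2) s(4)])
  qed
  have c1: "continuous_on UNIV (\<lambda>x. \<phi> x $ i)" for i by (rule Ck_on_imp_continuous[OF pi])
  have c2: "continuous_on UNIV (partial i (\<lambda>x. \<phi> x $ i))" for i using Ck_on_partial[of 0 "\<lambda>x. \<phi> x $ i" i] pi by simp
  have "{x. partial i (\<lambda>x. \<phi> x $ i) x \<noteq> 0} \<subseteq> ?C" for i
    using partial_support closure_minimal[OF csub closed_closure] by (rule order_trans)
  note i1 = i[OF u c2 this]
  note i2 = i[OF locally_integrable_component[OF conjunct1[OF g[unfolded is_weak_grad_def]]] c1 csub]
  have sumI: "set_lebesgue_integral lebesgue \<Omega> (\<lambda>x. \<Sum>i\<in>UNIV. F i x) = (\<Sum>i\<in>UNIV. set_lebesgue_integral lebesgue \<Omega> (F i))"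
    "set_integrable lebesgue \<Omega> (\<lambda>x. \<Sum>i\<in>UNIV. F i x)"
    if "\<And>i. set_integrable lebesgue \<Omega> (F i)" for F :: "'n \<Rightarrow> real ^ 'n \<Rightarrow> real"
  proof -
    have F: "integrable lebesgue (\<lambda>x. indicator \<Omega> x *\<^sub>R F i x)" for i
      using that by (simp only: set_integrable_def)
    show "set_lebesgue_integral lebesgue \<Omega> (\<lambda>x. \<Sum>i\<in>UNIV. F i x) = (\<Sum>i\<in>UNIV. set_lebesgue_integral lebesgue \<Omega> (F i))"
      unfolding set_lebesgue_integral_def scaleR_sum_right by (rule Bochner_Integration.integral_sum) (rule F)
    show "set_integrable lebesgue \<Omega> (\<lambda>x. \<Sum>i\<in>UNIV. F i x)"
      unfolding set_integrable_def scaleR_sum_right by (rule Bochner_Integration.integrable_sum) (rule F)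
  qed
  show "set_integrable lebesgue \<Omega> (\<lambda>x. g x \<bullet> \<phi> x)"
    unfolding inner_vec_def inner_real_def by (rule sumI(2)[OF i2])
  show "set_lebesgue_integral lebesgue \<Omega> (\<lambda>x. u x * divergence \<phi> x) = - set_lebesgue_integral lebesgue \<Omega> (\<lambda>x. g x \<bullet> \<phi> x)"
    unfolding inner_vec_def inner_real_def divergence_def sum_distrib_left sumI(1)[OF i1] sumI(1)[OF i2]
    by (simp add: weak_grad_C1_test[OF g u \<Omega> pi ci] sum_negf)
qed

lemma assoc_varifold_lower_bound:
  fixes u :: "real ^ 'n::finite \<Rightarrow> real"
  assumes \<Omega>: "open \<Omega>" and u: "u \<in> W12 \<Omega>" and cs: "classical_solution \<Omega> \<epsilon> u" and \<epsilon>: "0 < \<epsilon>"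
    and J: "J \<Omega> \<epsilon> u \<le> ennreal C" "0 \<le> C"
    and p: "Ck_on 1 \<phi> UNIV" "compactly_supported_in \<phi> \<Omega>"
  shows "2 * set_lebesgue_integral lebesgue \<Omega> (\<lambda>x. u x * divergence \<phi> x) \<le> (\<integral>z. norm (\<phi> (fst z)) \<partial>assoc_varifold \<Omega> \<epsilon> u)"
proof -
  define g where "g = weak_grad \<Omega> u"
  have g: "is_weak_grad \<Omega> u g" unfolding g_def by (rule is_weak_grad_weak_grad[OF u])
  have ul: "locally_integrable_on u \<Omega>" using u by (simp add: W12_def)
  note wd = weak_grad_divergence[OF \<Omega> g ul p]
  note s = compactly_supported_inD[OF p(2)]
  have cp: "continuous_on UNIV (\<lambda>x. norm (\<phi> x))" by (intro continuous_on_norm Ck_on_imp_continuous[OF p(1)])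
  have cn: "compactly_supported_in (\<lambda>x. norm (\<phi> x)) \<Omega>" using p(2) by (simp add: compactly_supported_in_def)
  note e = energy_density_integrable[OF \<Omega> u \<epsilon> J]
  have nn: "0 \<le> indicator \<Omega> x * energy_density \<Omega> \<epsilon> u x" for x using \<epsilon> by (simp add: energy_density_def)
  let ?S = "{x \<in> \<Omega>. g x \<noteq> 0}"
  let ?R = "\<lambda>x. indicator ?S x * (norm (\<phi> x) * (indicator \<Omega> x * energy_density \<Omega> \<epsilon> u x))"
  obtain B where B: "0 < B" "\<And>x. norm (norm (\<phi> x)) \<le> B"
    using bounded_range_bounded_support[OF cp] s(1) by auto
  have [measurable]: "(\<lambda>x. norm (\<phi> x)) \<in> borel_measurable lebesgue"
    using borel_measurable_continuous_onI[OF cp] by (intro measurable_completion) auto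
  have gm: "g \<in> borel_measurable (restrict_space lebesgue \<Omega>)"
    using open_locally_integrable_measurable[OF \<Omega>] g unfolding is_weak_grad_def by blast
  have "{x \<in> space (restrict_space lebesgue \<Omega>). g x \<noteq> 0} \<in> sets (restrict_space lebesgue \<Omega>)"
    using gm by measurable
  then have [measurable]: "?S \<in> sets lebesgue"
    using \<Omega> by (auto simp: space_restrict_space sets_restrict_space_iff)
  have Ri: "integrable lebesgue ?R"
  proof (rule Bochner_Integration.integrable_bound)
    show "integrable lebesgue (\<lambda>x. B * (indicator \<Omega> x * energy_density \<Omega> \<epsilon> u x))" using e(1) by (rule integrable_mult_right)
    show "AE x in lebesgue. norm (?R x) \<le> norm (B * (indicator \<Omega> x * energy_density \<Omega> \<epsilon> u x))"
    proof (intro AE_I2)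
      fix x
      have "norm (\<phi> x) * (indicator \<Omega> x * energy_density \<Omega> \<epsilon> u x) \<le> B * (indicator \<Omega> x * energy_density \<Omega> \<epsilon> u x)"
        using B(2)[of x] nn[of x] by (intro mult_right_mono) auto
      moreover have "0 \<le> norm (\<phi> x) * (indicator \<Omega> x * energy_density \<Omega> \<epsilon> u x)" by (rule mult_nonneg_nonneg[OF norm_ge_zero nn])
      ultimately show "norm (?R x) \<le> norm (B * (indicator \<Omega> x * energy_density \<Omega> \<epsilon> u x))"
        by (cases "x \<in> ?S") (auto simp: indicator_def)
    qed
  qed (use borel_measurable_integrable[OF e(1)] in measurable)
  have gi: "integrable lebesgue (\<lambda>x. indicator \<Omega> x *\<^sub>R (g x \<bullet> \<phi> x))" using wd(2) by (simp add: set_integrable_def)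
  have "2 * set_lebesgue_integral lebesgue \<Omega> (\<lambda>x. u x * divergence \<phi> x) = (\<integral>x. - 2 * (indicator \<Omega> x *\<^sub>R (g x \<bullet> \<phi> x)) \<partial>lebesgue)"
    unfolding wd(1) unfolding set_lebesgue_integral_def by simp
  also have "\<dots> \<le> (\<integral>x. ?R x \<partial>lebesgue)"
  proof (rule integral_mono_AE[OF _ Ri])
    show "integrable lebesgue (\<lambda>x. - 2 * (indicator \<Omega> x *\<^sub>R (g x \<bullet> \<phi> x)))" using gi by (rule integrable_mult_right)
    show "AE x in lebesgue. - 2 * (indicator \<Omega> x *\<^sub>R (g x \<bullet> \<phi> x)) \<le> ?R x"
      using classical_solution_weak_grad_0[OF \<Omega> cs g]
    proof eventually_elim
      case (elim x)
      show ?case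
      proof (cases "x \<in> ?S")
        case True
        then have "\<bar>u x\<bar> < 1" using elim by simp
        then have ed: "energy_density \<Omega> \<epsilon> u x = \<epsilon> * (norm (g x))\<^sup>2 + 1 / \<epsilon>"
          by (simp add: energy_density_def g_def abs_less_iff minus_less_iff)
        \<comment> \<open>Equality holds at slope 1/\<epsilon>, the value for which the recovery
          sequence is calibrated.\<close>
        have "0 \<le> \<epsilon> * (norm (g x) - 1 / \<epsilon>)\<^sup>2" using \<epsilon> by simp
        moreover have "\<epsilon> * (norm (g x) - 1 / \<epsilon>)\<^sup>2 = \<epsilon> * (norm (g x))\<^sup>2 - 2 * norm (g x) + 1 / \<epsilon>"
          using \<epsilon> by (simp add: power2_eq_square field_simps)
        ultimately have "2 * norm (g x) \<le> \<epsilon> * (norm (g x))\<^sup>2 + 1 / \<epsilon>" by linarith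
        from mult_right_mono[OF this, of "norm (\<phi> x)"]
        have "2 * (norm (g x) * norm (\<phi> x)) \<le> norm (\<phi> x) * energy_density \<Omega> \<epsilon> u x" by (simp add: ed mult_ac)
        moreover have "- (g x \<bullet> \<phi> x) \<le> norm (g x) * norm (\<phi> x)" using Cauchy_Schwarz_ineq2[of "g x" "\<phi> x"] by linarith
        ultimately show ?thesis using True by simp
      next
        case False
        then have z0: "indicator \<Omega> x *\<^sub>R (g x \<bullet> \<phi> x) = 0" by (auto simp: indicator_def)
        show ?thesis unfolding z0 using False by simp
      qed
    qed
  qed
  also have "\<dots> = (\<integral>z. norm (\<phi> (fst z)) \<partial>assoc_varifold \<Omega> \<epsilon> u)"
    unfolding integral_assoc_varifold_fst[OF \<Omega> u \<epsilon> cp cn] g_def ..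
  finally show ?thesis .
qed

section \<open>The perimeter measure\<close>

text \<open>Almost everywhere the indicator equals (u0 + 1)/2, and the constant contributes nothing
  because the divergence of a compactly supported field has integral zero.\<close>

lemma variation_indicator_level:
  fixes u0 :: "real ^ 'n::finite \<Rightarrow> real"
  assumes \<Omega>: "open \<Omega>" "bounded \<Omega>" and u0: "u0 \<in> BV_pm1 \<Omega>" and U: "open U" "U \<subseteq> \<Omega>"
  shows "variation U (indicator {x \<in> \<Omega>. u0 x = 1}) = ennreal (1 / 2) * variation U u0"
proof -
  let ?E = "{x \<in> \<Omega>. u0 x = 1}"
  have ui: "set_integrable lebesgue \<Omega> u0" and pm: "AE x in lebesgue. x \<in> \<Omega> \<longrightarrow> u0 x \<in> {-1, 1}"
    using u0 by (auto simp: BV_pm1_def BV_def)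
  have \<Omega>b: "\<Omega> \<in> sets borel" using \<Omega>(1) by simp
  have c: "set_integrable lebesgue \<Omega> (\<lambda>x. 1 :: real)"
    by (rule set_integrable_continuous_bounded(1)[OF continuous_on_const \<Omega>(2) \<Omega>b])
  have hi: "set_integrable lebesgue \<Omega> (\<lambda>x. (u0 x + 1) / 2)"
    using set_integral_add(1)[OF ui c] by simp
  have ae: "AE x in lebesgue. x \<in> \<Omega> \<longrightarrow> indicator ?E x = (u0 x + 1) / 2"
    using pm by eventually_elim (auto simp: indicator_def)
  have Ei: "set_integrable lebesgue \<Omega> (indicator ?E :: _ \<Rightarrow> real)"
  proof -
    have m: "(\<lambda>x. indicator \<Omega> x *\<^sub>R u0 x) \<in> borel_measurable lebesgue"
      using ui by (auto simp: set_integrable_def dest: borel_measurable_integrable)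
    have "?E = {x \<in> space lebesgue. indicator \<Omega> x *\<^sub>R u0 x = 1}" by (auto simp: indicator_def)
    also have "\<dots> \<in> sets lebesgue" using m by measurable
    finally have E: "?E \<in> sets lebesgue" .
    have "integrable lebesgue (\<lambda>x. indicator ?E x *\<^sub>R (indicator \<Omega> x *\<^sub>R (1::real)))"
      by (rule integrable_mult_indicator[OF E c[unfolded set_integrable_def]])
    moreover have "indicator ?E x *\<^sub>R (indicator \<Omega> x *\<^sub>R (1::real)) = indicator \<Omega> x *\<^sub>R indicator ?E x" for x by simp
    ultimately show ?thesis unfolding set_integrable_def by (simp only:)
  qed
  have Ul: "U \<in> sets lebesgue" using U(1) by simp
  have key: "set_lebesgue_integral lebesgue U (\<lambda>x. indicator ?E x * divergence \<phi> x) =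
      1 / 2 * set_lebesgue_integral lebesgue U (\<lambda>x. u0 x * divergence \<phi> x)" if t: "test_field U \<phi>" for \<phi>
  proof -
    note tD = test_fieldD[OF t]
    note s = compactly_supported_inD[OF tD(2)]
    obtain B where "\<And>x. norm (divergence \<phi> x) \<le> B" using bounded_range_bounded_support[OF tD(5,8)] by blast
    then have B: "\<bar>divergence \<phi> x\<bar> \<le> B" for x by simp
    have CU: "closure {x. \<phi> x \<noteq> 0} \<subseteq> U" "closure {x. \<phi> x \<noteq> 0} \<in> sets lebesgue" using s(4) by auto
    have sub: "set_integrable lebesgue (closure {x. \<phi> x \<noteq> 0}) k" if "set_integrable lebesgue \<Omega> k" for k :: "real ^ 'n \<Rightarrow> real"
      using that CU U(2) by (intro set_integrable_subset[OF that]) auto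
    have i: "set_integrable lebesgue U (\<lambda>x. k x * divergence \<phi> x)" if "set_integrable lebesgue \<Omega> k" for k :: "real ^ 'n \<Rightarrow> real"
      by (rule test_integral_bound(1)[OF sub[OF that] tD(5) B tD(6) CU(1)])
    have 0: "set_lebesgue_integral lebesgue U (\<lambda>x. 1 * divergence \<phi> x) = 0"
    proof -
      have g0: "grad (\<lambda>x. 1) = (\<lambda>x. 0 :: real ^ 'n)" by (rule ext, rule grad_eqI) simp
      have "set_lebesgue_integral lebesgue U (\<lambda>x. 1 * divergence \<phi> x) = (\<integral>x. 1 * divergence \<phi> x \<partial>lborel)"
        by (rule set_integral_lborel) (use borel_measurable_continuous_onI[OF tD(5)] tD(9) in auto)
      also have "\<dots> = - (\<integral>x. grad (\<lambda>x. 1) x \<bullet> \<phi> x \<partial>lborel)" by (rule integral_divergence_by_parts(1)[OF Ck_on_const tD(1,7)])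
      finally show ?thesis by (simp add: g0)
    qed
    have "set_lebesgue_integral lebesgue U (\<lambda>x. indicator ?E x * divergence \<phi> x) =
        set_lebesgue_integral lebesgue U (\<lambda>x. (u0 x + 1) / 2 * divergence \<phi> x)"
      by (rule set_integral_cong_AE_test[OF Ei hi ae U(2) Ul tD(5)])
    also have "\<dots> = set_lebesgue_integral lebesgue U (\<lambda>x. 1 / 2 * (u0 x * divergence \<phi> x + 1 * divergence \<phi> x))"
      by (simp add: field_simps)
    also have "\<dots> = 1 / 2 * set_lebesgue_integral lebesgue U (\<lambda>x. u0 x * divergence \<phi> x + 1 * divergence \<phi> x)"
      by (rule set_integral_mult_right)
    also have "\<dots> = 1 / 2 * set_lebesgue_integral lebesgue U (\<lambda>x. u0 x * divergence \<phi> x)"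
      using set_integral_add(2)[OF i[OF ui] i[OF c]] 0 by simp
    finally show ?thesis .
  qed
  have ne: "{\<phi>. test_field U \<phi>} \<noteq> {}"
  proof -
    have "test_field U (\<lambda>x. 0)" by (simp add: test_field_def compactly_supported_in_def del: Ck_on.simps One_nat_def)
    then show ?thesis by blast
  qed
  have "variation U (indicator ?E) =
    (SUP \<phi>\<in>{\<phi>. test_field U \<phi>}. ennreal (1 / 2) * ennreal (set_lebesgue_integral lebesgue U (\<lambda>x. u0 x * divergence \<phi> x)))"
    unfolding variation_eq_SUP_test_field by (intro SUP_cong refl) (simp only: mem_Collect_eq key ennreal_mult')
  also have "\<dots> = ennreal (1 / 2) * variation U u0"
    unfolding variation_eq_SUP_test_field by (rule SUP_mult_left_ennreal[symmetric])
  finally show ?thesis .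
qed

lemma set_integral_superset:
  fixes h :: "'a::euclidean_space \<Rightarrow> real"
  assumes "\<And>x. x \<notin> U \<Longrightarrow> h x = 0" "U \<subseteq> \<Omega>"
  shows "set_lebesgue_integral lebesgue \<Omega> h = set_lebesgue_integral lebesgue U h"
proof -
  have "indicator \<Omega> x *\<^sub>R h x = indicator U x *\<^sub>R h x" for x using assms by (auto simp: indicator_def)
  then show ?thesis unfolding set_lebesgue_integral_def by (simp only:)
qed

text \<open>Splitting a test field on \<open>\<Omega>\<close> by cutoffs of \<open>U\<close> bounds the variation in \<open>\<Omega>\<close> by that in \<open>U\<close> plus
  \<open>\<mu>(\<Omega> - U) / 2\<close>; this turns the upper bound for the total mass into one for \<open>\<mu> U\<close>.\<close>

lemma weight_eq_variation:
  fixes u0 :: "real ^ 'n::finite \<Rightarrow> real" and \<mu> :: "(real ^ 'n) measure"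
  assumes \<Omega>: "open \<Omega>" and \<mu>: "sets \<mu> = sets (restrict_space borel \<Omega>)"
    and fin: "emeasure \<mu> \<Omega> \<le> 2 * variation \<Omega> u0" "variation \<Omega> u0 < \<infinity>"
    and u0: "set_integrable lebesgue \<Omega> u0"
    and low: "\<And>\<phi>. Ck_on 1 \<phi> UNIV \<Longrightarrow> compactly_supported_in \<phi> \<Omega> \<Longrightarrow>
      2 * set_lebesgue_integral lebesgue \<Omega> (\<lambda>x. u0 x * divergence \<phi> x) \<le> (\<integral>x. norm (\<phi> x) \<partial>\<mu>)"
    and U: "open U" "U \<subseteq> \<Omega>"
  shows "2 * variation U u0 = emeasure \<mu> U"
proof -
  have sp: "space \<mu> = \<Omega>" using sets_eq_imp_space_eq[OF \<mu>] by (simp add: space_restrict_space)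
  have sets_open: "W \<in> sets \<mu>" if "open W" "W \<subseteq> \<Omega>" for W
    unfolding \<mu> using that \<Omega> by (simp add: sets_restrict_space_iff)
  have meas: "f \<in> borel_measurable \<mu>" if "continuous_on UNIV f" for f :: "real ^ 'n \<Rightarrow> real"
    unfolding measurable_cong_sets[OF \<mu> refl]
    using borel_measurable_continuous_onI[OF that] by (rule measurable_restrict_space1)
  have "emeasure \<mu> \<Omega> < \<infinity>" using fin by (auto intro!: le_less_trans[OF fin(1)] simp: ennreal_mult_less_top)
  then interpret \<mu>: finite_measure \<mu> by (intro finite_measureI) (simp add: sp)
  have int: "integrable \<mu> f" if "continuous_on UNIV f" "\<And>x. 0 \<le> f x \<and> f x \<le> 1" for f :: "real ^ 'n \<Rightarrow> real"
    using that by (intro \<mu>.integrable_const_bound[of _ 1] meas) auto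
  \<comment> \<open>The lower bound localizes: a field of norm at most 1 supported in
    \<open>W\<close> has norm at most the indicator of \<open>W\<close>.\<close>
  have W: "variation W u0 \<le> ennreal (measure \<mu> W / 2)" if W: "open W" "W \<subseteq> \<Omega>" for W
  proof (rule variation_leI)
    fix \<phi> assume t: "test_field W \<phi>"
    note tD = test_fieldD[OF t]
    have cs: "compactly_supported_in \<phi> \<Omega>" using tD(2) W(2) by (auto simp: compactly_supported_in_def)
    have "2 * set_lebesgue_integral lebesgue W (\<lambda>x. u0 x * divergence \<phi> x) = 2 * set_lebesgue_integral lebesgue \<Omega> (\<lambda>x. u0 x * divergence \<phi> x)"
      using set_integral_superset[OF _ W(2), of "\<lambda>x. u0 x * divergence \<phi> x"] tD(9) by force
    also have "\<dots> \<le> (\<integral>x. norm (\<phi> x) \<partial>\<mu>)" by (rule low[OF tD(1) cs])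
    also have "\<dots> \<le> (\<integral>x. indicator W x \<partial>\<mu>)"
    proof (rule integral_mono)
      show "integrable \<mu> (\<lambda>x. norm (\<phi> x))" using tD(3,4) by (intro int continuous_intros) auto
      show "integrable \<mu> (indicator W :: _ \<Rightarrow> real)" using sets_open[OF W] \<mu>.emeasure_finite[of W] by (intro integrable_real_indicator) (simp_all add: less_top[symmetric])
      show "norm (\<phi> x) \<le> indicator W x" for x
        using tD(3)[of x] compactly_supported_inD(2)[OF tD(2)] by (cases "x \<in> W") auto
    qed
    also have "\<dots> = measure \<mu> W" using W(2) sp by (simp add: Int_absorb2)
    finally show "set_lebesgue_integral lebesgue W (\<lambda>x. u0 x * divergence \<phi> x) \<le> measure \<mu> W / 2" by simp
  qed
  have two: "2 * ennreal D = ennreal (2 * D)" if "0 \<le> D" for D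
    using ennreal_mult[of 2 D] that by simp
  define mU where "mU = enn2real (variation U u0)"
  have "variation U u0 < \<infinity>" using W[OF U] by (rule le_less_trans) simp
  then have mU: "variation U u0 = ennreal mU" "0 \<le> mU" by (simp_all add: mU_def)
  have mUle: "mU \<le> measure \<mu> U / 2" using W[OF U] by (simp add: mU ennreal_le_iff)
  obtain \<theta> where \<theta>: "\<And>n::nat. smooth_on (\<theta> n) UNIV" "\<And>n. compactly_supported_in (\<theta> n) U"
    "\<And>n x. 0 \<le> \<theta> n x \<and> \<theta> n x \<le> 1" "\<And>x. (\<lambda>n. \<theta> n x) \<longlonglongrightarrow> (indicator U x :: real)"
    using smooth_cutoff_sequence[OF U(1)] by blast
  have \<theta>1: "Ck_on 1 (\<theta> n) UNIV" for n by (rule smooth_on_imp_Ck[OF \<theta>(1)])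
  have \<theta>c: "continuous_on UNIV (\<theta> n)" for n by (rule Ck_on_imp_continuous[OF \<theta>1])
  have lim: "(\<lambda>n. \<integral>x. 1 - \<theta> n x \<partial>\<mu>) \<longlonglongrightarrow> (\<integral>x. 1 - indicator U x \<partial>\<mu>)"
  proof (rule integral_dominated_convergence[where w = "\<lambda>x. 1"])
    show "AE x in \<mu>. (\<lambda>n. 1 - \<theta> n x) \<longlonglongrightarrow> 1 - indicator U x" by (intro AE_I2 tendsto_intros \<theta>(4))
    show "(\<lambda>x. 1 - indicator U x :: real) \<in> borel_measurable \<mu>" using sets_open[OF U] by measurable
    show "(\<lambda>x. 1 - \<theta> n x) \<in> borel_measurable \<mu>" for n by (intro meas continuous_intros \<theta>c)
  qed (use \<theta>(3) in auto)
  have "(\<integral>x. 1 - indicator U x \<partial>\<mu>) = (\<integral>x. indicator (\<Omega> - U) x \<partial>\<mu>)"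
    by (rule Bochner_Integration.integral_cong) (auto simp: sp indicator_def)
  also have "\<dots> = measure \<mu> (\<Omega> - U)" by (simp add: sp Int_absorb2 Diff_subset)
  also have "\<dots> = measure \<mu> \<Omega> - measure \<mu> U"
    using \<mu>.finite_measure_compl[OF sets_open[OF U]] by (simp add: sp)
  finally have lim': "(\<lambda>n. mU + (\<integral>x. 1 - \<theta> n x \<partial>\<mu>) / 2) \<longlonglongrightarrow> mU + (measure \<mu> \<Omega> - measure \<mu> U) / 2"
    using lim by (intro tendsto_intros) simp_all
  have "variation \<Omega> u0 \<le> ennreal (mU + (measure \<mu> \<Omega> - measure \<mu> U) / 2)"
  proof (rule variation_leI)
    fix \<phi> assume t: "test_field \<Omega> \<phi>"
    note tD = test_fieldD[OF t]
    have "set_lebesgue_integral lebesgue \<Omega> (\<lambda>x. u0 x * divergence \<phi> x) \<le> mU + (\<integral>x. 1 - \<theta> n x \<partial>\<mu>) / 2" for n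
    proof -
      \<comment> \<open>The piece supported in \<open>U\<close> is charged to the variation in
        \<open>U\<close>, the other to \<mu> through 1 - \<theta>_n, which tends to the indicator of
        the complement of \<open>U\<close>.\<close>
      define p1 where "p1 = (\<lambda>x. \<theta> n x *\<^sub>R \<phi> x)"
      define p2 where "p2 = (\<lambda>x. (1 - \<theta> n x) *\<^sub>R \<phi> x)"
      have c1: "Ck_on 1 p1 UNIV" "Ck_on 1 p2 UNIV" unfolding p1_def p2_def
        by (intro Ck_on_scaleR Ck_on_diff Ck_on_const \<theta>1 tD(1))+
      note s = compactly_supported_inD[OF \<theta>(2), of n] and s\<phi> = compactly_supported_inD[OF tD(2)]
      have cs1: "compactly_supported_in p1 U"
      proof (rule compactly_supported_inI[OF _ s(3,4)])
        show "{x. p1 x \<noteq> 0} \<subseteq> closure {x. \<theta> n x \<noteq> 0}" using closure_subset[of "{x. \<theta> n x \<noteq> 0}"] by (auto simp: p1_def)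
      qed
      have cs2: "compactly_supported_in p2 \<Omega>"
      proof (rule compactly_supported_inI[OF _ s\<phi>(3,4)])
        show "{x. p2 x \<noteq> 0} \<subseteq> closure {x. \<phi> x \<noteq> 0}" using closure_subset[of "{x. \<phi> x \<noteq> 0}"] by (auto simp: p2_def)
      qed
      have t1: "test_field U p1" unfolding test_field_def
      proof (intro conjI c1(1) cs1 allI)
        fix x
        have "\<theta> n x * norm (\<phi> x) \<le> 1 * 1" using \<theta>(3)[of n x] tD(3)[of x] by (intro mult_mono) auto
        then show "norm (p1 x) \<le> 1" using \<theta>(3)[of n x] by (simp add: p1_def)
      qed
      note t1D = test_fieldD[OF t1]
      have dv: "divergence \<phi> x = divergence p1 x + divergence p2 x" for x
      proof -
        have "((\<lambda>x. 1 - \<theta> n x) has_derivative (\<lambda>v. 0 - grad (\<theta> n) x \<bullet> v)) (at x)"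
          by (intro has_derivative_diff has_derivative_const has_derivative_grad[OF \<theta>1[unfolded One_nat_def]])
        then have "grad (\<lambda>x. 1 - \<theta> n x) x = - grad (\<theta> n) x" by (intro grad_eqI) simp
        then show ?thesis unfolding p1_def p2_def
          using divergence_scaleR[OF \<theta>1[of n] tD(1), of x] divergence_scaleR[OF Ck_on_diff[OF Ck_on_const \<theta>1[of n]] tD(1), of 1 x]
          by (simp add: algebra_simps)
      qed
      have i: "set_integrable lebesgue \<Omega> (\<lambda>x. u0 x * divergence p x)" if "Ck_on 1 p UNIV" "compactly_supported_in p \<Omega>" for p
      proof -
        have d: "continuous_on UNIV (divergence p)" using Ck_on_divergence[of 0 p] that(1) by simp
        note sp = compactly_supported_inD[OF that(2)]
        have db: "{x. divergence p x \<noteq> 0} \<subseteq> \<Omega>" using divergence_support[of p] sp(4) by blast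
        obtain B where "\<And>x. norm (divergence p x) \<le> B"
          using bounded_range_bounded_support[OF d bounded_subset[OF compact_imp_bounded[OF sp(3)] divergence_support]] by blast
        then have B: "\<bar>divergence p x\<bar> \<le> B" for x by simp
        show ?thesis by (rule test_integral_bound(1)[OF u0 d B db order_refl])
      qed
      have cs1': "compactly_supported_in p1 \<Omega>" using cs1 U(2) by (auto simp: compactly_supported_in_def)
      have "set_lebesgue_integral lebesgue \<Omega> (\<lambda>x. u0 x * divergence \<phi> x) =
        set_lebesgue_integral lebesgue \<Omega> (\<lambda>x. u0 x * divergence p1 x) + set_lebesgue_integral lebesgue \<Omega> (\<lambda>x. u0 x * divergence p2 x)"
        unfolding dv distrib_left by (rule set_integral_add(2)[OF i[OF c1(1) cs1'] i[OF c1(2) cs2]])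
      moreover have "set_lebesgue_integral lebesgue \<Omega> (\<lambda>x. u0 x * divergence p1 x) \<le> mU"
      proof -
        have "set_lebesgue_integral lebesgue \<Omega> (\<lambda>x. u0 x * divergence p1 x) = set_lebesgue_integral lebesgue U (\<lambda>x. u0 x * divergence p1 x)"
          using set_integral_superset[OF _ U(2), of "\<lambda>x. u0 x * divergence p1 x"] t1D(9) by force
        then show ?thesis using test_field_le_variation[OF t1 _ mU(2)] mU(1) by simp
      qed
      moreover have "2 * set_lebesgue_integral lebesgue \<Omega> (\<lambda>x. u0 x * divergence p2 x) \<le> (\<integral>x. 1 - \<theta> n x \<partial>\<mu>)"
      proof (rule order_trans[OF low[OF c1(2) cs2]], rule integral_mono)
        have n2: "norm (p2 x) \<le> 1 - \<theta> n x" for x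
          using mult_left_mono[OF tD(3)[of x], of "1 - \<theta> n x"] \<theta>(3)[of n x] by (simp add: p2_def)
        then show "norm (p2 x) \<le> 1 - \<theta> n x" for x .
        have n3: "norm (p2 x) \<le> 1" for x using n2[of x] \<theta>(3)[of n x] by linarith
        show "integrable \<mu> (\<lambda>x. norm (p2 x))"
          using n3 by (intro int continuous_on_norm Ck_on_imp_continuous[OF c1(2)]) simp
        show "integrable \<mu> (\<lambda>x. 1 - \<theta> n x)" using \<theta>(3) by (intro int continuous_intros \<theta>c) auto
      qed
      ultimately show ?thesis by linarith
    qed
    then show "set_lebesgue_integral lebesgue \<Omega> (\<lambda>x. u0 x * divergence \<phi> x) \<le> mU + (measure \<mu> \<Omega> - measure \<mu> U) / 2"
      by (intro LIMSEQ_le_const[OF lim']) blast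
  qed
  then have "2 * variation \<Omega> u0 \<le> 2 * ennreal (mU + (measure \<mu> \<Omega> - measure \<mu> U) / 2)" by (rule mult_left_mono) simp
  with fin(1) have "emeasure \<mu> \<Omega> \<le> 2 * ennreal (mU + (measure \<mu> \<Omega> - measure \<mu> U) / 2)" by (rule order_trans)
  moreover have mono: "measure \<mu> U \<le> measure \<mu> \<Omega>" using U(2) sets_open[OF \<Omega> order_refl] by (intro \<mu>.finite_measure_mono)
  then have nn: "0 \<le> mU + (measure \<mu> \<Omega> - measure \<mu> U) / 2" using mU(2) by simp
  have "2 * ennreal (mU + (measure \<mu> \<Omega> - measure \<mu> U) / 2) = ennreal (2 * (mU + (measure \<mu> \<Omega> - measure \<mu> U) / 2))"
    by (rule two[OF nn])
  ultimately have "ennreal (measure \<mu> \<Omega>) \<le> ennreal (2 * (mU + (measure \<mu> \<Omega> - measure \<mu> U) / 2))"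
    by (simp add: \<mu>.emeasure_eq_measure)
  then have "measure \<mu> \<Omega> \<le> 2 * (mU + (measure \<mu> \<Omega> - measure \<mu> U) / 2)"
    using ennreal_le_iff[OF mult_nonneg_nonneg[OF zero_le_numeral nn]] by blast
  \<comment> \<open>The finite number \<mu>(\<Omega>) cancels and leaves \<mu>(U) \<le> 2 mU; the
    converse is the local lower bound.\<close>
  then have "2 * mU = measure \<mu> U" using mUle by (simp add: field_simps)
  then show ?thesis using two[OF mU(2)] mU(1) by (simp add: \<mu>.emeasure_eq_measure)
qed

text \<open>For a finite Borel measure \<open>N\<close> agreeing with the variation on open sets,
  the infimum in the definition is computed by outer regularity of \<open>N\<close>. In particular
  that set function is countably additive, so \<open>measure_of\<close> returns it and not its
  default, the zero measure.\<close>

lemma perimeter_measure_eq: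
  fixes N :: "(real ^ 'n::finite) measure"
  assumes \<Omega>: "open \<Omega>" and N: "sets N = sets (restrict_space borel \<Omega>)" "emeasure N \<Omega> < \<infinity>"
    and eq: "\<And>U. open U \<Longrightarrow> U \<subseteq> \<Omega> \<Longrightarrow> variation U (indicator E) = emeasure N U"
  shows "perimeter_measure \<Omega> E = N"
proof -
  have sp: "space N = \<Omega>" using sets_eq_imp_space_eq[OF N(1)] by (simp add: space_restrict_space)
  have id: "(\<lambda>x. x) \<in> N \<rightarrow>\<^sub>M borel"
    unfolding measurable_cong_sets[OF N(1) refl] by (rule measurable_restrict_space1) simp
  \<comment> \<open>The push-forward to the whole space, to which outer regularity applies; open
    sets are intersected with \<Omega> afterwards.\<close>
  let ?M = "distr N borel (\<lambda>x. x)"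
  have emM: "emeasure ?M A = emeasure N (A \<inter> \<Omega>)" if "A \<in> sets borel" for A
    using that by (subst emeasure_distr[OF id]) (simp_all add: sp Int_commute)
  have P: "(INF U \<in> {U. open U \<and> A \<subseteq> U \<and> U \<subseteq> \<Omega>}. variation U (indicator E)) = emeasure N A" if A: "A \<in> sets (restrict_space borel \<Omega>)" for A
  proof -
    have A': "A \<subseteq> \<Omega>" "A \<in> sets borel" using A \<Omega> by (auto simp: sets_restrict_space_iff)
    have "emeasure N A = emeasure ?M A" using A' by (simp add: emM Int_absorb2)
    also have "\<dots> = (INF U\<in>{U. A \<subseteq> U \<and> open U}. emeasure ?M U)"
      using A'(2) N(2) by (intro outer_regular) (auto simp: emM)
    also have "\<dots> = (INF U\<in>{U. A \<subseteq> U \<and> open U}. emeasure N (U \<inter> \<Omega>))"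
      by (intro INF_cong refl) (auto simp: emM)
    also have "\<dots> = (INF U \<in> {U. open U \<and> A \<subseteq> U \<and> U \<subseteq> \<Omega>}. variation U (indicator E))"
    proof (rule INF_eq)
      fix U assume "U \<in> {U. open U \<and> A \<subseteq> U \<and> U \<subseteq> \<Omega>}"
      then show "\<exists>W\<in>{U. A \<subseteq> U \<and> open U}. emeasure N (W \<inter> \<Omega>) \<le> variation U (indicator E)"
        by (intro bexI[of _ U]) (auto simp: eq Int_absorb2)
    next
      fix U assume "U \<in> {U. A \<subseteq> U \<and> open U}"
      then show "\<exists>W\<in>{U. open U \<and> A \<subseteq> U \<and> U \<subseteq> \<Omega>}. variation W (indicator E) \<le> emeasure N (U \<inter> \<Omega>)"
        using A'(1) \<Omega> by (intro bexI[of _ "U \<inter> \<Omega>"]) (auto simp: eq open_Int)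
    qed
    finally show ?thesis by simp
  qed
  have sub: "sets (restrict_space borel \<Omega>) \<subseteq> Pow \<Omega>"
    using sets.space_closed[of "restrict_space borel \<Omega>"] by (simp add: space_restrict_space)
  have "perimeter_measure \<Omega> E = measure_of \<Omega> (sets (restrict_space borel \<Omega>)) (emeasure N)"
    unfolding perimeter_measure_def
  proof (rule measure_of_eq[OF sub])
    fix A assume "A \<in> sigma_sets \<Omega> (sets (restrict_space borel \<Omega>))"
    then have "A \<in> sets (restrict_space borel \<Omega>)"
      using sets.sigma_sets_eq[of "restrict_space borel \<Omega>"] by (simp add: space_restrict_space)
    then show "(INF U \<in> {U. open U \<and> A \<subseteq> U \<and> U \<subseteq> \<Omega>}. variation U (indicator E)) = emeasure N A" by (rule P)
  qed
  also have "\<dots> = N" using measure_of_of_measure[of N] by (simp add: sp N(1))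
  finally show ?thesis .
qed

section \<open>The weight of a varifold\<close>

lemma varifold_fst_measurable:
  fixes V :: "'n::finite varifold"
  assumes "is_varifold \<Omega> V"
  shows "sets V = sets (restrict_space borel (\<Omega> \<times> grassmannian))" "space V = \<Omega> \<times> grassmannian"
    "fst \<in> V \<rightarrow>\<^sub>M restrict_space borel \<Omega>"
proof -
  show 1: "sets V = sets (restrict_space borel (\<Omega> \<times> grassmannian))"
    using assms by (simp add: is_varifold_def radon_measure_on_def)
  show 2: "space V = \<Omega> \<times> grassmannian" using sets_eq_imp_space_eq[OF 1] by (simp add: space_restrict_space)
  have "(fst :: (real ^ 'n) \<times> (real ^ 'n ^ 'n) \<Rightarrow> _) \<in> borel_measurable borel"
    by (intro borel_measurable_continuous_onI continuous_intros)
  then have "fst \<in> borel_measurable V"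
    unfolding measurable_cong_sets[OF 1 refl] by (rule measurable_restrict_space1)
  then show "fst \<in> V \<rightarrow>\<^sub>M restrict_space borel \<Omega>"
    by (intro measurable_restrict_space2) (auto simp: 2)
qed

text \<open>Local finiteness of the weight rests on the compactness of the fibre: the preimage of a
  compact set is its product with the Grassmannian.\<close>

lemma weight_facts:
  fixes V :: "'n::finite varifold"
  assumes V: "is_varifold \<Omega> V"
  shows "sets (weight \<Omega> V) = sets (restrict_space borel \<Omega>)" "space (weight \<Omega> V) = \<Omega>"
    "\<And>K. compact K \<Longrightarrow> K \<subseteq> \<Omega> \<Longrightarrow> emeasure (weight \<Omega> V) K < \<infinity>"
    "\<And>f :: real ^ 'n \<Rightarrow> real. continuous_on UNIV f \<Longrightarrow> (\<integral>x. f x \<partial>weight \<Omega> V) = (\<integral>z. f (fst z) \<partial>V)"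
proof -
  note f = varifold_fst_measurable[OF V]
  show "sets (weight \<Omega> V) = sets (restrict_space borel \<Omega>)" "space (weight \<Omega> V) = \<Omega>"
    by (simp_all add: weight_def space_restrict_space)
  show "emeasure (weight \<Omega> V) K < \<infinity>" if K: "compact K" "K \<subseteq> \<Omega>" for K
  proof -
    have "K = \<Omega> \<inter> K" using K(2) by blast
    then have Ks: "K \<in> sets (restrict_space borel \<Omega>)"
      using borel_compact[OF K(1)] unfolding sets_restrict_space by blast
    have "emeasure (weight \<Omega> V) K = emeasure V (fst -` K \<inter> space V)"
      unfolding weight_def by (rule emeasure_distr[OF f(3) Ks])
    also have "fst -` K \<inter> space V = K \<times> grassmannian" using K(2) by (auto simp: f(2))
    also have "emeasure V (K \<times> grassmannian) < \<infinity>"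
      using V compact_Times[OF K(1) compact_grassmannian] K(2) unfolding is_varifold_def radon_measure_on_def by blast
    finally show ?thesis .
  qed
  show "(\<integral>x. f x \<partial>weight \<Omega> V) = (\<integral>z. f (fst z) \<partial>V)" if "continuous_on UNIV f" for f :: "real ^ 'n \<Rightarrow> real"
    unfolding weight_def
    by (rule integral_distr[OF f(3)]) (rule measurable_restrict_space1[OF borel_measurable_continuous_onI[OF that]])
qed

text \<open>Varifold convergence is tested only with compact supports in \<Omega>; Fatou's lemma
  along cutoffs recovers the mass of all of \<Omega> from the uniform bound.\<close>

lemma weight_le_if_test_integrals_le:
  fixes V :: "'n::finite varifold"
  assumes V: "is_varifold \<Omega> V" and \<Omega>: "open \<Omega>"
    and le: "\<And>f :: real ^ 'n \<Rightarrow> real. continuous_on UNIV f \<Longrightarrow> compactly_supported_in f \<Omega> \<Longrightarrow> (\<And>x. 0 \<le> f x \<and> f x \<le> 1) \<Longrightarrow>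
      (\<integral>x. f x \<partial>weight \<Omega> V) \<le> C"
  shows "emeasure (weight \<Omega> V) \<Omega> \<le> ennreal C"
proof -
  let ?\<mu> = "weight \<Omega> V"
  note w = weight_facts[OF V]
  obtain \<theta> where \<theta>: "\<And>n::nat. smooth_on (\<theta> n) UNIV" "\<And>n. compactly_supported_in (\<theta> n) \<Omega>"
    "\<And>n x. 0 \<le> \<theta> n x \<and> \<theta> n x \<le> 1" "\<And>x. (\<lambda>n. \<theta> n x) \<longlonglongrightarrow> (indicator \<Omega> x :: real)"
    using smooth_cutoff_sequence[OF \<Omega>] by blast
  have \<theta>c: "continuous_on UNIV (\<theta> n)" for n
    using Ck_on_imp_continuous[OF smooth_on_imp_Ck[OF \<theta>(1)]] by blast
  have m: "\<theta> n \<in> borel_measurable ?\<mu>" for n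
    unfolding measurable_cong_sets[OF w(1) refl]
    using borel_measurable_continuous_onI[OF \<theta>c] by (rule measurable_restrict_space1)
  have int: "integrable ?\<mu> (\<theta> n)" for n
  proof (rule integrableI_bounded_set)
    note s = compactly_supported_inD[OF \<theta>(2), of n]
    let ?K = "closure {x. \<theta> n x \<noteq> 0}"
    have "?K = \<Omega> \<inter> ?K" using s(4) by blast
    then show "?K \<in> sets ?\<mu>" unfolding w(1) sets_restrict_space using borel_compact[OF s(3)] by blast
    show "emeasure ?\<mu> ?K < \<infinity>" by (rule w(3)[OF s(3,4)])
    show "AE x \<in> ?K in ?\<mu>. norm (\<theta> n x) \<le> 1" using \<theta>(3) by auto
    show "AE x in ?\<mu>. x \<notin> ?K \<longrightarrow> \<theta> n x = 0" using closure_subset[of "{x. \<theta> n x \<noteq> 0}"] by auto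
  qed (rule m)
  have "emeasure ?\<mu> \<Omega> = (\<integral>\<^sup>+x. liminf (\<lambda>n. ennreal (\<theta> n x)) \<partial>?\<mu>)"
  proof -
    have "liminf (\<lambda>n. ennreal (\<theta> n x)) = indicator \<Omega> x" for x
    proof -
      have "(\<lambda>n. ennreal (\<theta> n x)) \<longlonglongrightarrow> ennreal (indicator \<Omega> x)" by (rule tendsto_ennrealI[OF \<theta>(4)])
      from lim_imp_Liminf[OF _ this] show ?thesis by (simp add: ennreal_indicator)
    qed
    moreover have "\<Omega> \<in> sets ?\<mu>" using w(2) sets.top[of ?\<mu>] by simp
    ultimately show ?thesis by simp
  qed
  also have "\<dots> \<le> liminf (\<lambda>n. \<integral>\<^sup>+x. ennreal (\<theta> n x) \<partial>?\<mu>)"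
    using m by (intro nn_integral_liminf) measurable
  also have "\<dots> \<le> liminf (\<lambda>n. ennreal C)"
  proof (rule Liminf_mono, intro always_eventually allI)
    fix n
    have "(\<integral>\<^sup>+x. ennreal (\<theta> n x) \<partial>?\<mu>) = ennreal (\<integral>x. \<theta> n x \<partial>?\<mu>)"
      by (rule nn_integral_eq_integral[OF int]) (use \<theta>(3) in auto)
    also have "\<dots> \<le> ennreal C" by (rule ennreal_leI[OF le[OF \<theta>c \<theta>(2) \<theta>(3)]])
    finally show "(\<integral>\<^sup>+x. ennreal (\<theta> n x) \<partial>?\<mu>) \<le> ennreal C" .
  qed
  also have "\<dots> = ennreal C" by (simp add: Liminf_const)
  finally show ?thesis .
qed

section \<open>Limits of local minimizers\<close>

text \<open>The sequences are already indexed along the subsequence, and the energy bound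
  \<open>C\<close> is a nonnegative real, so that \<open>ennreal\<close> does not truncate
  it.\<close>

locale minimizer_limit =
  fixes \<Omega> :: "(real ^ 'n::finite) set" and \<epsilon> :: "nat \<Rightarrow> real" and u :: "nat \<Rightarrow> real ^ 'n \<Rightarrow> real"
    and C c :: real and u0 :: "real ^ 'n \<Rightarrow> real" and V :: "'n varifold"
  assumes bounded: "bounded \<Omega>" and opn: "open \<Omega>" and smooth: "smooth_boundary \<Omega>"
    and eps_pos: "\<And>i. 0 < \<epsilon> i" and eps_lim: "\<epsilon> \<longlonglongrightarrow> 0"
    and u_unit: "\<And>i. u i \<in> W12_unit \<Omega>" and u_classical: "\<And>i. classical_solution \<Omega> (\<epsilon> i) (u i)"
    and J_le: "\<And>i. J \<Omega> (\<epsilon> i) (u i) \<le> ennreal C" and C: "0 \<le> C"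
    and minimal: "\<And>i v. v \<in> W12_unit \<Omega> \<Longrightarrow> set_lebesgue_integral lebesgue \<Omega> (\<lambda>x. \<bar>u i x - v x\<bar>) < c \<Longrightarrow>
      J \<Omega> (\<epsilon> i) (u i) \<le> J \<Omega> (\<epsilon> i) v"
    and u0: "u0 \<in> BV_pm1 \<Omega>" and u_lim: "AE x in lebesgue. x \<in> \<Omega> \<longrightarrow> (\<lambda>i. u i x) \<longlonglongrightarrow> u0 x"
    and V: "is_varifold \<Omega> V" and V_lim: "varifold_tendsto \<Omega> (\<lambda>i. assoc_varifold \<Omega> (\<epsilon> i) (u i)) V"
begin

lemma open_borel: "\<Omega> \<in> sets borel"
  using opn by simp

lemma u_W12: "u i \<in> W12 \<Omega>" and u_le_1: "AE x in lebesgue. x \<in> \<Omega> \<longrightarrow> \<bar>u i x\<bar> \<le> 1"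
  using u_unit[of i] by (auto simp: W12_unit_def abs_le_iff minus_le_iff)

lemma u0_int: "set_integrable lebesgue \<Omega> u0" and u0_pm1: "AE x in lebesgue. x \<in> \<Omega> \<longrightarrow> u0 x \<in> {-1, 1}"
  using u0 by (auto simp: BV_pm1_def BV_def)

lemma one_int: "integrable lebesgue (\<lambda>x. indicator \<Omega> x *\<^sub>R (b :: real))"
  using set_integrable_continuous_bounded(1)[OF continuous_on_const bounded open_borel] by (simp only: set_integrable_def)

lemma u_measurable: "(\<lambda>x. indicator \<Omega> x *\<^sub>R u i x) \<in> borel_measurable lebesgue"
proof -
  have "u i \<in> borel_measurable (restrict_space lebesgue \<Omega>)"
    using u_W12 open_locally_integrable_measurable[OF opn] unfolding W12_def by blast
  then show ?thesis using borel_measurable_restrict_space_iff[of \<Omega> lebesgue "u i"] opn by simp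
qed

lemma u_int: "set_integrable lebesgue \<Omega> (u i)"
  unfolding set_integrable_def
proof (rule Bochner_Integration.integrable_bound[OF one_int[of 1] u_measurable])
  show "AE x in lebesgue. norm (indicator \<Omega> x *\<^sub>R u i x) \<le> norm (indicator \<Omega> x *\<^sub>R (1 :: real))"
    using u_le_1[of i] by eventually_elim (auto simp: indicator_def)
qed

lemma u0_measurable: "(\<lambda>x. indicator \<Omega> x *\<^sub>R u0 x) \<in> borel_measurable lebesgue"
  using u0_int by (auto simp: set_integrable_def dest: borel_measurable_integrable)

lemma u_tendsto_L1: "(\<lambda>i. set_lebesgue_integral lebesgue \<Omega> (\<lambda>x. \<bar>u i x - u0 x\<bar>)) \<longlonglongrightarrow> 0"
proof -
  have eq: "indicator \<Omega> x *\<^sub>R \<bar>u i x - u0 x\<bar> = \<bar>indicator \<Omega> x *\<^sub>R u i x - indicator \<Omega> x *\<^sub>R u0 x\<bar>" for i x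
    by (auto simp: indicator_def)
  have "(\<lambda>i. \<integral>x. \<bar>indicator \<Omega> x *\<^sub>R u i x - indicator \<Omega> x *\<^sub>R u0 x\<bar> \<partial>lebesgue) \<longlonglongrightarrow> (\<integral>x. 0 \<partial>(lebesgue :: (real ^ 'n) measure))"
  proof (rule integral_dominated_convergence[OF _ _ one_int[of 2]])
    show "AE x in lebesgue. (\<lambda>i. \<bar>indicator \<Omega> x *\<^sub>R u i x - indicator \<Omega> x *\<^sub>R u0 x\<bar>) \<longlonglongrightarrow> 0"
      using u_lim
    proof eventually_elim
      case (elim x)
      show ?case
      proof (cases "x \<in> \<Omega>")
        case True
        then have "(\<lambda>i. \<bar>u i x - u0 x\<bar>) \<longlonglongrightarrow> \<bar>u0 x - u0 x\<bar>" using elim by (intro tendsto_intros) auto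
        then show ?thesis using True by simp
      qed simp
    qed
    \<comment> \<open>Both functions take values in [-1, 1], so the constant 2 on the bounded set
      \<Omega> is a majorant.\<close>
    show "AE x in lebesgue. norm \<bar>indicator \<Omega> x *\<^sub>R u i x - indicator \<Omega> x *\<^sub>R u0 x\<bar> \<le> indicator \<Omega> x *\<^sub>R 2" for i
      using u_le_1[of i] u0_pm1 by eventually_elim (auto simp: indicator_def)
    show "(\<lambda>x. \<bar>indicator \<Omega> x *\<^sub>R u i x - indicator \<Omega> x *\<^sub>R u0 x\<bar>) \<in> borel_measurable lebesgue" for i
      using u_measurable[of i] u0_measurable by measurable
  qed simp
  then show ?thesis unfolding set_lebesgue_integral_def eq by simp
qed

lemma u_tendsto_test:
  assumes h: "continuous_on UNIV h" "\<And>x. \<bar>h x\<bar> \<le> B"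
  shows "(\<lambda>i. set_lebesgue_integral lebesgue \<Omega> (\<lambda>x. u i x * h x)) \<longlonglongrightarrow> set_lebesgue_integral lebesgue \<Omega> (\<lambda>x. u0 x * h x)"
proof -
  have eq: "indicator \<Omega> x *\<^sub>R (k x * h x) = (indicator \<Omega> x *\<^sub>R k x) * h x" for k :: "real ^ 'n \<Rightarrow> real" and x by simp
  have [measurable]: "h \<in> borel_measurable lebesgue"
    using borel_measurable_continuous_onI[OF h(1)] by (intro measurable_completion) auto
  show ?thesis unfolding set_lebesgue_integral_def eq
  proof (rule integral_dominated_convergence[OF _ _ one_int[of B]])
    show "(\<lambda>x. (indicator \<Omega> x *\<^sub>R u0 x) * h x) \<in> borel_measurable lebesgue" using u0_measurable by measurable
    show "(\<lambda>x. (indicator \<Omega> x *\<^sub>R u i x) * h x) \<in> borel_measurable lebesgue" for i using u_measurable[of i] by measurable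
    show "AE x in lebesgue. (\<lambda>i. (indicator \<Omega> x *\<^sub>R u i x) * h x) \<longlonglongrightarrow> (indicator \<Omega> x *\<^sub>R u0 x) * h x"
      using u_lim
    proof eventually_elim
      case (elim x)
      then show ?case by (cases "x \<in> \<Omega>") (auto intro: tendsto_intros)
    qed
    show "AE x in lebesgue. norm ((indicator \<Omega> x *\<^sub>R u i x) * h x) \<le> indicator \<Omega> x *\<^sub>R B" for i
      using u_le_1[of i]
    proof eventually_elim
      case (elim x)
      show ?case
      proof (cases "x \<in> \<Omega>")
        case True
        have "\<bar>u i x\<bar> * \<bar>h x\<bar> \<le> 1 * B" using elim True h(2)[of x] by (intro mult_mono) auto
        then show ?thesis using True by (simp add: abs_mult)
      qed simp
    qed
  qed
qed

lemma assoc_varifold_tendsto: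
  fixes f :: "real ^ 'n \<Rightarrow> real"
  assumes f: "continuous_on UNIV f" "compactly_supported_in f \<Omega>"
  shows "(\<lambda>i. \<integral>z. f (fst z) \<partial>assoc_varifold \<Omega> (\<epsilon> i) (u i)) \<longlonglongrightarrow> (\<integral>x. f x \<partial>weight \<Omega> V)"
  using V_lim[unfolded varifold_tendsto_def, THEN bspec, OF Cc_on_fst[OF f]]
  unfolding weight_facts(4)[OF V f(1)] .

text \<open>The bound for each index passes to the limit on both sides: on the left by dominated
  convergence against the bounded divergence, on the right by varifold convergence.\<close>

lemma weight_lower_bound:
  assumes p: "Ck_on 1 \<phi> UNIV" "compactly_supported_in \<phi> \<Omega>"
  shows "2 * set_lebesgue_integral lebesgue \<Omega> (\<lambda>x. u0 x * divergence \<phi> x) \<le> (\<integral>x. norm (\<phi> x) \<partial>weight \<Omega> V)"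
proof -
  note s = compactly_supported_inD[OF p(2)]
  have d: "continuous_on UNIV (divergence \<phi>)" using Ck_on_divergence[of 0 \<phi>] p(1) by simp
  obtain B where "\<And>x. norm (divergence \<phi> x) \<le> B"
    using bounded_range_bounded_support[OF d bounded_subset[OF compact_imp_bounded[OF s(3)] divergence_support]] by blast
  then have B: "\<bar>divergence \<phi> x\<bar> \<le> B" for x by simp
  have cp: "continuous_on UNIV (\<lambda>x. norm (\<phi> x))" by (intro continuous_on_norm Ck_on_imp_continuous[OF p(1)])
  have cn: "compactly_supported_in (\<lambda>x. norm (\<phi> x)) \<Omega>" using p(2) by (simp add: compactly_supported_in_def)
  show ?thesis
  proof (rule LIMSEQ_le[OF tendsto_mult_left[OF u_tendsto_test[OF d B]] assoc_varifold_tendsto[OF cp cn]], intro exI allI impI)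
    fix i
    show "2 * set_lebesgue_integral lebesgue \<Omega> (\<lambda>x. u i x * divergence \<phi> x) \<le> (\<integral>z. norm (\<phi> (fst z)) \<partial>assoc_varifold \<Omega> (\<epsilon> i) (u i))"
      by (rule assoc_varifold_lower_bound[OF opn u_W12 u_classical eps_pos J_le C p])
  qed
qed

text \<open>A recovery sequence for \<open>v\<close> competes with \<open>u i\<close>. Their L1
  distance is at most the sum of the distances from \<open>u i\<close> to \<open>u0\<close>, from
  \<open>u0\<close> to \<open>v\<close> and from \<open>v\<close> to the recovery sequence, and this
  stays below \<open>c\<close> for large indices.\<close>

lemma weight_upper_bound:
  assumes v: "v \<in> BV_pm1 \<Omega>" "set_lebesgue_integral lebesgue \<Omega> (\<lambda>x. \<bar>u0 x - v x\<bar>) < c"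
  shows "emeasure (weight \<Omega> V) \<Omega> \<le> 2 * variation \<Omega> v"
proof -
  have vi: "set_integrable lebesgue \<Omega> v" and "variation \<Omega> v < \<infinity>" using v(1) by (auto simp: BV_pm1_def BV_def)
  define W where "W = enn2real (variation \<Omega> v)"
  have W: "variation \<Omega> v = ennreal W" "0 \<le> W" using \<open>variation \<Omega> v < \<infinity>\<close> by (simp_all add: W_def)
  define d where "d = set_lebesgue_integral lebesgue \<Omega> (\<lambda>x. \<bar>u0 x - v x\<bar>)"
  have d: "d < c" using v(2) by (simp add: d_def)
  have "(\<integral>x. f x \<partial>weight \<Omega> V) \<le> 2 * W"
    if f: "continuous_on UNIV f" "compactly_supported_in f \<Omega>" "\<And>x. 0 \<le> f x \<and> f x \<le> 1" for f :: "real ^ 'n \<Rightarrow> real"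
  proof (rule field_le_epsilon)
    fix e :: real assume e: "0 < e"
    \<comment> \<open>The gap between \<open>d\<close> and \<open>c\<close> is shared equally by the
      two vanishing errors.\<close>
    define e' where "e' = min e ((c - d) / 2)"
    have e': "0 < e'" "e' \<le> e" "e' \<le> (c - d) / 2"
      using e d unfolding e'_def by (simp_all only: min_less_iff_conj min.cobounded1 min.cobounded2) simp
    have "filterlim \<epsilon> (at_right 0) sequentially"
    proof -
      have "\<epsilon> i \<noteq> 0" for i using eps_pos[of i] by simp
      then show ?thesis using eps_lim eps_pos by (simp add: filterlim_at)
    qed
    from eventually_compose_filterlim[OF recovery_exists[OF opn bounded smooth v(1) _ W(2) e'(1)] this]
    have rec: "\<forall>\<^sub>F i in sequentially. \<exists>v'. v' \<in> W12_unit \<Omega> \<and> set_integrable lebesgue \<Omega> v' \<and>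
      set_lebesgue_integral lebesgue \<Omega> (\<lambda>x. \<bar>v x - v' x\<bar>) < e' \<and> J \<Omega> (\<epsilon> i) v' \<le> ennreal (2 * W + e')"
      using W(1) by simp
    have near: "\<forall>\<^sub>F i in sequentially. set_lebesgue_integral lebesgue \<Omega> (\<lambda>x. \<bar>u i x - u0 x\<bar>) < (c - d) / 2"
      using d by (intro order_tendstoD(2)[OF u_tendsto_L1]) simp
    have "\<forall>\<^sub>F i in sequentially. (\<integral>z. f (fst z) \<partial>assoc_varifold \<Omega> (\<epsilon> i) (u i)) \<le> 2 * W + e"
      using rec near
    proof eventually_elim
      case (elim i)
      then obtain v' where v': "v' \<in> W12_unit \<Omega>" "set_integrable lebesgue \<Omega> v'"
        "set_lebesgue_integral lebesgue \<Omega> (\<lambda>x. \<bar>v x - v' x\<bar>) < e'" "J \<Omega> (\<epsilon> i) v' \<le> ennreal (2 * W + e')" by blast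
      have ab: "set_integrable lebesgue \<Omega> (\<lambda>x. \<bar>k x - l x\<bar>)"
        if "set_integrable lebesgue \<Omega> k" "set_integrable lebesgue \<Omega> l" for k l :: "real ^ 'n \<Rightarrow> real"
        by (rule set_integrable_abs[OF set_integral_diff(1)[OF that]])
      note i1 = ab[OF u_int[of i] u0_int] and i2 = ab[OF u0_int vi] and i3 = ab[OF vi v'(2)]
      have "set_lebesgue_integral lebesgue \<Omega> (\<lambda>x. \<bar>u i x - v' x\<bar>) \<le>
        set_lebesgue_integral lebesgue \<Omega> (\<lambda>x. (\<bar>u i x - u0 x\<bar> + \<bar>u0 x - v x\<bar>) + \<bar>v x - v' x\<bar>)"
      proof (rule set_integral_mono)
        show "set_integrable lebesgue \<Omega> (\<lambda>x. \<bar>u i x - v' x\<bar>)" by (rule ab[OF u_int v'(2)])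
        show "set_integrable lebesgue \<Omega> (\<lambda>x. (\<bar>u i x - u0 x\<bar> + \<bar>u0 x - v x\<bar>) + \<bar>v x - v' x\<bar>)"
          by (rule set_integral_add(1)[OF set_integral_add(1)[OF i1 i2] i3])
      qed auto
      also have "\<dots> = set_lebesgue_integral lebesgue \<Omega> (\<lambda>x. \<bar>u i x - u0 x\<bar>) + d + set_lebesgue_integral lebesgue \<Omega> (\<lambda>x. \<bar>v x - v' x\<bar>)"
        unfolding set_integral_add(2)[OF set_integral_add(1)[OF i1 i2] i3] set_integral_add(2)[OF i1 i2] d_def ..
      also have "\<dots> < c" using elim(2) v'(3) e'(3) by (simp add: field_simps)
      finally have "J \<Omega> (\<epsilon> i) (u i) \<le> J \<Omega> (\<epsilon> i) v'" by (intro minimal v'(1))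
      also note v'(4)
      also have "ennreal (2 * W + e') \<le> ennreal (2 * W + e)" using e' by (intro ennreal_leI) simp
      finally show ?case
        using e W(2) by (intro assoc_varifold_le_J[OF opn u_W12 eps_pos _ _ f]) auto
    qed
    then show "(\<integral>x. f x \<partial>weight \<Omega> V) \<le> 2 * W + e"
      by (rule tendsto_upperbound[OF assoc_varifold_tendsto[OF f(1,2)]]) simp
  qed
  then have "emeasure (weight \<Omega> V) \<Omega> \<le> ennreal (2 * W)" by (rule weight_le_if_test_integrals_le[OF V opn])
  then show ?thesis using W ennreal_mult[of 2 W] by simp
qed

lemma weight_open:
  assumes c: "0 < c" and U: "open U" "U \<subseteq> \<Omega>"
  shows "2 * variation U u0 = emeasure (weight \<Omega> V) U"
proof (rule weight_eq_variation[OF opn weight_facts(1)[OF V] _ _ u0_int weight_lower_bound U])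
  show "emeasure (weight \<Omega> V) \<Omega> \<le> 2 * variation \<Omega> u0"
    using c by (intro weight_upper_bound u0) (simp add: set_lebesgue_integral_def)
  show "variation \<Omega> u0 < \<infinity>" using u0 by (simp add: BV_pm1_def BV_def)
qed

text \<open>The factor 1/4 combines the half in \<open>variation_indicator_level\<close> with the
  half in passing from weight to variation; agreement on open sets then determines the perimeter
  measure.\<close>

lemma perimeter_measure_eq_weight:
  assumes c: "0 < c"
  shows "perimeter_measure \<Omega> {x \<in> \<Omega>. u0 x = 1} = scale_measure (ennreal (1 / 4)) (weight \<Omega> V)"
proof (rule perimeter_measure_eq[OF opn])
  show "sets (scale_measure (ennreal (1 / 4)) (weight \<Omega> V)) = sets (restrict_space borel \<Omega>)"
    by (simp add: weight_facts(1)[OF V])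
  have "variation \<Omega> u0 < \<infinity>" using u0 by (simp add: BV_pm1_def BV_def)
  then show "emeasure (scale_measure (ennreal (1 / 4)) (weight \<Omega> V)) \<Omega> < \<infinity>"
    by (simp add: weight_open[OF c opn order_refl, symmetric] ennreal_mult_less_top)
  fix U assume U: "open U" "U \<subseteq> \<Omega>"
  have "ennreal (1 / 4) * (2 * variation U u0) = ennreal (1 / 2) * variation U u0"
  proof -
    have "ennreal (1 / 4) * 2 = ennreal (1 / 2)" using ennreal_mult[of "1 / 4" 2] by simp
    then show ?thesis by (simp only: mult.assoc[symmetric])
  qed
  then show "variation U (indicator {x \<in> \<Omega>. u0 x = 1}) = emeasure (scale_measure (ennreal (1 / 4)) (weight \<Omega> V)) U"
    by (simp add: variation_indicator_level[OF opn bounded u0 U] weight_open[OF c U, symmetric])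
qed

end

lemma spt_scale_measure:
  assumes "r \<noteq> 0" shows "spt (scale_measure r M) = spt M"
  using assms by (simp add: spt_def space_scale_measure)

theorem theorem1p4:
  fixes \<Omega> :: "(real ^ 'n::finite) set"
    and \<epsilon> :: "nat \<Rightarrow> real"
    and u :: "nat \<Rightarrow> real ^ 'n \<Rightarrow> real"
    and E0 c :: real
    and r :: "nat \<Rightarrow> nat"
    and u0 :: "real ^ 'n \<Rightarrow> real"
    and V :: "'n varifold"
  assumes "bounded \<Omega>" and "connected \<Omega>" and "open \<Omega>" and "smooth_boundary \<Omega>"
    and "\<And>i. \<epsilon> i \<in> {0<..<1}" and "\<epsilon> \<longlonglongrightarrow> 0"
    and "\<And>i. u i \<in> W12_unit \<Omega>"
    and "\<And>i. classical_solution \<Omega> (\<epsilon> i) (u i)"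
    and "\<And>i. J \<Omega> (\<epsilon> i) (u i) \<le> ennreal E0"
    and "c > 0"
    and "\<And>i v. v \<in> W12_unit \<Omega> \<Longrightarrow>
           set_lebesgue_integral lebesgue \<Omega> (\<lambda>x. \<bar>u i x - v x\<bar>) < c \<Longrightarrow>
           J \<Omega> (\<epsilon> i) (u i) \<le> J \<Omega> (\<epsilon> i) v"
    and "strict_mono r"
    and "u0 \<in> BV_pm1 \<Omega>"
    and "AE x in lebesgue. x \<in> \<Omega> \<longrightarrow> (\<lambda>i. u (r i) x) \<longlonglongrightarrow> u0 x"
    and "is_varifold \<Omega> V"
    and "varifold_tendsto \<Omega> (\<lambda>i. assoc_varifold \<Omega> (\<epsilon> (r i)) (u (r i))) V"
  shows "(\<forall>v\<in>BV_pm1 \<Omega>. set_lebesgue_integral lebesgue \<Omega> (\<lambda>x. \<bar>u0 x - v x\<bar>) < c \<longrightarrow>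
            J0 \<Omega> u0 \<le> J0 \<Omega> v)
       \<and> spt (weight \<Omega> V) = spt (perimeter_measure \<Omega> {x \<in> \<Omega>. u0 x = 1})
       \<and> ((\<exists>C. \<forall>i. AE x in lebesgue. x \<in> transition_set \<Omega> (u i) \<longrightarrow>
              norm (hessian (u i) x) \<le> C * (1 / \<epsilon> i ^ 2)) \<longrightarrow>
          scale_measure (ennreal (1 / 4)) (weight \<Omega> V) =
            perimeter_measure \<Omega> {x \<in> \<Omega>. u0 x = 1})"
proof -
  \<comment> \<open>A negative \<open>E0\<close> counts as 0 under \<open>ennreal\<close>, so
    \<open>max E0 0\<close> is an equivalent nonnegative bound.\<close>
  interpret minimizer_limit \<Omega> "\<lambda>i. \<epsilon> (r i)" "\<lambda>i. u (r i)" "max E0 0" c u0 V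
  proof
    show "(\<lambda>i. \<epsilon> (r i)) \<longlonglongrightarrow> 0"
      using LIMSEQ_subseq_LIMSEQ[OF assms(6) assms(12)] by (simp add: o_def)
    show "0 < \<epsilon> (r i)" for i using assms(5)[of "r i"] by simp
    show "J \<Omega> (\<epsilon> (r i)) (u (r i)) \<le> ennreal (max E0 0)" for i
      by (rule order_trans[OF assms(9) ennreal_leI]) simp
  qed (use assms in simp_all)
  have "J0 \<Omega> u0 \<le> J0 \<Omega> v" if v: "v \<in> BV_pm1 \<Omega>" "set_lebesgue_integral lebesgue \<Omega> (\<lambda>x. \<bar>u0 x - v x\<bar>) < c" for v
  proof -
    \<comment> \<open>Minimality is read off from the total weight: it equals \<open>J0\<close> of
      the limit and is bounded by \<open>J0\<close> of every competitor within distance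
      \<open>c\<close>.\<close>
    have "J0 \<Omega> u0 = emeasure (weight \<Omega> V) \<Omega>"
      using weight_open[OF assms(10) opn order_refl] u0 by (simp add: J0_def)
    also have "\<dots> \<le> 2 * variation \<Omega> v" by (rule weight_upper_bound[OF v])
    also have "\<dots> = J0 \<Omega> v" using v(1) by (simp add: J0_def)
    finally show ?thesis .
  qed
  then show ?thesis
    by (simp add: perimeter_measure_eq_weight[OF assms(10)] spt_scale_measure)
qed

end
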